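(* The following two statements are equivalent: (i) (Winding Number Conjecture) For all positive integers $d$ and $q$, every continuous map $f:\Delta_{d-1}^{(d+1)(q-1)}\to\mathbb{R}^d$ has a winding partition. (ii) (Topological Tverberg Theorem) For all positive integers $d$ and $q$, every continuous map $f:\Delta^{(d+1)(q-1)}\to\mathbb{R}^d$ has a Tverberg partition.
   Context: For integers $N\ge 0$ and $0\le k\le N$, $\Delta^N$ denotes the $N$-dimensional simplex (with $N+1$ vertices) and $\Delta^N_k$ its $k$-skeleton; faces are identified with their geometric realizations, and two faces are disjoint if they share no vertex. For a map $f$ from $\Delta_k^{(d+1)(q-1)}$ to $\mathbb{R}^d$, a Tverberg partition of $f$ is a set of $q$ pairwise disjoint faces $\sigma_1,\dots,\sigma_q$ of $\Delta_k^{(d+1)(q-1)}$ with $\bigcap_i f(\sigma_i)\neq\emptyset$. Winding numbers: let $\partial\Delta^d=\Delta^d_{d-1}\cong\mathbb{S}^{d-1}$. For a continuous $g:\partial\Delta^d\to\mathbb{R}^d$ and $p\notin g(\partial\Delta^d)$: if $d\ge2$, "$W(g,p)\neq0$" means that $g$ represents a nonzero element of $\pi_{d-1}(\mathbb{R}^d\setminus\{p\})\cong\mathbb{Z}$ (i.e. $g$ is not null-homotopic in $\mathbb{R}^d\setminus\{p\}$); if $d=1$, "$W(g,p)\ne 0$" means that the two points of $g(\partial\Delta^1)$ lie in different components of $\mathbb{R}\setminus\{p\}$. Set $W_{\neq0}(g):=g(\partial\Delta^d)\cup\{x\in\mathbb{R}^d\setminus g(\partial\Delta^d): W(g,x)\neq0\}$.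 For a continuous $f:\Delta_{d-1}^{(d+1)(q-1)}\to\mathbb{R}^d$, a winding partition of $f$ is a set of $q$ pairwise disjoint faces $\sigma_1,\dots,\sigma_q$ of $\Delta^{(d+1)(q-1)}$, each of dimension at most $d$, for which there exists a point $p\in\mathbb{R}^d$ (a winding point) such that for every $i$: if $\dim\sigma_i\le d-1$ then $p\in f(\sigma_i)$, and if $\dim\sigma_i=d$ then $p\in W_{\neq0}(f|_{\partial\sigma_i})$. *)

theory Defs
  imports "HOL-Homology.Homology"
begin

text \<open>
  The simplex with \<open>N + 1\<close> vertices is \<^term>\<open>standard_simplex N\<close>. Its faces are represented by
  their nonempty vertex sets \<open>S \<subseteq> {..N}\<close>, so that faces are disjoint in the sense of sharing no
  vertex iff they are disjoint as sets. Points are functions \<open>nat \<Rightarrow> real\<close> with finitely many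
  nonzero coordinates, topologised by the product topology; a map is a total function of which only
  the values on its domain matter.
\<close>

definition face_dim :: "nat set \<Rightarrow> nat" where
  "face_dim S = card S - 1"

definition simplex_faces :: "nat \<Rightarrow> nat \<Rightarrow> nat set set" where
  "simplex_faces N k = {S. S \<subseteq> {..N} \<and> S \<noteq> {} \<and> face_dim S \<le> k}"

definition face_realization :: "nat set \<Rightarrow> (nat \<Rightarrow> real) set" where
  "face_realization S = {x. (\<forall>i. 0 \<le> x i) \<and> (\<forall>i. i \<notin> S \<longrightarrow> x i = 0) \<and> (\<Sum>i\<in>S. x i) = 1}"

text \<open>For \<open>k \<ge> N\<close> the following is the whole simplex.\<close>

definition simplex_skeleton :: "nat \<Rightarrow> nat \<Rightarrow> (nat \<Rightarrow> real) set" where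
  "simplex_skeleton N k = (\<Union>S\<in>simplex_faces N k. face_realization S)"

definition face_boundary :: "nat set \<Rightarrow> (nat \<Rightarrow> real) set" where
  "face_boundary S = (\<Union>T\<in>{T. T \<subset> S \<and> T \<noteq> {}}. face_realization T)"

abbreviation space_on :: "(nat \<Rightarrow> real) set \<Rightarrow> (nat \<Rightarrow> real) topology" where
  "space_on A \<equiv> subtopology (powertop_real UNIV) A"

abbreviation punctured_space :: "nat \<Rightarrow> (nat \<Rightarrow> real) \<Rightarrow> (nat \<Rightarrow> real) topology" where
  "punctured_space d p \<equiv> subtopology (Euclidean_space d) (- {p})"

text \<open>
  In the next two definitions \<open>S\<close> is a \<open>d\<close>-dimensional face and \<open>g\<close> a map on its boundary; \<open>p\<close> is
  assumed not to lie in the image of \<open>g\<close>. For \<open>d = 1\<close> the boundary consists of the two vertices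
  of \<open>S\<close>. For \<open>d \<ge> 2\<close>, null-homotopy is free, so it does not depend on an identification of the
  boundary with a sphere; it amounts to triviality in the homotopy group, as a map from a sphere is
  freely null-homotopic iff it is null-homotopic relative to a base point.
\<close>

definition winding_nonzero ::
  "nat \<Rightarrow> nat set \<Rightarrow> ((nat \<Rightarrow> real) \<Rightarrow> nat \<Rightarrow> real) \<Rightarrow> (nat \<Rightarrow> real) \<Rightarrow> bool" where
  "winding_nonzero d S g p \<longleftrightarrow>
     (if d = 1
      then \<exists>a\<in>face_boundary S. \<exists>b\<in>face_boundary S.
             \<not> connected_component_of (punctured_space d p) (g a) (g b)
      else \<not> (\<exists>c. homotopic_with (\<lambda>_. True) (space_on (face_boundary S)) (punctured_space d p)
                    g (\<lambda>_. c)))"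

definition winding_set ::
  "nat \<Rightarrow> nat set \<Rightarrow> ((nat \<Rightarrow> real) \<Rightarrow> nat \<Rightarrow> real) \<Rightarrow> (nat \<Rightarrow> real) set" where
  "winding_set d S g =
     g ` face_boundary S \<union>
     {x \<in> topspace (Euclidean_space d) - g ` face_boundary S. winding_nonzero d S g x}"

definition tverberg_partition ::
  "nat \<Rightarrow> nat \<Rightarrow> nat \<Rightarrow> ((nat \<Rightarrow> real) \<Rightarrow> nat \<Rightarrow> real) \<Rightarrow> nat set set \<Rightarrow> bool" where
  "tverberg_partition d q k f F \<longleftrightarrow>
     F \<subseteq> simplex_faces ((d + 1) * (q - 1)) k \<and> card F = q \<and> pairwise disjnt F \<and>
     (\<Inter>S\<in>F. f ` face_realization S) \<noteq> {}"

definition winding_partition ::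
  "nat \<Rightarrow> nat \<Rightarrow> ((nat \<Rightarrow> real) \<Rightarrow> nat \<Rightarrow> real) \<Rightarrow> nat set set \<Rightarrow> bool" where
  "winding_partition d q f F \<longleftrightarrow>
     F \<subseteq> simplex_faces ((d + 1) * (q - 1)) d \<and> card F = q \<and> pairwise disjnt F \<and>
     (\<exists>p\<in>topspace (Euclidean_space d). \<forall>S\<in>F.
        (face_dim S \<le> d - 1 \<longrightarrow> p \<in> f ` face_realization S) \<and>
        (face_dim S = d \<longrightarrow> p \<in> winding_set d S f))"

lemma face_realization_subset_standard_simplex:
  assumes "S \<subseteq> {..N}"
  shows "face_realization S = {x \<in> standard_simplex N. \<forall>i. i \<notin> S \<longrightarrow> x i = 0}"
proof -
  have fin: "finite S" using assms finite_subset by blast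
  have sum_eq: "(\<Sum>i\<le>N. x i) = (\<Sum>i\<in>S. x i)" if "\<forall>i. i \<notin> S \<longrightarrow> x i = 0" for x :: "nat \<Rightarrow> real"
  proof (rule sum.mono_neutral_right)
    show "\<forall>i\<in>{..N} - S. x i = 0" using that by blast
  qed (use assms in simp_all)
  show ?thesis
  proof (intro equalityI subsetI)
    fix x assume "x \<in> face_realization S"
    then have nonneg: "\<And>i. 0 \<le> x i" and zero: "\<forall>i. i \<notin> S \<longrightarrow> x i = 0" and one: "(\<Sum>i\<in>S. x i) = 1"
      unfolding face_realization_def by blast+
    have "x i \<le> 1" for i
    proof (cases "i \<in> S")
      case True
      then have "x i \<le> (\<Sum>i\<in>S. x i)"
        by (rule member_le_sum) (use nonneg fin in simp_all)
      with one show ?thesis by simp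
    next
      case False
      with zero show ?thesis by simp
    qed
    moreover have "\<forall>i>N. x i = 0"
    proof (intro allI impI)
      fix i assume "N < i"
      then have "i \<notin> S" using assms by (meson atMost_iff not_le subsetD)
      with zero show "x i = 0" by blast
    qed
    moreover have "(\<Sum>i\<le>N. x i) = 1" using sum_eq[OF zero] one by simp
    ultimately show "x \<in> {x \<in> standard_simplex N. \<forall>i. i \<notin> S \<longrightarrow> x i = 0}"
      using nonneg zero unfolding standard_simplex_def by blast
  next
    fix x assume x: "x \<in> {x \<in> standard_simplex N. \<forall>i. i \<notin> S \<longrightarrow> x i = 0}"
    then have zero: "\<forall>i. i \<notin> S \<longrightarrow> x i = 0" and "\<forall>i. 0 \<le> x i" and "(\<Sum>i\<le>N. x i) = 1"
      unfolding standard_simplex_def by blast+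
    with sum_eq[OF zero] show "x \<in> face_realization S"
      unfolding face_realization_def by simp
  qed
qed

lemma simplex_skeleton_full: "simplex_skeleton N N = standard_simplex N"
proof
  show "simplex_skeleton N N \<subseteq> standard_simplex N"
    unfolding simplex_skeleton_def
  proof (rule UN_least)
    fix S assume "S \<in> simplex_faces N N"
    then have "S \<subseteq> {..N}" by (simp add: simplex_faces_def)
    from face_realization_subset_standard_simplex[OF this]
    show "face_realization S \<subseteq> standard_simplex N" by blast
  qed
  have "x i = 0" if "x \<in> standard_simplex N" "i \<notin> {..N}" for x i
    using that by (simp add: standard_simplex_def)
  then have "face_realization {..N} = standard_simplex N"
    unfolding face_realization_subset_standard_simplex[OF order_refl] by blast
  moreover have "{..N} \<in> simplex_faces N N"
    by (simp add: simplex_faces_def face_dim_def)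
  ultimately show "standard_simplex N \<subseteq> simplex_skeleton N N"
    unfolding simplex_skeleton_def by blast
qed

end

theory Submission
  imports Defs "Jordan_Normal_Form.Determinant"
begin

text \<open>
  If a winding partition of the restriction of \<open>f\<close> to the \<open>(d - 1)\<close>-skeleton is given, then each of
  its \<open>d\<close>-faces \<open>S\<close> must contain the winding point in \<open>f(S)\<close>: otherwise the contraction of \<open>S\<close> would
  make \<open>f\<close> null-homotopic on the boundary of \<open>S\<close>.

  For the converse let \<open>f\<close> be a map on the \<open>(d - 1)\<close>-skeleton of the simplex with \<open>N = (d + 1)(q - 1)\<close>.
  Winding partitions survive uniform limits, so \<open>f\<close> may be replaced by a generic piecewise affine map:
  disjoint faces whose codimensions add up to more than \<open>d\<close> have no common image point, and those whose
  codimensions add up to \<open>d\<close> have common image points only in a finite set \<open>P\<close>. The Tverberg theorem is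
  then used one dimension higher. The simplex with \<open>N + q\<close> vertices maps to a cone over the old simplex,
  and the cone is mapped to \<open>\<real>\<^sup>d \<times> \<real>\<close> with height at most zero on the base and at least zero on the cone
  over the \<open>(d - 1)\<close>-skeleton. As one of \<open>q\<close> disjoint faces contains no new vertex and one has at most
  \<open>d\<close> old vertices, a Tverberg point has height zero, and a count of vertices shows that it lies in
  \<open>P\<close> and that every face has at most \<open>d + 1\<close> old vertices. It remains to arrange that the cone over a
  \<open>d\<close>-face \<open>T\<close> misses every point of \<open>P\<close> around which \<open>T\<close> does not wind. On the boundary of that cone
  the map is a suspension of \<open>f\<close> on the boundary of \<open>T\<close>, and after one suspension a map that is
  null-homotopic in the complement of each single point of \<open>P\<close> is null-homotopic in the complement of
  \<open>P\<close>; without the suspension this fails for \<open>d = 2\<close>, as commutators in the fundamental group show.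
\<close>

section \<open>Homotopies between maps into coordinate spaces\<close>

text \<open>The count of vertices: \<open>N + 1 = q * (d + 1) - d\<close>, so for \<open>q\<close>
  disjoint sets of old vertices the integers \<open>d + 1 - card\<close> add up to at least
  \<open>d\<close>. General position lets the sets with at most \<open>d\<close> elements contribute
  at most \<open>d\<close>, and larger sets contribute at most zero. So equality holds throughout,
  which puts the point into \<open>P\<close> and rules out sets with more than \<open>d + 1\<close>
  elements. The suspension helps because a vertical path can be cut into two successive pieces. If a
  hyperplane separates \<open>P\<close> into two groups, each piece is pushed into one half space
  and has to avoid one group only, so that two unrelated null-homotopies run side by side without
  interfering. The ends of the paths have to keep the signs of their heights because the homotopy is
  blended there with the values prescribed on the boundary of the cone: points whose heights have
  the same nonzero sign can be joined by a segment that misses \<open>P\<close>.\<close>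

definition eucl :: "nat \<Rightarrow> (nat \<Rightarrow> real) set" where
  "eucl d = {x. \<forall>i\<ge>d. x i = 0}"

text \<open>One notion of triviality for every \<open>d\<close>; for \<open>d = 1\<close> it takes
  the place of the components in \<open>winding_nonzero\<close>, which
  \<open>winding_nonzero_iff\<close> justifies.\<close>

definition null_in :: "'a::topological_space set \<Rightarrow> (nat \<Rightarrow> real) set \<Rightarrow> ('a \<Rightarrow> nat \<Rightarrow> real) \<Rightarrow> bool" where
  "null_in X U f \<longleftrightarrow> (\<exists>c. homotopic_with_canon (\<lambda>_. True) X U f (\<lambda>_. c))"

lemma space_on_eq: "space_on A = top_of_set A"
  by (simp add: euclidean_product_topology)

lemma Euclidean_space_eq: "Euclidean_space d = top_of_set (eucl d)"
  by (simp add: Euclidean_space_def eucl_def euclidean_product_topology)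

lemma punctured_space_eq: "punctured_space d p = top_of_set (eucl d - {p})"
  by (simp add: Euclidean_space_eq subtopology_subtopology Diff_eq)

lemma continuous_map_Euclidean_space:
  "continuous_map (space_on A) (Euclidean_space d) f \<longleftrightarrow> continuous_on A f \<and> f ` A \<subseteq> eucl d"
  by (simp add: space_on_eq Euclidean_space_eq image_subset_iff_funcset)

lemma continuous_on_coordinate:
  fixes f :: "'a::topological_space \<Rightarrow> nat \<Rightarrow> real"
  assumes "continuous_on S f"
  shows "continuous_on S (\<lambda>x. f x i)"
  using assms by (rule continuous_on_product_then_coordinatewise)

lemma homotopic_with_canonI:
  fixes a b :: "'a::topological_space \<Rightarrow> 'b::topological_space"
  assumes h: "continuous_on ({0..1::real} \<times> W) h"
    and U: "\<And>s w. s \<in> {0..1} \<Longrightarrow> w \<in> W \<Longrightarrow> h (s, w) \<in> U"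
    and "\<And>w. h (0, w) = a w" "\<And>w. h (1, w) = b w"
    and "\<And>s. s \<in> {0..1} \<Longrightarrow> Q (\<lambda>w. h (s, w))"
  shows "homotopic_with_canon Q W U a b"
  unfolding homotopic_with_def
proof (intro exI[of _ h] conjI ballI allI)
  show "continuous_map (prod_topology (top_of_set {0..1}) (top_of_set W)) (top_of_set U) h"
    using h U by (auto simp: prod_topology_subtopology_eu Pi_iff)
qed (use assms in auto)

lemma homotopic_with_canonE:
  fixes a b :: "'a::topological_space \<Rightarrow> 'b::topological_space"
  assumes "homotopic_with_canon Q W U a b"
  obtains h where "continuous_on ({0..1::real} \<times> W) h"
    "\<And>s w. s \<in> {0..1} \<Longrightarrow> w \<in> W \<Longrightarrow> h (s, w) \<in> U"
    "\<And>w. h (0, w) = a w" "\<And>w. h (1, w) = b w"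
    "\<And>s. s \<in> {0..1} \<Longrightarrow> Q (\<lambda>w. h (s, w))"
proof -
  obtain h where h: "continuous_map (prod_topology (top_of_set {0..1::real}) (top_of_set W)) (top_of_set U) h"
    "\<And>w. h (0, w) = a w" "\<And>w. h (1, w) = b w" "\<And>s. s \<in> {0..1} \<Longrightarrow> Q (\<lambda>w. h (s, w))"
    using assms unfolding homotopic_with_def by blast
  from h(1) have "continuous_on ({0..1::real} \<times> W) h" "h ` ({0..1} \<times> W) \<subseteq> U"
    by (simp_all add: prod_topology_subtopology_eu image_subset_iff_funcset)
  then have "h (s, w) \<in> U" if "s \<in> {0..1}" "w \<in> W" for s w
    using that by blast
  with \<open>continuous_on ({0..1} \<times> W) h\<close> show thesis
    using h(2-4) by (rule that)
qed

lemma homotopic_with_linear_coordinates: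
  fixes a b :: "'a::topological_space \<Rightarrow> nat \<Rightarrow> real"
  assumes a: "continuous_on W a" and b: "continuous_on W b"
    and U: "\<And>s w. s \<in> {0..1} \<Longrightarrow> w \<in> W \<Longrightarrow> (\<lambda>j. (1 - s) * a w j + s * b w j) \<in> U"
    and Q: "\<And>s. s \<in> {0..1} \<Longrightarrow> Q (\<lambda>w j. (1 - s) * a w j + s * b w j)"
  shows "homotopic_with_canon Q W U a b"
proof (rule homotopic_with_canonI[where h = "\<lambda>z j. (1 - fst z) * a (snd z) j + fst z * b (snd z) j"])
  have ca: "continuous_on ({0..1::real} \<times> W) (\<lambda>z. a (snd z))"
    by (rule continuous_on_compose2[OF a]) (auto intro: continuous_on_snd continuous_on_id)
  have cb: "continuous_on ({0..1::real} \<times> W) (\<lambda>z. b (snd z))"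
    by (rule continuous_on_compose2[OF b]) (auto intro: continuous_on_snd continuous_on_id)
  show "continuous_on ({0..1} \<times> W) (\<lambda>z j. (1 - fst z) * a (snd z) j + fst z * b (snd z) j)"
    by (intro continuous_intros continuous_on_coordinate[OF ca] continuous_on_coordinate[OF cb])
qed (use U Q in auto)

section \<open>Null-homotopies after suspension\<close>

definition rises :: "nat \<Rightarrow> 'a set \<Rightarrow> ('a \<times> real \<Rightarrow> nat \<Rightarrow> real) \<Rightarrow> bool" where
  "rises d X b \<longleftrightarrow> (\<forall>x\<in>X. 0 < b (x, 1) d \<and> b (x, -1) d < 0)"

text \<open>Points of \<open>eucl d\<close> use the indices below \<open>d\<close>, so index
  \<open>d\<close> is free to hold the height.\<close>

definition vlift :: "nat \<Rightarrow> ('a \<Rightarrow> nat \<Rightarrow> real) \<Rightarrow> 'a \<times> real \<Rightarrow> nat \<Rightarrow> real" where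
  "vlift d f z = (f (fst z))(d := snd z)"

text \<open>A suspension is treated as a family of paths: \<open>x\<close> gives the vertical path through \<open>f x\<close>, whose ends
  have to stay below and above height zero during the homotopy.\<close>

definition susp_null ::
  "nat \<Rightarrow> 'a::topological_space set \<Rightarrow> (nat \<Rightarrow> real) set \<Rightarrow> ('a \<Rightarrow> nat \<Rightarrow> real) \<Rightarrow> bool" where
  "susp_null d X P f \<longleftrightarrow>
     (\<exists>\<beta>. homotopic_with_canon (rises d X) (X \<times> {-1..1}) (eucl (d + 1) - P)
            (vlift d f) (\<lambda>z. \<beta> (snd z)))"

definition clamp01 :: "real \<Rightarrow> real" where
  "clamp01 t = max 0 (min 1 t)"

definition clamp11 :: "real \<Rightarrow> real" where
  "clamp11 t = max (-1) (min 1 t)"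

lemma clamp01_range: "0 \<le> clamp01 t" "clamp01 t \<le> 1" "clamp01 t \<in> {0..1}"
  by (auto simp: clamp01_def)

lemma clamp11_range: "clamp11 t \<in> {-1..1}"
  by (auto simp: clamp11_def)

lemma continuous_on_clamp [continuous_intros]:
  assumes "continuous_on S f"
  shows "continuous_on S (\<lambda>x. clamp01 (f x))" "continuous_on S (\<lambda>x. clamp11 (f x))"
  unfolding clamp01_def clamp11_def by (intro continuous_intros assms)+

lemma continuous_on_fun_upd [continuous_intros]:
  fixes f :: "'a::topological_space \<Rightarrow> nat \<Rightarrow> real"
  assumes "continuous_on S f" "continuous_on S g"
  shows "continuous_on S (\<lambda>x. (f x)(d := g x))"
proof (rule continuous_on_coordinatewise_then_product)
  fix i show "continuous_on S (\<lambda>x. ((f x)(d := g x)) i)"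
    using assms continuous_on_coordinate[OF assms(1), of i] by (cases "i = d") auto
qed

lemma continuous_on_vlift:
  assumes "continuous_on X f" "continuous_on S g" "continuous_on S h" "g ` S \<subseteq> X"
  shows "continuous_on S (\<lambda>w. vlift d f (g w, h w))"
  unfolding vlift_def fst_conv snd_conv
  by (intro continuous_on_fun_upd continuous_on_compose2[OF assms(1,2,4)] assms(3))

text \<open>The null-homotopy is run at all heights at once. As \<open>P\<close> lies at height
  zero, a collision could only happen in the slice of height zero, and there the moving point is
  that of the given homotopy.\<close>

lemma null_in_imp_susp_null:
  assumes null: "null_in X (eucl d - P) f" and P: "P \<subseteq> eucl d"
  shows "susp_null d X P f"
proof -
  obtain c h where h: "continuous_on ({0..1::real} \<times> X) h"
    "\<And>s w. s \<in> {0..1} \<Longrightarrow> w \<in> X \<Longrightarrow> h (s, w) \<in> eucl d - P"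
    "\<And>w. h (0, w) = f w" "\<And>w. h (1, w) = c"
    using null unfolding null_in_def by (elim exE homotopic_with_canonE) blast
  have "homotopic_with_canon (rises d X) (X \<times> {-1..1}) (eucl (d + 1) - P)
            (vlift d f) (\<lambda>z. c(d := snd z))"
  proof (rule homotopic_with_canonI[where h = "\<lambda>w. (h (fst w, fst (snd w)))(d := snd (snd w))"])
    show "continuous_on ({0..1} \<times> X \<times> {-1..1})
       (\<lambda>w. (h (fst w, fst (snd w)))(d := snd (snd w)))"
      by (intro continuous_intros continuous_on_compose2[OF h(1)]) auto
    fix s :: real and w :: "'a \<times> real"
    assume s: "s \<in> {0..1}" and w: "w \<in> X \<times> {-1..1}"
    have e: "h (s, fst w) \<in> eucl d - P" using h(2)[OF s] w by auto
    let ?y = "(h (s, fst w))(d := snd w)"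
    have "?y \<notin> P"
    proof
      assume y: "?y \<in> P"
      then have "snd w = 0" using subsetD[OF P y] by (simp add: eucl_def) (metis order_refl)
      moreover have "h (s, fst w) d = 0" using e by (simp add: eucl_def)
      ultimately have "?y = h (s, fst w)" by (metis fun_upd_triv)
      then show False using y e by simp
    qed
    then show "(h (fst (s, w), fst (snd (s, w))))(d := snd (snd (s, w))) \<in> eucl (d + 1) - P"
      using e by (auto simp: eucl_def)
  qed (auto simp: vlift_def rises_def h(3,4))
  then show ?thesis unfolding susp_null_def by blast
qed

text \<open>The path \<open>u\<close>, pushed to the side \<open>c \<le> x\<^sub>i\<close>, is followed by the path \<open>v\<close>, pushed to the other
  side; in between, the path descends through the point of the hyperplane \<open>x\<^sub>i = c\<close> at height zero
  where the time \<open>t\<close> is zero.\<close>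

definition zigzag ::
  "nat \<Rightarrow> real \<Rightarrow> real \<Rightarrow> (nat \<Rightarrow> real) \<Rightarrow> (nat \<Rightarrow> real) \<Rightarrow> nat \<Rightarrow> real" where
  "zigzag i c t u v j =
     clamp01 (-t) * (if j = i then max c (u j) else u j) +
     clamp01 t * (if j = i then min c (v j) else v j) +
     (1 - clamp01 (-t) - clamp01 t) * (if j = i then c else 0)"

lemma zigzag_simps:
  "t \<le> -1 \<Longrightarrow> zigzag i c t u v j = (if j = i then max c (u j) else u j)"
  "-1 \<le> t \<Longrightarrow> t \<le> 0 \<Longrightarrow> j \<noteq> i \<Longrightarrow> zigzag i c t u v j = - t * u j"
  "0 \<le> t \<Longrightarrow> t \<le> 1 \<Longrightarrow> j \<noteq> i \<Longrightarrow> zigzag i c t u v j = t * v j"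
  "1 \<le> t \<Longrightarrow> zigzag i c t u v j = (if j = i then min c (v j) else v j)"
  "zigzag i c 0 u v i = c"
  by (auto simp: zigzag_def clamp01_def)

lemma continuous_on_zigzag:
  assumes "continuous_on S t" "continuous_on S u" "continuous_on S v"
  shows "continuous_on S (\<lambda>w. zigzag i c (t w) (u w) (v w))"
proof (rule continuous_on_coordinatewise_then_product)
  fix j
  note cu = continuous_on_coordinate[OF assms(2), of j]
  note cv = continuous_on_coordinate[OF assms(3), of j]
  show "continuous_on S (\<lambda>w. zigzag i c (t w) (u w) (v w) j)"
    by (cases "j = i"; simp add: zigzag_def cong del: if_weak_cong; (use cu cv in simp)?;
        intro continuous_intros assms(1) cu cv; use cu cv in simp)
qed

text \<open>A point of \<open>P\<close> lies strictly beyond \<open>c\<close> in direction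
  \<open>i\<close>, where pushing to the side \<open>c \<le> x i\<close> changes nothing, so on the
  first part a collision with \<open>P\<close> would already be one of \<open>u\<close>, and the
  push excludes \<open>Q\<close>; symmetrically for \<open>v\<close> on the last part. On the
  passage in between, the height is \<open>- t * u d\<close> or \<open>t * v d\<close>, hence
  nonzero for \<open>t \<noteq> 0\<close>, while for \<open>t = 0\<close> the point lies on the
  hyperplane.\<close>

lemma zigzag_avoids:
  assumes P: "P \<subseteq> eucl d" "\<And>p. p \<in> P \<Longrightarrow> c < p i" and Q: "Q \<subseteq> eucl d" "\<And>p. p \<in> Q \<Longrightarrow> p i < c"
    and i: "i < d" and u: "u \<in> eucl (d + 1) - P" "-1 < t \<Longrightarrow> 0 < u d"
    and v: "v \<in> eucl (d + 1) - Q" "t < 1 \<Longrightarrow> v d < 0"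
  shows "zigzag i c t u v \<in> eucl (d + 1) - (P \<union> Q)"
proof -
  let ?w = "zigzag i c t u v"
  have "?w \<in> eucl (d + 1)"
    using u v i by (auto simp: eucl_def zigzag_def)
  moreover have "?w \<notin> P \<union> Q"
  proof
    assume w: "?w \<in> P \<union> Q"
    then have wd: "?w d = 0" using P Q by (auto simp: eucl_def)
    have wi: "?w i > c \<and> ?w \<in> P \<or> ?w i < c \<and> ?w \<in> Q" using w P Q by blast
    consider "t \<le> -1" | "-1 < t" "t < 0" | "t = 0" | "0 < t" "t < 1" | "1 \<le> t" by linarith
    then show False
    proof cases
      case 1
      then have i1: "?w i = max c (u i)" and j1: "\<And>j. j \<noteq> i \<Longrightarrow> ?w j = u j"
        by (simp_all add: zigzag_simps)
      have "?w = u"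
      proof
        fix j show "?w j = u j" using i1 j1 wi by (cases "j = i") auto
      qed
      then show False using u wi i1 by auto
    next
      case 2
      then have "?w d = - t * u d" using i by (intro zigzag_simps) auto
      with 2 u(2) wd show False by auto
    next
      case 3
      then show False using wi by (auto simp: zigzag_simps)
    next
      case 4
      then have "?w d = t * v d" using i by (intro zigzag_simps) auto
      with 4 v(2) wd show False by auto
    next
      case 5
      then have i1: "?w i = min c (v i)" and j1: "\<And>j. j \<noteq> i \<Longrightarrow> ?w j = v j"
        by (simp_all add: zigzag_simps)
      have "?w = v"
      proof
        fix j show "?w j = v j" using i1 j1 wi by (cases "j = i") auto
      qed
      then show False using v wi i1 by auto
    qed
  qed
  ultimately show ?thesis by blast
qed

text \<open>When both \<open>u\<close> and \<open>v\<close> are the vertical path through \<open>y\<close>, the part of the zigzag that is not vertical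
  over \<open>y\<close> can be lifted (for \<open>y\<close> above the hyperplane) or lowered (for \<open>y\<close> below it) away from height
  zero. In a slab around the hyperplane both motions are harmless, so \<open>E\<close> interpolates between them.\<close>

lemma zigzag_vlift_avoids:
  assumes P: "R \<subseteq> eucl d" "\<And>p. p \<in> R \<Longrightarrow> \<eta> < \<bar>p i - c\<bar>" and i: "i < d" and \<eta>: "0 < \<eta>"
    and y: "y \<in> eucl d - R" and t: "-3 \<le> t" "t \<le> 3"
    and r: "0 \<le> r" "r \<le> 1" and s: "0 \<le> s" "s \<le> 1" and rs: "r = 0 \<or> s = 1"
    and a: "a = zigzag i c t (y(d := clamp11 (t + 2))) (y(d := clamp11 (t - 2)))"
    and E: "E = clamp01 ((y i - c) / \<eta>) * (t + 3) + clamp01 (- ((y i - c) / \<eta>)) * (t - 3)"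
    and w: "\<And>j. j \<noteq> d \<Longrightarrow> w j = (1 - r) * a j + r * y j" "w d = a d + s * E"
  shows "w \<in> eucl (d + 1) - R"
proof -
  have "w j = 0" if "j \<ge> d + 1" for j
    using that y i by (simp add: w(1) a zigzag_def eucl_def)
  then have "w \<in> eucl (d + 1)" by (simp add: eucl_def)
  moreover have "w \<notin> R"
  proof
    assume wR: "w \<in> R"
    then have wd: "w d = 0" and wi: "\<eta> < \<bar>w i - c\<bar>" using P by (auto simp: eucl_def)
    have yd: "y d = 0" using y by (simp add: eucl_def)
    define g where "g = y i - c"
    define al where "al = clamp01 (-t)"
    define be where "be = clamp01 t"
    have albe: "0 \<le> al" "al \<le> 1" "0 \<le> be" "be \<le> 1" by (simp_all add: al_def be_def clamp01_range)
    have "a i - c = al * max 0 g + be * min 0 g"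
      using i by (simp add: a zigzag_def al_def[symmetric] be_def[symmetric] g_def max_def min_def algebra_simps)
    then have wig: "w i - c = (1 - r) * (al * max 0 g + be * min 0 g) + r * g"
      using w(1)[of i] i by (simp add: g_def algebra_simps)
    have ad: "a d = al * clamp11 (t + 2) + be * clamp11 (t - 2)"
      using i by (simp add: a zigzag_def al_def be_def)
    have notsame: False if "\<And>j. j \<noteq> d \<Longrightarrow> a j = y j"
    proof -
      have "w = y"
      proof
        fix j show "w j = y j"
          using that[of j] w(1)[of j] wd yd by (cases "j = d") (auto simp: algebra_simps)
      qed
      then show False using wR y by simp
    qed
    show False
    proof (cases "0 \<le> g")
      case True
      have e: "w i - c = ((1 - r) * al + r) * g"
        unfolding wig using True by (simp add: algebra_simps)
      have "(1 - r) * al \<le> (1 - r) * 1" using albe r by (intro mult_left_mono) auto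
      then have le1: "(1 - r) * al + r \<le> 1" by simp
      have ge0: "0 \<le> (1 - r) * al + r" using albe r by simp
      have "w i - c \<le> 1 * g" unfolding e using le1 True by (intro mult_right_mono) auto
      moreover have "0 \<le> w i - c" unfolding e using ge0 True by simp
      \<comment> \<open>\<open>w i\<close> lies between \<open>c\<close> and \<open>y i\<close>; as
        points of \<open>R\<close> are farther than \<open>\<eta>\<close> from the hyperplane,
        \<open>y i\<close> is beyond the slab, where \<open>E\<close> is the pure lift
        \<open>t + 3\<close>.\<close>
      ultimately have g: "\<eta> < g" using wi by linarith
      then have "clamp01 (g / \<eta>) = 1" "clamp01 (- (g / \<eta>)) = 0" using \<eta>
        by (auto simp: clamp01_def min_def max_def divide_simps)
      then have E': "E = t + 3" by (simp add: E g_def)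
      show False
      proof (cases "t \<le> -1")
        case True
        show False
          by (rule notsame) (use True g \<eta> in \<open>auto simp: a zigzag_simps g_def\<close>)
      next
        case False
        have pos: "a d + E > 0"
          using False t unfolding ad E' al_def be_def clamp01_def clamp11_def
          by (cases "t < 0"; cases "t < 1") (auto simp: max_def min_def)
        from rs show False
        proof
          assume "s = 1" then show False using pos wd w(2) by simp
        next
          \<comment> \<open>Here the lift may be incomplete, but no straightening has begun: off the
            hyperplane the first path still has positive weight, so \<open>t < 0\<close> and the
            height \<open>- t\<close> is positive before any lift.\<close>
          assume "r = 0"
          then have "al \<noteq> 0" using wi e \<eta> by auto
          then have "t < 0" by (auto simp: al_def clamp01_def max_def min_def split: if_splits)
          then have "a d = - t" using False i
            unfolding ad al_def be_def clamp01_def clamp11_def by auto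
          moreover have "0 \<le> s * E" using s t E' by simp
          ultimately show False using \<open>t < 0\<close> wd w(2) by simp
        qed
      qed
    next
      case False
      then have g0: "g < 0" by simp
      have e: "w i - c = ((1 - r) * be + r) * g"
        unfolding wig using g0 by (simp add: algebra_simps)
      have "(1 - r) * be \<le> (1 - r) * 1" using albe r by (intro mult_left_mono) auto
      then have le1: "(1 - r) * be + r \<le> 1" by simp
      have ge0: "0 \<le> (1 - r) * be + r" using albe r by simp
      have "w i - c \<ge> 1 * g" unfolding e using le1 g0 by (intro mult_right_mono_neg) auto
      moreover have "0 \<ge> w i - c" unfolding e using ge0 g0 by (simp add: mult_nonneg_nonpos)
      ultimately have g: "g < - \<eta>" using wi by linarith
      then have "clamp01 (g / \<eta>) = 0" "clamp01 (- (g / \<eta>)) = 1" using \<eta> 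
        by (auto simp: clamp01_def min_def max_def divide_simps)
      then have E': "E = t - 3" by (simp add: E g_def)
      show False
      proof (cases "1 \<le> t")
        case True
        show False
          by (rule notsame) (use True g \<eta> in \<open>auto simp: a zigzag_simps g_def\<close>)
      next
        case False
        have pos: "a d + E < 0"
          using False t unfolding ad E' al_def be_def clamp01_def clamp11_def
          by (cases "t > 0"; cases "t > - 1") (auto simp: max_def min_def)
        from rs show False
        proof
          assume "s = 1" then show False using pos wd w(2) by simp
        next
          assume "r = 0"
          then have "be \<noteq> 0" using wi e \<eta> by auto
          then have "t > 0" by (auto simp: be_def clamp01_def max_def min_def split: if_splits)
          then have "a d = - t" using False i
            unfolding ad al_def be_def clamp01_def clamp11_def by auto
          moreover have "0 \<ge> s * E" using s t E' by (simp add: mult_nonneg_nonpos)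
          ultimately show False using \<open>t > 0\<close> wd w(2) by simp
        qed
      qed
    qed
  qed
  ultimately show ?thesis by blast
qed

text \<open>The vertical path is replaced by a zigzag \<open>a\<close> of two vertical paths, and
  then both null-homotopies run at the same time, one on each piece, where
  \<open>zigzag_avoids\<close> keeps them from interfering. The passage from
  \<open>vlift d f\<close> to \<open>a\<close> goes through the lifted zigzag \<open>b\<close> and
  its straightened form \<open>g\<close>.\<close>

lemma susp_null_Un:
  assumes f: "continuous_on X f" "\<And>x. x \<in> X \<Longrightarrow> f x \<in> eucl d - (P \<union> Q)"
    and P: "P \<subseteq> eucl d" "\<And>p. p \<in> P \<Longrightarrow> c + \<eta> < p i"
    and Q: "Q \<subseteq> eucl d" "\<And>p. p \<in> Q \<Longrightarrow> p i < c - \<eta>"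
    and i: "i < d" and \<eta>: "0 < \<eta>" and sP: "susp_null d X P f" and sQ: "susp_null d X Q f"
  shows "susp_null d X (P \<union> Q) f"
proof -
  let ?W = "X \<times> {-1..1::real}" and ?R = "P \<union> Q"
  let ?U = "eucl (d + 1) - ?R"
  obtain \<beta> h where h: "continuous_on ({0..1::real} \<times> ?W) h"
    "\<And>s w. s \<in> {0..1} \<Longrightarrow> w \<in> ?W \<Longrightarrow> h (s, w) \<in> eucl (d + 1) - P"
    "\<And>w. h (0, w) = vlift d f w" "\<And>w. h (1, w) = \<beta> (snd w)"
    "\<And>s. s \<in> {0..1} \<Longrightarrow> rises d X (\<lambda>w. h (s, w))"
    using sP unfolding susp_null_def by (elim exE homotopic_with_canonE) blast
  obtain \<gamma> k where k: "continuous_on ({0..1::real} \<times> ?W) k"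
    "\<And>s w. s \<in> {0..1} \<Longrightarrow> w \<in> ?W \<Longrightarrow> k (s, w) \<in> eucl (d + 1) - Q"
    "\<And>w. k (0, w) = vlift d f w" "\<And>w. k (1, w) = \<gamma> (snd w)"
    "\<And>s. s \<in> {0..1} \<Longrightarrow> rises d X (\<lambda>w. k (s, w))"
    using sQ unfolding susp_null_def by (elim exE homotopic_with_canonE) blast
  \<comment> \<open>The time interval is stretched to length six: the first path runs on
    \<open>[-3, -1]\<close>, the passage through the hyperplane on \<open>[-1, 1]\<close>, the
    second path on \<open>[1, 3]\<close>.\<close>
  define a where "a z = zigzag i c (3 * snd z) (vlift d f (fst z, clamp11 (3 * snd z + 2)))
      (vlift d f (fst z, clamp11 (3 * snd z - 2)))" for z :: "'a \<times> real"
  define e where "e z = zigzag i c (3 * snd z) (\<beta> (clamp11 (3 * snd z + 2)))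
      (\<gamma> (clamp11 (3 * snd z - 2)))" for z :: "'a \<times> real"
  have ae: "homotopic_with_canon (rises d X) ?W ?U a e"
  proof (rule homotopic_with_canonI[where h = "\<lambda>w. zigzag i c (3 * snd (snd w))
        (h (fst w, fst (snd w), clamp11 (3 * snd (snd w) + 2)))
        (k (fst w, fst (snd w), clamp11 (3 * snd (snd w) - 2)))"])
    have ch: "continuous_on ({0..1} \<times> ?W) (\<lambda>w. h (fst w, fst (snd w), clamp11 (3 * snd (snd w) + 2)))"
      by (rule continuous_on_compose2[OF h(1)])
        (auto intro!: continuous_intros simp del: atLeastAtMost_iff simp: clamp11_range)
    have ck: "continuous_on ({0..1} \<times> ?W)
        (\<lambda>w. k (fst w, fst (snd w), clamp11 (3 * snd (snd w) - 2)))"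
      by (rule continuous_on_compose2[OF k(1)])
        (auto intro!: continuous_intros simp del: atLeastAtMost_iff simp: clamp11_range)
    show "continuous_on ({0..1} \<times> ?W) (\<lambda>w. zigzag i c (3 * snd (snd w))
        (h (fst w, fst (snd w), clamp11 (3 * snd (snd w) + 2)))
        (k (fst w, fst (snd w), clamp11 (3 * snd (snd w) - 2))))"
      by (intro continuous_on_zigzag ch ck) (intro continuous_intros)
  next
    fix s :: real and w :: "'a \<times> real" assume s: "s \<in> {0..1}" and w: "w \<in> ?W"
    then have x: "fst w \<in> X" by auto
    let ?t = "3 * snd w"
    have "zigzag i c ?t (h (s, fst w, clamp11 (?t + 2))) (k (s, fst w, clamp11 (?t - 2))) \<in> ?U"
    proof (rule zigzag_avoids[OF P(1) _ Q(1) _ i])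
      show "h (s, fst w, clamp11 (?t + 2)) \<in> eucl (d + 1) - P"
        using h(2)[OF s] x clamp11_range by blast
      show "k (s, fst w, clamp11 (?t - 2)) \<in> eucl (d + 1) - Q"
        using k(2)[OF s] x clamp11_range by blast
      show "0 < h (s, fst w, clamp11 (?t + 2)) d" if "-1 < ?t"
      proof -
        have "clamp11 (?t + 2) = 1" using that by (simp add: clamp11_def)
        then show ?thesis using h(5)[OF s] x by (simp add: rises_def)
      qed
      show "k (s, fst w, clamp11 (?t - 2)) d < 0" if "?t < 1"
      proof -
        have "clamp11 (?t - 2) = -1" using that by (simp add: clamp11_def)
        then show ?thesis using k(5)[OF s] x by (simp add: rises_def)
      qed
    qed (use P(2) Q(2) \<eta> in fastforce)+
    then show "zigzag i c (3 * snd (snd (s, w))) (h (fst (s, w), fst (snd (s, w)), clamp11 (3 * snd (snd (s, w)) + 2)))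
        (k (fst (s, w), fst (snd (s, w)), clamp11 (3 * snd (snd (s, w)) - 2))) \<in> ?U" by simp
  next
    fix s :: real assume s: "s \<in> {0..1}"
    show "rises d X (\<lambda>w. zigzag i c (3 * snd (snd (s, w)))
        (h (fst (s, w), fst (snd (s, w)), clamp11 (3 * snd (snd (s, w)) + 2)))
        (k (fst (s, w), fst (snd (s, w)), clamp11 (3 * snd (snd (s, w)) - 2))))"
      using h(5)[OF s] k(5)[OF s] i by (simp add: rises_def zigzag_simps clamp11_def)
  qed (simp_all add: a_def e_def h(3,4) k(3,4))
  define E where "E z = clamp01 ((f (fst z) i - c) / \<eta>) * (3 * snd z + 3) +
      clamp01 (- ((f (fst z) i - c) / \<eta>)) * (3 * snd z - 3)" for z :: "'a \<times> real"
  define b where "b z = (a z)(d := a z d + E z)" for z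
  define g where "g z = (f (fst z))(d := b z d)" for z
  have cf: "continuous_on ?W (\<lambda>z. f (fst z))"
    by (rule continuous_on_compose2[OF f(1)]) (auto intro!: continuous_intros)
  have ca: "continuous_on ?W a"
    unfolding a_def
    by (intro continuous_on_zigzag continuous_on_vlift[OF f(1)] continuous_intros) auto
  have cb: "continuous_on ?W b"
    unfolding b_def E_def
    by (intro continuous_intros ca continuous_on_coordinate[OF ca] continuous_on_coordinate[OF cf])
      (use \<eta> in auto)
  have cg: "continuous_on ?W g"
    unfolding g_def by (intro continuous_intros cf continuous_on_coordinate[OF cb])
  have cl: "continuous_on ?W (vlift d f)"
    using continuous_on_vlift[OF f(1) continuous_on_fst continuous_on_snd, OF continuous_on_id continuous_on_id, of ?W d]
    by auto
  have far: "\<eta> < \<bar>p i - c\<bar>" if "p \<in> ?R" for p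
    using that P(2)[of p] Q(2)[of p] \<eta> by (auto simp: abs_if)
  have Re: "?R \<subseteq> eucl d" using P Q by blast
  \<comment> \<open>\<open>s\<close> measures the lift and \<open>r\<close> the straightening;
    \<open>r = 0 \<or> s = 1\<close> says that straightening waits for the full lift. The instances
    are the homotopies from \<open>a\<close> to \<open>b\<close> and from \<open>b\<close> to
    \<open>g\<close>.\<close>
  have avoid: "w \<in> ?U"
    if "z \<in> ?W" "0 \<le> r" "r \<le> 1" "0 \<le> s" "s \<le> 1" "r = 0 \<or> s = 1"
      "\<And>j. j \<noteq> d \<Longrightarrow> w j = (1 - r) * a z j + r * f (fst z) j" "w d = a z d + s * E z"
    for z r s w
  proof (rule zigzag_vlift_avoids[where r = r and s = s and t = "3 * snd z" and y = "f (fst z)"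
        and R = ?R and d = d and w = w and c = c and i = i and \<eta> = \<eta> and a = "a z" and E = "E z", OF Re _ i \<eta>])
    show "\<eta> < \<bar>p i - c\<bar>" if "p \<in> ?R" for p using that by (rule far)
    show "f (fst z) \<in> eucl d - ?R" using f(2) that(1) by auto
  qed (use that in \<open>auto simp: a_def E_def vlift_def\<close>)
  have a1: "a (x, 1) d = 1" "a (x, -1) d = -1" for x
    using i by (simp_all add: a_def zigzag_simps vlift_def clamp11_def)
  have E1: "0 \<le> E (x, 1)" "E (x, -1) \<le> 0" for x
    by (simp_all add: E_def clamp01_range)
  have E_lt1: "E (x, -1) < 1" for x
    using E1(2)[of x] by linarith
  have "homotopic_with_canon (rises d X) ?W ?U a b"
  proof (rule homotopic_with_linear_coordinates[OF ca cb])
    fix s :: real and z assume "s \<in> {0..1}" "z \<in> ?W"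
    then show "(\<lambda>j. (1 - s) * a z j + s * b z j) \<in> ?U"
      by (intro avoid[of z 0 s]) (auto simp: b_def algebra_simps)
  next
    fix s :: real assume s: "s \<in> {0..1}"
    have "(1 - s) * a (x, 1) d + s * b (x, 1) d = 1 + s * E (x, 1)"
      "(1 - s) * a (x, -1) d + s * b (x, -1) d = -1 + s * E (x, -1)" for x
      by (simp_all add: b_def a1 algebra_simps)
    moreover have "0 < 1 + s * E (x, 1)" "-1 + s * E (x, -1) < 0" for x
      using s E1[of x] mult_nonneg_nonpos[of s "E (x, -1)"] by (auto intro: add_pos_nonneg)
    ultimately show "rises d X (\<lambda>z j. (1 - s) * a z j + s * b z j)"
      unfolding rises_def by (simp only:) simp
  qed
  moreover have "homotopic_with_canon (rises d X) ?W ?U b g"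
  proof (rule homotopic_with_linear_coordinates[OF cb cg])
    fix s :: real and z assume "s \<in> {0..1}" "z \<in> ?W"
    then show "(\<lambda>j. (1 - s) * b z j + s * g z j) \<in> ?U"
      by (intro avoid[of z s 1]) (auto simp: b_def g_def algebra_simps)
  next
    fix s :: real assume s: "s \<in> {0..1}"
    have "(1 - s) * b z d + s * g z d = a z d + E z" for z
      by (simp add: b_def g_def algebra_simps)
    then show "rises d X (\<lambda>z j. (1 - s) * b z j + s * g z j)"
      using E1(1) E_lt1 by (simp only: rises_def a1) (auto intro: add_pos_nonneg)
  qed
  \<comment> \<open>Both paths stay over \<open>f (fst z)\<close>, which is not in
    \<open>?R\<close>, so only the height moves and no collision is possible.\<close>
  moreover have "homotopic_with_canon (rises d X) ?W ?U g (vlift d f)"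
  proof (rule homotopic_with_linear_coordinates[OF cg cl])
    fix s :: real and z assume s: "s \<in> {0..1}" "z \<in> ?W"
    let ?w = "\<lambda>j. (1 - s) * g z j + s * vlift d f z j"
    have fz: "f (fst z) \<in> eucl d - ?R" using f(2) s by auto
    have wj: "?w j = f (fst z) j" if "j \<noteq> d" for j
      using that by (simp add: g_def vlift_def algebra_simps)
    have "?w \<notin> ?R"
    proof
      assume w: "?w \<in> ?R"
      have "?w = f (fst z)"
      proof
        fix j show "?w j = f (fst z) j"
        proof (cases "j = d")
          case True
          have "?w d = 0" using subsetD[OF Re w] unfolding eucl_def by blast
          then show ?thesis using True fz by (simp add: eucl_def)
        qed (rule wj)
      qed
      with w fz show False by simp
    qed
    moreover have "?w \<in> eucl (d + 1)" using fz wj by (simp add: eucl_def)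
    ultimately show "?w \<in> ?U" by blast
  next
    fix s :: real assume s: "s \<in> {0..1}"
    have pos: "0 < g (x, 1) d" "g (x, -1) d < 0" for x
      using E1[of x] by (simp_all add: g_def b_def a1)
    have "0 < (1 - s) * y + s" if "0 < y" for y :: real
      using s that by (cases "s = 0") (auto intro: add_nonneg_pos)
    moreover have "(1 - s) * z < s" if "z < 0" for z :: real
      using s that mult_nonneg_nonpos[of "1 - s" z] by (cases "s = 0") auto
    ultimately show "rises d X (\<lambda>z j. (1 - s) * g z j + s * vlift d f z j)"
      using pos by (simp add: rises_def vlift_def)
  qed
  ultimately have "homotopic_with_canon (rises d X) ?W ?U a (vlift d f)"
    by (meson homotopic_with_trans)
  with ae have "homotopic_with_canon (rises d X) ?W ?U (vlift d f) e"
    by (meson homotopic_with_sym homotopic_with_trans)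
  then show ?thesis unfolding susp_null_def e_def by fastforce
qed

text \<open>Two distinct points of \<open>P\<close> differ in some coordinate, and a hyperplane in
  that direction splits \<open>P\<close> into two proper subsets, to which the induction applies.
  The splitting stops at single points, where the hypothesis is available; for empty
  \<open>P\<close> the space is convex.\<close>

theorem susp_null_finite:
  assumes "finite P" "P \<subseteq> eucl d" "continuous_on X f" "\<And>x. x \<in> X \<Longrightarrow> f x \<in> eucl d - P"
    and "\<And>p. p \<in> P \<Longrightarrow> null_in X (eucl d - {p}) f"
  shows "susp_null d X P f"
  using assms
proof (induction P rule: finite_psubset_induct)
  case (psubset P)
  show ?case
  proof (cases "\<exists>p q. p \<in> P \<and> q \<in> P \<and> p \<noteq> q")
    case False
    have "null_in X (eucl d - P) f"
    proof (cases "P = {}")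
      case True
      have "homotopic_with_canon (\<lambda>_. True) X (eucl d) f (\<lambda>_ _. 0)"
        by (rule homotopic_with_linear_coordinates)
          (use psubset.prems True in \<open>auto simp: eucl_def\<close>)
      then show ?thesis unfolding null_in_def True by auto
    next
      case nonempty: False
      then obtain p where "P = {p}" using False by blast
      then show ?thesis using psubset.prems by blast
    qed
    then show ?thesis using psubset.prems by (intro null_in_imp_susp_null)
  next
    case True
    then obtain p q i where pq: "p \<in> P" "q \<in> P" "p i < q i"
      by (metis ext linorder_neqE_linordered_idom)
    have i: "i < d"
    proof (rule ccontr)
      assume "\<not> i < d"
      then have "p i = 0" "q i = 0" using pq psubset.prems(1) by (auto simp: eucl_def)
      with pq show False by simp
    qed
    define A where "A = (\<lambda>r. r i) ` P"
    have A: "finite A" "A \<noteq> {}" using psubset.hyps pq by (auto simp: A_def)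
    \<comment> \<open>\<open>m\<close> is the next value of coordinate \<open>i\<close> above
      \<open>p i\<close>. The midpoint of this gap serves as \<open>c\<close> and a quarter of its
      length as \<open>\<eta>\<close>, which leaves strict inequalities on both sides.\<close>
    define m where "m = Min {a \<in> A. p i < a}"
    have B: "finite {a \<in> A. p i < a}" "{a \<in> A. p i < a} \<noteq> {}"
      using A pq by (auto simp: A_def)
    have m: "m \<in> A" "p i < m" "\<And>a. a \<in> A \<Longrightarrow> p i < a \<Longrightarrow> m \<le> a"
      using Min_in[OF B] Min_le[OF B(1)] by (auto simp: m_def)
    define P1 where "P1 = {r \<in> P. p i < r i}"
    define P2 where "P2 = {r \<in> P. r i \<le> p i}"
    have "p \<notin> P1" "q \<notin> P2" using pq by (auto simp: P1_def P2_def)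
    moreover have "P1 \<union> P2 = P" by (auto simp: P1_def P2_def)
    ultimately have PP: "P1 \<union> P2 = P" "P1 \<subset> P" "P2 \<subset> P"
      using pq by blast+
    have "susp_null d X (P1 \<union> P2) f"
    proof (rule susp_null_Un[where c = "(p i + m) / 2" and \<eta> = "(m - p i) / 4" and i = i])
      show "susp_null d X P1 f" "susp_null d X P2 f"
        using PP psubset.prems by (intro psubset.IH; auto)+
      show "(p i + m) / 2 + (m - p i) / 4 < r i" if "r \<in> P1" for r
      proof -
        have "m \<le> r i" using that by (intro m(3)) (auto simp: P1_def A_def)
        with m(2) show ?thesis by (simp add: field_simps)
      qed
      show "r i < (p i + m) / 2 - (m - p i) / 4" if "r \<in> P2" for r
        using that m(2) by (simp add: P2_def field_simps)
    qed (use psubset.prems PP i m in auto)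
    then show ?thesis using PP by simp
  qed
qed

section \<open>General position\<close>

lemma det_eq_0_iff_kernel:
  fixes A :: "nat \<Rightarrow> nat \<Rightarrow> real"
  shows "det (mat n n (\<lambda>(i, j). A i j)) = 0 \<longleftrightarrow>
    (\<exists>x. (\<forall>i<n. (\<Sum>j<n. A i j * x j) = 0) \<and> (\<exists>j<n. x j \<noteq> 0))" (is "?L \<longleftrightarrow> ?R")
proof -
  let ?M = "mat n n (\<lambda>(i, j). A i j)"
  have M: "?M \<in> carrier_mat n n" by simp
  have mv: "?M *\<^sub>v vec n x = vec n (\<lambda>i. \<Sum>j<n. A i j * x j)" for x
    by (auto simp: mult_mat_vec_def scalar_prod_def atLeast0LessThan intro!: eq_vecI)
  show ?thesis
  proof
    assume ?L
    then obtain v where v: "v \<in> carrier_vec n" "v \<noteq> 0\<^sub>v n" "?M *\<^sub>v v = 0\<^sub>v n"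
      using det_0_iff_vec_prod_zero_field[OF M] by blast
    have vv: "vec n (\<lambda>i. v $ i) = v" using v(1) by (auto intro!: eq_vecI)
    have kernel: "vec n (\<lambda>i. \<Sum>j<n. A i j * v $ j) = 0\<^sub>v n"
      using v(3) mv[of "\<lambda>i. v $ i"] by (simp only: vv)
    have "(\<Sum>j<n. A i j * v $ j) = 0" if "i < n" for i
    proof -
      have "vec n (\<lambda>i. \<Sum>j<n. A i j * v $ j) $ i = 0\<^sub>v n $ i" by (simp only: kernel)
      then show ?thesis using that by simp
    qed
    moreover have "\<exists>j<n. v $ j \<noteq> 0"
    proof (rule ccontr)
      assume "\<not> (\<exists>j<n. v $ j \<noteq> 0)"
      then have "v = 0\<^sub>v n" using v(1) by (intro eq_vecI) auto
      then show False using v(2) by simp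
    qed
    ultimately show ?R by blast
  next
    assume ?R
    then obtain x where x: "\<And>i. i < n \<Longrightarrow> (\<Sum>j<n. A i j * x j) = 0" "\<exists>j<n. x j \<noteq> 0" by blast
    have "?M *\<^sub>v vec n x = 0\<^sub>v n" unfolding mv using x(1) by (auto intro!: eq_vecI)
    moreover have "vec n x \<noteq> 0\<^sub>v n"
    proof
      assume z: "vec n x = 0\<^sub>v n"
      have "x j = 0" if "j < n" for j
      proof -
        have "vec n x $ j = 0\<^sub>v n $ j" by (simp only: z)
        then show ?thesis using that by simp
      qed
      then show False using x(2) by blast
    qed
    ultimately show ?L using det_0_iff_vec_prod_zero_field[OF M] vec_carrier by blast
  qed
qed

text \<open>The determinant is a polynomial in the parameter which does not vanish at
  \<open>t0\<close>, so it has only finitely many roots.\<close>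

lemma finite_singular_square:
  fixes A :: "nat \<Rightarrow> nat \<Rightarrow> real poly"
  assumes "\<And>x. (\<And>i. i < n \<Longrightarrow> (\<Sum>j<n. poly (A i j) t0 * x j) = 0) \<Longrightarrow> (\<forall>j<n. x j = 0)"
  shows "finite {t. \<exists>x. (\<forall>i<n. (\<Sum>j<n. poly (A i j) t * x j) = 0) \<and> (\<exists>j<n. x j \<noteq> 0)}"
proof -
  define D where "D = det (mat n n (\<lambda>(i, j). A i j))"
  have D: "poly D t = det (mat n n (\<lambda>(i, j). poly (A i j) t))" for t
  proof -
    have hom: "comm_ring_hom (\<lambda>p::real poly. poly p t)" by unfold_locales auto
    have "map_mat (\<lambda>p. poly p t) (mat n n (\<lambda>(i, j). A i j)) = mat n n (\<lambda>(i, j). poly (A i j) t)"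
      by (auto intro!: eq_matI)
    then show ?thesis unfolding D_def comm_ring_hom.hom_det[OF hom, symmetric] by simp
  qed
  have "poly D t0 \<noteq> 0"
    unfolding D det_eq_0_iff_kernel using assms by blast
  then have "D \<noteq> 0" by auto
  then have "finite {t. poly D t = 0}" by (rule poly_roots_finite)
  then show ?thesis unfolding D det_eq_0_iff_kernel .
qed

text \<open>A matrix has trivial kernel iff its Gram matrix is regular.\<close>

lemma finite_singular:
  fixes B :: "'r \<Rightarrow> 'c \<Rightarrow> real poly"
  assumes fin: "finite R" "finite C"
    and reg: "\<And>x. (\<And>r. r \<in> R \<Longrightarrow> (\<Sum>c\<in>C. poly (B r c) t0 * x c) = 0) \<Longrightarrow> (\<forall>c\<in>C. x c = 0)"
  shows "finite {t. \<exists>x. (\<forall>r\<in>R. (\<Sum>c\<in>C. poly (B r c) t * x c) = 0) \<and> (\<exists>c\<in>C. x c \<noteq> 0)}"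
proof -
  define n where "n = card C"
  obtain e where e: "bij_betw e {..<n} C"
    using ex_bij_betw_nat_finite[OF fin(2)] by (auto simp: n_def atLeast0LessThan)
  define A where "A i j = (\<Sum>r\<in>R. B r (e i) * B r (e j))" for i j
  have row: "(\<Sum>j<n. poly (A i j) t * x (e j)) = (\<Sum>r\<in>R. poly (B r (e i)) t * (\<Sum>c\<in>C. poly (B r c) t * x c))"
    for i t x
  proof -
    have "(\<Sum>j<n. poly (A i j) t * x (e j)) =
        (\<Sum>j<n. \<Sum>r\<in>R. poly (B r (e i)) t * (poly (B r (e j)) t * x (e j)))"
      by (simp add: A_def poly_sum sum_distrib_right mult.assoc)
    also have "\<dots> = (\<Sum>r\<in>R. \<Sum>j<n. poly (B r (e i)) t * (poly (B r (e j)) t * x (e j)))"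
      by (rule sum.swap)
    also have "\<dots> = (\<Sum>r\<in>R. poly (B r (e i)) t * (\<Sum>j<n. poly (B r (e j)) t * x (e j)))"
      by (simp add: sum_distrib_left)
    also have "\<dots> = (\<Sum>r\<in>R. poly (B r (e i)) t * (\<Sum>c\<in>C. poly (B r c) t * x c))"
      by (simp add: sum.reindex_bij_betw[OF e, of "\<lambda>c. poly (B _ c) t * x c"])
    finally show ?thesis .
  qed
  have "finite {t. \<exists>x. (\<forall>i<n. (\<Sum>j<n. poly (A i j) t * x j) = 0) \<and> (\<exists>j<n. x j \<noteq> 0)}"
  proof (rule finite_singular_square)
    fix y :: "nat \<Rightarrow> real" assume y: "\<And>i. i < n \<Longrightarrow> (\<Sum>j<n. poly (A i j) t0 * y j) = 0"
    define x where "x c = y (the_inv_into {..<n} e c)" for c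
    have xe: "x (e j) = y j" if "j < n" for j
      using e that by (simp add: x_def bij_betw_def the_inv_into_f_f)
    define s where "s r = (\<Sum>c\<in>C. poly (B r c) t0 * x c)" for r
    have 0: "(\<Sum>r\<in>R. poly (B r (e i)) t0 * s r) = 0" if "i < n" for i
      using y[OF that] row[of i t0 x] by (simp add: xe s_def)
    \<comment> \<open>The squared norm of \<open>B x\<close> is \<open>x\<close> paired with the
      Gram matrix applied to \<open>x\<close>, so a kernel vector of the Gram matrix is one of
      \<open>B\<close>.\<close>
    have "(\<Sum>r\<in>R. s r * s r) = (\<Sum>r\<in>R. \<Sum>i<n. poly (B r (e i)) t0 * x (e i) * s r)"
      by (subst (1) s_def)
        (simp add: sum_distrib_right sum.reindex_bij_betw[OF e, of "\<lambda>c. poly (B _ c) t0 * x c * s _", symmetric])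
    also have "\<dots> = (\<Sum>i<n. x (e i) * (\<Sum>r\<in>R. poly (B r (e i)) t0 * s r))"
      by (subst sum.swap) (simp add: sum_distrib_left algebra_simps)
    also have "\<dots> = 0" using 0 by simp
    finally have "\<forall>r\<in>R. s r = 0"
      using sum_nonneg_eq_0_iff[OF fin(1), of "\<lambda>r. s r * s r"] by simp
    then have "\<forall>c\<in>C. x c = 0" using reg[of x] by (simp add: s_def)
    then show "\<forall>j<n. y j = 0" using xe e by (metis bij_betwE lessThan_iff)
  qed
  moreover have "{t. \<exists>x. (\<forall>r\<in>R. (\<Sum>c\<in>C. poly (B r c) t * x c) = 0) \<and> (\<exists>c\<in>C. x c \<noteq> 0)}
      \<subseteq> {t. \<exists>x. (\<forall>i<n. (\<Sum>j<n. poly (A i j) t * x j) = 0) \<and> (\<exists>j<n. x j \<noteq> 0)}"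
  proof clarify
    fix t x c assume x: "\<forall>r\<in>R. (\<Sum>c\<in>C. poly (B r c) t * x c) = 0" "c \<in> C" "x c \<noteq> 0"
    have "\<exists>j<n. x (e j) \<noteq> 0"
      using x(2,3) e by (metis bij_betw_iff_bijections lessThan_iff)
    then show "\<exists>x. (\<forall>i<n. (\<Sum>j<n. poly (A i j) t * x j) = 0) \<and> (\<exists>j<n. x j \<noteq> 0)"
      using x(1) by (intro exI[of _ "\<lambda>j. x (e j)"]) (simp add: row)
  qed
  ultimately show ?thesis by (rule finite_subset[rotated])
qed

section \<open>Transversal families of disjoint vertex sets\<close>

definition hom_coord :: "nat \<Rightarrow> ('v \<Rightarrow> nat \<Rightarrow> real) \<Rightarrow> 'v \<Rightarrow> nat \<Rightarrow> real" where
  "hom_coord d w v j = (if j = d then 1 else w v j)"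

text \<open>Adding a coordinate that is constantly one turns affine hulls into linear hulls; the condition says
  that the linear hulls of the members of \<open>F\<close> meet only in zero and that each member is independent.\<close>

definition transversal :: "nat \<Rightarrow> 'v set set \<Rightarrow> ('v \<Rightarrow> nat \<Rightarrow> real) \<Rightarrow> bool" where
  "transversal d F w \<longleftrightarrow>
     (\<forall>l p. (\<forall>A\<in>F. \<forall>j\<le>d. (\<Sum>v\<in>A. l v * hom_coord d w v j) = p j) \<longrightarrow>
        (\<forall>A\<in>F. \<forall>v\<in>A. l v = 0) \<and> (\<forall>j\<le>d. p j = 0))"

text \<open>Transversality says that a homogeneous linear system has only the zero solution. The
  unknowns are the weights \<open>l\<close> (tagged \<open>Inl\<close>) and the coordinates
  \<open>p\<close> (tagged \<open>Inr\<close>), there is one equation for each member and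
  coordinate, and the coefficients are affine in \<open>t\<close>.\<close>

lemma finite_not_transversal:
  fixes w s :: "'v \<Rightarrow> nat \<Rightarrow> real"
  assumes F: "finite F" "\<And>A. A \<in> F \<Longrightarrow> finite A"
    and t0: "transversal d F (\<lambda>v j. w v j + t0 * (s v j - w v j))"
  shows "finite {t. \<not> transversal d F (\<lambda>v j. w v j + t * (s v j - w v j))}"
proof -
  let ?wt = "\<lambda>t v j. w v j + t * (s v j - w v j)"
  define R where "R = F \<times> {..d}"
  define C where "C = Inl ` \<Union>F \<union> Inr ` {..d}"
  define B :: "'v set \<times> nat \<Rightarrow> 'v + nat \<Rightarrow> real poly" where
    "B r c = (case c of
       Inl v \<Rightarrow> if v \<in> fst r then if snd r = d then 1 else [:w v (snd r), s v (snd r) - w v (snd r):] else 0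
     | Inr j \<Rightarrow> if j = snd r then -1 else 0)" for r c
  have fin: "finite R" "finite C" using F by (auto simp: R_def C_def)
  have row: "(\<Sum>c\<in>C. poly (B (A, j) c) t * x c) =
      (\<Sum>v\<in>A. x (Inl v) * hom_coord d (?wt t) v j) - x (Inr j)" if "A \<in> F" "j \<le> d" for A j t x
  proof -
    have "(\<Sum>c\<in>C. poly (B (A, j) c) t * x c) =
        (\<Sum>v\<in>\<Union>F. poly (B (A, j) (Inl v)) t * x (Inl v)) + (\<Sum>i\<le>d. poly (B (A, j) (Inr i)) t * x (Inr i))"
      unfolding C_def using F by (subst sum.union_disjoint) (auto simp: sum.reindex)
    also have "(\<Sum>v\<in>\<Union>F. poly (B (A, j) (Inl v)) t * x (Inl v)) =
        (\<Sum>v\<in>A. poly (B (A, j) (Inl v)) t * x (Inl v))"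
      using F that by (intro sum.mono_neutral_right) (auto simp: B_def)
    also have "\<dots> = (\<Sum>v\<in>A. x (Inl v) * hom_coord d (?wt t) v j)"
      by (intro sum.cong) (auto simp: B_def hom_coord_def algebra_simps)
    also have "(\<Sum>i\<le>d. poly (B (A, j) (Inr i)) t * x (Inr i)) = (\<Sum>i\<le>d. if i = j then - x (Inr i) else 0)"
      by (intro sum.cong) (auto simp: B_def)
    also have "\<dots> = - x (Inr j)" using that by simp
    finally show ?thesis by simp
  qed
  have "finite {t. \<exists>x. (\<forall>r\<in>R. (\<Sum>c\<in>C. poly (B r c) t * x c) = 0) \<and> (\<exists>c\<in>C. x c \<noteq> 0)}"
  proof (rule finite_singular[OF fin])
    fix x assume x: "\<And>r. r \<in> R \<Longrightarrow> (\<Sum>c\<in>C. poly (B r c) t0 * x c) = 0"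
    have "\<forall>A\<in>F. \<forall>j\<le>d. (\<Sum>v\<in>A. x (Inl v) * hom_coord d (?wt t0) v j) = x (Inr j)"
      using x row by (force simp: R_def)
    then have "(\<forall>A\<in>F. \<forall>v\<in>A. x (Inl v) = 0) \<and> (\<forall>j\<le>d. x (Inr j) = 0)"
      using t0[unfolded transversal_def, rule_format, of "\<lambda>v. x (Inl v)" "\<lambda>j. x (Inr j)"] by blast
    then show "\<forall>c\<in>C. x c = 0" by (auto simp: C_def)
  qed
  moreover have "{t. \<not> transversal d F (?wt t)}
     \<subseteq> {t. \<exists>x. (\<forall>r\<in>R. (\<Sum>c\<in>C. poly (B r c) t * x c) = 0) \<and> (\<exists>c\<in>C. x c \<noteq> 0)}"
  proof
    fix t assume "t \<in> {t. \<not> transversal d F (?wt t)}"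
    then obtain l p where lp': "\<forall>A\<in>F. \<forall>j\<le>d. (\<Sum>v\<in>A. l v * hom_coord d (?wt t) v j) = p j"
      and nz': "\<not> ((\<forall>A\<in>F. \<forall>v\<in>A. l v = 0) \<and> (\<forall>j\<le>d. p j = 0))"
      unfolding transversal_def mem_Collect_eq not_all not_imp by (elim exE conjE)
    note lp = lp'[rule_format]
    have nz: "(\<exists>A\<in>F. \<exists>v\<in>A. l v \<noteq> 0) \<or> (\<exists>j\<le>d. p j \<noteq> 0)" using nz' by blast
    have "\<exists>c\<in>C. case_sum l p c \<noteq> 0"
      using nz
    proof (elim disjE bexE exE conjE)
      fix A v assume "A \<in> F" "v \<in> A" "l v \<noteq> 0"
      then show ?thesis by (intro bexI[of _ "Inl v"]) (auto simp: C_def)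
    next
      fix j assume "j \<le> d" "p j \<noteq> 0"
      then show ?thesis by (intro bexI[of _ "Inr j"]) (auto simp: C_def)
    qed
    moreover have "(\<Sum>c\<in>C. poly (B r c) t * case_sum l p c) = 0" if "r \<in> R" for r
    proof -
      have r: "fst r \<in> F" "snd r \<le> d" using that by (auto simp: R_def)
      show ?thesis using row[OF r, of t "case_sum l p"] lp[OF r] by simp
    qed
    ultimately show "t \<in> {t. \<exists>x. (\<forall>r\<in>R. (\<Sum>c\<in>C. poly (B r c) t * x c) = 0) \<and> (\<exists>c\<in>C. x c \<noteq> 0)}"
      by blast
  qed
  ultimately show ?thesis by (rule finite_subset[rotated])
qed

text \<open>Greedy choice: each set takes as much of the uncovered part of \<open>X\<close> as its
  prescribed size permits and is filled up with other elements of \<open>Y\<close> only when that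
  part is exhausted.\<close>

lemma exists_covering_subsets:
  assumes "finite F" "finite Y" "X \<subseteq> Y" "\<And>a. a \<in> F \<Longrightarrow> c a \<le> card Y" "card X \<le> (\<Sum>a\<in>F. c a)"
  shows "\<exists>S. (\<forall>a\<in>F. S a \<subseteq> Y \<and> card (S a) = c a) \<and> X \<subseteq> (\<Union>a\<in>F. S a)"
  using assms
proof (induction F arbitrary: X rule: finite_induct)
  case empty
  then have "finite X" "card X = 0" using finite_subset by auto
  then have "X = {}" by simp
  then show ?case by simp
next
  case (insert a F)
  have finX: "finite X" using insert.prems finite_subset by blast
  obtain T where T: "T \<subseteq> Y" "card T = c a" "card (X - T) \<le> (\<Sum>b\<in>F. c b)"
  proof (cases "c a \<le> card X")
    case True
    then obtain T where T: "T \<subseteq> X" "card T = c a" by (meson obtain_subset_with_card_n)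
    then have "card (X - T) = card X - c a" using finX by (metis card_Diff_subset finite_subset)
    moreover have "card X \<le> c a + (\<Sum>b\<in>F. c b)" using insert by simp
    ultimately show thesis using T insert.prems(2) by (intro that[of T]) auto
  next
    case False
    then obtain T where "X \<subseteq> T" "T \<subseteq> Y" "card T = c a"
      using exists_subset_between[of X "c a" Y] insert.prems by auto
    then show thesis by (intro that[of T]) (auto simp: Diff_eq_empty_iff[THEN iffD2])
  qed
  have "\<exists>S. (\<forall>b\<in>F. S b \<subseteq> Y \<and> card (S b) = c b) \<and> X - T \<subseteq> (\<Union>b\<in>F. S b)"
    using insert.prems T by (intro insert.IH) auto
  then obtain S where S: "\<And>b. b \<in> F \<Longrightarrow> S b \<subseteq> Y \<and> card (S b) = c b" "X - T \<subseteq> (\<Union>b\<in>F. S b)"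
    by blast
  have "(\<Union>b\<in>insert a F. (S(a := T)) b) = T \<union> (\<Union>b\<in>F. S b)"
    using insert.hyps by auto
  then show ?case
    using S T insert.hyps by (intro exI[of _ "S(a := T)"]) auto
qed

text \<open>Each member of \<open>F\<close> is sent to some of the \<open>d + 1\<close> vertices of a simplex, such that every vertex is
  avoided by at least one member.\<close>

lemma exists_transversal:
  fixes F :: "'v set set"
  assumes F: "finite F" "\<And>A. A \<in> F \<Longrightarrow> finite A" "pairwise disjnt F"
    and c: "\<And>A. A \<in> F \<Longrightarrow> card A \<le> d + 1" "d + 1 \<le> (\<Sum>A\<in>F. d + 1 - card A)"
  shows "\<exists>w. transversal d F w"
proof -
  \<comment> \<open>\<open>S A\<close> is the set of vertices that \<open>A\<close> avoids; the
    bound on the total codimension is what allows these sets to cover all \<open>d + 1\<close>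
    vertices.\<close>
  have "\<exists>S. (\<forall>A\<in>F. S A \<subseteq> {..d} \<and> card (S A) = d + 1 - card A) \<and> {..d} \<subseteq> (\<Union>A\<in>F. S A)"
    using F(1) c(2) by (intro exists_covering_subsets) auto
  then obtain S where S: "\<And>A. A \<in> F \<Longrightarrow> S A \<subseteq> {..d} \<and> card (S A) = d + 1 - card A"
    and cover: "{..d} \<subseteq> (\<Union>A\<in>F. S A)" by blast
  have "\<exists>b. bij_betw b A ({..d} - S A)" if "A \<in> F" for A
  proof (rule finite_same_card_bij)
    have "card ({..d} - S A) = d + 1 - (d + 1 - card A)"
      using S[OF that] by (subst card_Diff_subset) (auto intro: finite_subset)
    then show "card A = card ({..d} - S A)" using c(1)[OF that] by simp
  qed (use F that in auto)
  then obtain b where b: "\<And>A. A \<in> F \<Longrightarrow> bij_betw (b A) A ({..d} - S A)" by metis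
  define e where "e v = b (THE A. A \<in> F \<and> v \<in> A) v" for v
  have e: "e v = b A v" if "A \<in> F" "v \<in> A" for A v
  proof -
    have "(THE A. A \<in> F \<and> v \<in> A) = A"
      using that F(3) by (intro the_equality) (auto simp: pairwise_def disjnt_def)
    then show ?thesis by (simp add: e_def)
  qed
  \<comment> \<open>Unit vectors for indices below \<open>d\<close>. Index \<open>d\<close> stands
    for the origin, because \<open>hom_coord\<close> overwrites that coordinate.\<close>
  define w :: "'v \<Rightarrow> nat \<Rightarrow> real" where "w v j = (if j = e v then 1 else 0)" for v j
  have "transversal d F w"
    unfolding transversal_def
  proof (intro allI impI)
    fix l p assume lp: "\<forall>A\<in>F. \<forall>j\<le>d. (\<Sum>v\<in>A. l v * hom_coord d w v j) = p j"
    have eb: "bij_betw e A ({..d} - S A)" if "A \<in> F" for A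
      using b[OF that] e[OF that] by (metis bij_betw_cong)
    have pj: "p j = 0" if j: "j < d" for j
    proof -
      have "j \<in> {..d}" using j by simp
      then obtain A where A: "A \<in> F" "j \<in> S A" using cover by blast
      have "p j = (\<Sum>v\<in>A. l v * hom_coord d w v j)" using lp A j by auto
      also have "\<dots> = 0"
        using bij_betwE[OF eb[OF A(1)]] A j by (intro sum.neutral) (auto simp: hom_coord_def w_def)
      finally show ?thesis .
    qed
    have lv: "l v = 0" if A: "A \<in> F" "v \<in> A" "e v < d" for A v
    proof -
      have "p (e v) = (\<Sum>u\<in>A. l u * hom_coord d w u (e v))" using lp A by auto
      also have "\<dots> = (\<Sum>u\<in>A. if u = v then l u else 0)"
        using bij_betw_imp_inj_on[OF eb[OF A(1)]] A
        by (intro sum.cong) (auto simp: hom_coord_def w_def dest: inj_onD)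
      also have "\<dots> = l v" using A F by simp
      finally show ?thesis using pj A by simp
    qed
    have pd: "p d = (\<Sum>v\<in>A. l v)" if "A \<in> F" for A
    proof -
      have "p d = (\<Sum>v\<in>A. l v * hom_coord d w v d)"
        using lp[rule_format, OF that order_refl] by simp
      then show ?thesis by (simp add: hom_coord_def)
    qed
    have "p d = 0"
    proof -
      have "d \<in> {..d}" by simp
      then obtain A where A: "A \<in> F" "d \<in> S A" using cover by blast
      have "e v < d" if "v \<in> A" for v
        using bij_betwE[OF eb[OF A(1)]] that A(2) by (metis DiffE atMost_iff le_neq_implies_less)
      then show ?thesis using pd[OF A(1)] lv[OF A(1)] by simp
    qed
    have "l v = 0" if A: "A \<in> F" "v \<in> A" for A v
    proof (cases "e v < d")
      case False
      have "l u = 0" if u: "u \<in> A" "u \<noteq> v" for u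
      proof -
        have "e u \<noteq> e v" using bij_betw_imp_inj_on[OF eb[OF A(1)]] A u by (auto dest: inj_onD)
        moreover have "e u \<le> d" "e v \<le> d" using bij_betwE[OF eb[OF A(1)]] A u by auto
        ultimately show ?thesis using False lv[OF A(1) u(1)] by linarith
      qed
      then have "(\<Sum>u\<in>A. l u) = l v" using A F by (subst sum.remove[of A v]) (auto intro: sum.neutral)
      then show ?thesis using pd[OF A(1)] \<open>p d = 0\<close> by simp
    qed (use lv A in blast)
    then show "(\<forall>A\<in>F. \<forall>v\<in>A. l v = 0) \<and> (\<forall>j\<le>d. p j = 0)"
      using pj \<open>p d = 0\<close> by (metis le_neq_implies_less)
  qed
  then show ?thesis by blast
qed

text \<open>From a \<open>w\<close> that is good for \<open>FF\<close> one moves along the line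
  towards a configuration \<open>s\<close> that is good for \<open>F\<close>. The old conditions
  hold at \<open>t = 0\<close> and the new one at \<open>t = 1\<close>, so each fails for finitely
  many \<open>t\<close> only, and some small positive \<open>t\<close> satisfies all.\<close>

lemma exists_simultaneously_transversal:
  fixes w0 :: "'v \<Rightarrow> nat \<Rightarrow> real"
  assumes "finite FF" "\<And>F. F \<in> FF \<Longrightarrow> finite F \<and> (\<forall>A\<in>F. finite A) \<and> (\<exists>w. transversal d F w)"
    and "finite V" "0 < \<epsilon>"
  shows "\<exists>w. (\<forall>v\<in>V. \<forall>j<d. \<bar>w v j - w0 v j\<bar> < \<epsilon>) \<and> (\<forall>F\<in>FF. transversal d F w)"
  using assms
proof (induction FF arbitrary: \<epsilon> rule: finite_induct)
  case empty
  then show ?case by (intro exI[of _ w0]) simp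
next
  case (insert F FF)
  have "\<exists>w. (\<forall>v\<in>V. \<forall>j<d. \<bar>w v j - w0 v j\<bar> < \<epsilon> / 2) \<and> (\<forall>F\<in>FF. transversal d F w)"
    using insert.prems by (intro insert.IH) auto
  then obtain w where w: "\<And>v j. v \<in> V \<Longrightarrow> j < d \<Longrightarrow> \<bar>w v j - w0 v j\<bar> < \<epsilon> / 2"
    "\<And>F. F \<in> FF \<Longrightarrow> transversal d F w" by blast
  obtain s where s: "transversal d F s" using insert.prems by blast
  let ?w = "\<lambda>t v j. w v j + t * (s v j - w v j)"
  have "finite {t. \<not> transversal d G (?w t)}" if G: "G \<in> insert F FF" for G
  proof -
    have fin: "finite G" "\<And>A. A \<in> G \<Longrightarrow> finite A" using insert.prems(1)[OF G] by blast+
    show ?thesis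
    proof (cases "G = F")
      case True
      have "transversal d G (?w 1)" using s True by simp
      with fin show ?thesis by (rule finite_not_transversal)
    next
      case False
      then have "transversal d G (?w 0)" using w(2) G by simp
      with fin show ?thesis by (rule finite_not_transversal)
    qed
  qed
  then have bad: "finite (\<Union>G\<in>insert F FF. {t. \<not> transversal d G (?w t)})"
    using insert.hyps by blast
  \<comment> \<open>\<open>M\<close> bounds all displacements along the line; the summand one keeps
    it positive, so that \<open>\<epsilon> / (2 * M)\<close> is a legitimate bound for the
    step.\<close>
  define M where "M = 1 + (\<Sum>v\<in>V. \<Sum>j<d. \<bar>s v j - w v j\<bar>)"
  have M1: "1 \<le> M" unfolding M_def by (simp add: sum_nonneg)
  have M: "\<bar>s v j - w v j\<bar> \<le> M" if "v \<in> V" "j < d" for v j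
  proof -
    have "\<bar>s v j - w v j\<bar> \<le> (\<Sum>j<d. \<bar>s v j - w v j\<bar>)"
      using that by (intro member_le_sum) auto
    also have "\<dots> \<le> (\<Sum>v\<in>V. \<Sum>j<d. \<bar>s v j - w v j\<bar>)"
      using that insert.prems by (intro member_le_sum[of v V "\<lambda>v. \<Sum>j<d. \<bar>s v j - w v j\<bar>"]) (auto intro: sum_nonneg)
    finally show ?thesis by (simp add: M_def)
  qed
  have "infinite {0<..<\<epsilon> / (2 * M)}" using M1 insert.prems by (simp add: infinite_Ioo)
  then have "\<not> {0<..<\<epsilon> / (2 * M)} \<subseteq> (\<Union>G\<in>insert F FF. {t. \<not> transversal d G (?w t)})"
    using finite_subset[OF _ bad] by blast
  then obtain t where "t \<in> {0<..<\<epsilon> / (2 * M)}" "t \<notin> (\<Union>G\<in>insert F FF. {t. \<not> transversal d G (?w t)})"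
    by blast
  then have t: "0 < t" "t < \<epsilon> / (2 * M)" "\<And>G. G \<in> insert F FF \<Longrightarrow> transversal d G (?w t)"
    by auto
  have "\<bar>?w t v j - w0 v j\<bar> < \<epsilon>" if "v \<in> V" "j < d" for v j
  proof -
    have "\<bar>t * (s v j - w v j)\<bar> \<le> t * M"
      using t(1) M[OF that] by (simp add: abs_mult mult_left_mono)
    also have "\<dots> < \<epsilon> / 2" using t(2) M1 by (simp add: field_simps)
    finally show ?thesis using w(1)[OF that] by linarith
  qed
  then show ?case using t(3) by (intro exI[of _ "?w t"]) blast
qed

section \<open>Common points of the hulls of disjoint vertex sets\<close>

definition in_hull :: "nat \<Rightarrow> ('v \<Rightarrow> nat \<Rightarrow> real) \<Rightarrow> 'v set \<Rightarrow> (nat \<Rightarrow> real) \<Rightarrow> bool" where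
  "in_hull d w A p \<longleftrightarrow>
     (\<exists>l. (\<forall>v\<in>A. 0 \<le> l v) \<and> sum l A = 1 \<and> (\<forall>j<d. p j = (\<Sum>v\<in>A. l v * w v j)))"

text \<open>\<open>d + 1 - card A\<close> is the codimension in dimension \<open>d\<close> of a
  simplex with vertex set \<open>A\<close>; the bound \<open>card A \<le> d + 1\<close> keeps the
  subtraction from being cut off at zero.\<close>

definition general_position :: "nat \<Rightarrow> 'v set \<Rightarrow> ('v \<Rightarrow> nat \<Rightarrow> real) \<Rightarrow> bool" where
  "general_position d V w \<longleftrightarrow>
     (\<forall>F. F \<subseteq> Pow V \<longrightarrow> pairwise disjnt F \<longrightarrow> (\<forall>A\<in>F. card A \<le> d + 1) \<longrightarrow>
        d < (\<Sum>A\<in>F. d + 1 - card A) \<longrightarrow> (\<nexists>p. \<forall>A\<in>F. in_hull d w A p))"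

text \<open>Since the members are disjoint, the weights of the separate hulls fit together into one
  function on the vertices, the form in which \<open>transversal\<close> takes them.\<close>

lemma disjoint_family_weights:
  assumes "pairwise disjnt F" "\<And>A. A \<in> F \<Longrightarrow> in_hull d w A p"
  obtains l where "\<And>A v. A \<in> F \<Longrightarrow> v \<in> A \<Longrightarrow> 0 \<le> l v" "\<And>A. A \<in> F \<Longrightarrow> sum l A = 1"
    "\<And>A j. A \<in> F \<Longrightarrow> j < d \<Longrightarrow> p j = (\<Sum>v\<in>A. l v * w v j)"
proof -
  have "\<forall>A\<in>F. \<exists>l. (\<forall>v\<in>A. 0 \<le> l v) \<and> sum l A = 1 \<and> (\<forall>j<d. p j = (\<Sum>v\<in>A. l v * w v j))"
    using assms(2) by (simp add: in_hull_def)
  then obtain k where k: "\<forall>A\<in>F. (\<forall>v\<in>A. 0 \<le> k A v) \<and> sum (k A) A = 1 \<and>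
      (\<forall>j<d. p j = (\<Sum>v\<in>A. k A v * w v j))"
    by (auto dest!: bchoice)
  define l where "l v = k (THE A. A \<in> F \<and> v \<in> A) v" for v
  have l: "l v = k A v" if "A \<in> F" "v \<in> A" for A v
  proof -
    have "(THE A. A \<in> F \<and> v \<in> A) = A"
      using that assms(1) by (intro the_equality) (auto simp: pairwise_def disjnt_def)
    then show ?thesis by (simp add: l_def)
  qed
  show thesis
  proof (rule that[of l])
    fix A assume A: "A \<in> F"
    show "0 \<le> l v" if "v \<in> A" for v using k A that l[OF A that] by simp
    have "sum l A = sum (k A) A" using l[OF A] by (intro sum.cong) auto
    then show "sum l A = 1" using k A by simp
    fix j assume "j < d"
    have "(\<Sum>v\<in>A. l v * w v j) = (\<Sum>v\<in>A. k A v * w v j)" using l[OF A] by (intro sum.cong) auto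
    then show "p j = (\<Sum>v\<in>A. l v * w v j)" using k A \<open>j < d\<close> by simp
  qed
qed

text \<open>A common point of the hulls, extended by a last coordinate one, is a nonzero common
  vector of the linear hulls, which transversality forbids.\<close>

lemma exists_general_position:
  fixes w0 :: "'v \<Rightarrow> nat \<Rightarrow> real"
  assumes V: "finite V" and \<epsilon>: "0 < \<epsilon>"
  shows "\<exists>w. (\<forall>v\<in>V. \<forall>j<d. \<bar>w v j - w0 v j\<bar> < \<epsilon>) \<and> general_position d V w"
proof -
  define FF where "FF = {F. F \<subseteq> Pow V \<and> pairwise disjnt F \<and> (\<forall>A\<in>F. card A \<le> d + 1) \<and>
        d < (\<Sum>A\<in>F. d + 1 - card A)}"
  have "finite FF" unfolding FF_def using V by (auto intro: finite_subset[of _ "Pow (Pow V)"])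
  moreover have "finite F \<and> (\<forall>A\<in>F. finite A) \<and> (\<exists>w. transversal d F w)" if "F \<in> FF" for F
  proof -
    have F: "F \<subseteq> Pow V" "pairwise disjnt F" "\<And>A. A \<in> F \<Longrightarrow> card A \<le> d + 1"
      "d + 1 \<le> (\<Sum>A\<in>F. d + 1 - card A)"
      using that by (auto simp: FF_def)
    have fin: "finite F" "\<And>A. A \<in> F \<Longrightarrow> finite A"
      using F(1) V by (auto intro: finite_subset[of _ "Pow V"] finite_subset[of _ V])
    show ?thesis using fin exists_transversal[OF fin F(2-4)] by blast
  qed
  ultimately obtain w where w: "\<forall>v\<in>V. \<forall>j<d. \<bar>w v j - w0 v j\<bar> < \<epsilon>" "\<forall>F\<in>FF. transversal d F w"
    using exists_simultaneously_transversal[of FF d V \<epsilon> w0] V \<epsilon> by auto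
  have "\<not> (\<forall>A\<in>F. in_hull d w A p)" if F: "F \<in> FF" for F p
  proof
    assume "\<forall>A\<in>F. in_hull d w A p"
    then have h: "in_hull d w A p" if "A \<in> F" for A using that by blast
    have dis: "pairwise disjnt F" using F by (simp add: FF_def)
    have t: "transversal d F w" using w(2) F by blast
    show False
    proof (rule disjoint_family_weights[OF dis h])
      fix l assume l: "\<And>A. A \<in> F \<Longrightarrow> sum l A = 1"
        "\<And>A j. A \<in> F \<Longrightarrow> j < d \<Longrightarrow> p j = (\<Sum>v\<in>A. l v * w v j)"
      have eq: "\<forall>A\<in>F. \<forall>j\<le>d. (\<Sum>v\<in>A. l v * hom_coord d w v j) = (if j = d then 1 else p j)"
      proof (intro ballI allI impI)
        fix A j assume "A \<in> F" "j \<le> d"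
        then show "(\<Sum>v\<in>A. l v * hom_coord d w v j) = (if j = d then 1 else p j)"
          using l(1)[of A] l(2)[of A j] by (cases "j = d") (simp_all add: hom_coord_def)
      qed
      have "\<forall>j\<le>d. (if j = d then 1 else p j) = 0"
        by (rule conjunct2[OF mp[OF t[unfolded transversal_def, THEN spec[of _ l],
          THEN spec[of _ "\<lambda>j. if j = d then 1 else p j"]] eq]])
      from this[rule_format, OF order_refl] show False by simp
    qed
  qed
  then have "general_position d V w"
    unfolding general_position_def by (simp add: FF_def)
  then show ?thesis using w(1) by (intro exI[of _ w] conjI)
qed

text \<open>The line through two common points leaves one of the hulls through a facet, and this gives a common
  point of a family with larger total codimension.\<close>

lemma general_position_unique:
  assumes V: "finite V" and gp: "general_position d V w" and d: "0 < d"
    and F: "F \<subseteq> Pow V" "pairwise disjnt F" "\<And>A. A \<in> F \<Longrightarrow> card A \<le> d + 1"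
      "d = (\<Sum>A\<in>F. d + 1 - card A)"
    and p: "\<And>A. A \<in> F \<Longrightarrow> in_hull d w A p" and q: "\<And>A. A \<in> F \<Longrightarrow> in_hull d w A q"
    and i: "i < d"
  shows "p i = q i"
proof (rule ccontr)
  assume pq: "p i \<noteq> q i"
  have finF: "finite F" and finA: "\<And>A. A \<in> F \<Longrightarrow> finite A"
    using F(1) V by (auto intro: finite_subset[of _ "Pow V"] finite_subset[of _ V])
  obtain l where l: "\<And>A v. A \<in> F \<Longrightarrow> v \<in> A \<Longrightarrow> 0 \<le> l v" "\<And>A. A \<in> F \<Longrightarrow> sum l A = 1"
    "\<And>A j. A \<in> F \<Longrightarrow> j < d \<Longrightarrow> p j = (\<Sum>v\<in>A. l v * w v j)"
    using disjoint_family_weights[OF F(2) p] by blast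
  obtain k where k: "\<And>A v. A \<in> F \<Longrightarrow> v \<in> A \<Longrightarrow> 0 \<le> k v" "\<And>A. A \<in> F \<Longrightarrow> sum k A = 1"
    "\<And>A j. A \<in> F \<Longrightarrow> j < d \<Longrightarrow> q j = (\<Sum>v\<in>A. k v * w v j)"
    using disjoint_family_weights[OF F(2) q] by blast
  define B where "B = {v \<in> \<Union>F. k v < l v}"
  have "F \<noteq> {}" using F(4) d by auto
  then obtain A0 where A0: "A0 \<in> F" by blast
  have "\<exists>v\<in>A0. k v < l v"
  proof (rule ccontr)
    assume "\<not> ?thesis"
    then have le: "\<And>v. v \<in> A0 \<Longrightarrow> l v \<le> k v" by (meson not_le)
    have "l v = k v" if "v \<in> A0" for v
    proof (rule ccontr)
      assume "l v \<noteq> k v"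
      then have "sum l A0 < sum k A0"
        using le that finA[OF A0] by (intro sum_strict_mono_ex1) (auto simp: less_le)
      then show False using l(2) k(2) A0 by simp
    qed
    then have "p i = q i" using l(3)[OF A0 i] k(3)[OF A0 i] by simp
    then show False using pq by simp
  qed
  then have B: "finite B" "B \<noteq> {}" using A0 finF finA by (auto simp: B_def)
  \<comment> \<open>\<open>r v\<close> is the time at which the decreasing weight of
    \<open>v\<close> reaches zero. At the first such time \<open>s\<close> the vertex
    \<open>b\<close> leaves its hull while all weights are still nonnegative. Since \<open>k\<close>
    is nonnegative, \<open>s\<close> is at least one: the new point \<open>y\<close> lies at
    \<open>q\<close> or beyond it.\<close>
  define r where "r v = l v / (l v - k v)" for v
  obtain b where b: "b \<in> B" "\<And>v. v \<in> B \<Longrightarrow> r b \<le> r v"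
    using B by (metis arg_min_least arg_min_if_finite(1) finite_has_minimal)
  define s where "s = r b"
  obtain A1 where A1: "A1 \<in> F" "b \<in> A1" and kb: "k b < l b" using b by (auto simp: B_def)
  have s0: "0 \<le> s" using kb l(1)[OF A1] by (simp add: s_def r_def)
  define m where "m v = l v + s * (k v - l v)" for v
  have m0: "0 \<le> m v" if "A \<in> F" "v \<in> A" for A v
  proof (cases "k v < l v")
    case True
    then have "s \<le> r v" using b(2)[of v] that by (auto simp: s_def B_def)
    then have "s * (l v - k v) \<le> l v" using True by (simp add: r_def pos_le_divide_eq)
    then show ?thesis by (simp add: m_def algebra_simps)
  next
    case False
    then show ?thesis using s0 l(1)[OF that] by (simp add: m_def)
  qed
  have mb: "m b = 0" using kb by (simp add: m_def s_def r_def field_simps)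
  have m1: "sum m A = 1" if "A \<in> F" for A
    using l(2)[OF that] k(2)[OF that]
    by (simp add: m_def sum.distrib sum_subtractf flip: sum_distrib_left)
  define y where "y j = p j + s * (q j - p j)" for j
  have my: "y j = (\<Sum>v\<in>A. m v * w v j)" if "A \<in> F" "j < d" for A j
    using l(3)[OF that] k(3)[OF that]
    by (simp add: m_def y_def algebra_simps sum.distrib sum_subtractf sum_distrib_left)
  define A2 where "A2 = A1 - {b}"
  define G where "G = insert A2 (F - {A1})"
  have A2y: "in_hull d w A2 y"
    unfolding in_hull_def A2_def using m0[OF A1(1)] m1[OF A1(1)] my[OF A1(1)] finA[OF A1(1)] A1 mb
    by (intro exI[of _ m]) (auto simp: sum.remove)
  have "A2 \<noteq> {}" using A2y by (auto simp: in_hull_def)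
  have A2F: "A2 \<notin> F"
  proof
    assume "A2 \<in> F"
    moreover have "A2 \<noteq> A1" using A1 by (auto simp: A2_def)
    ultimately have "disjnt A2 A1" using F(2) A1 by (auto simp: pairwise_def)
    then show False using \<open>A2 \<noteq> {}\<close> by (auto simp: disjnt_def A2_def)
  qed
  have dis: "disjnt A2 A" "disjnt A A2" if "A \<in> F - {A1}" for A
  proof -
    have "disjnt A1 A" using pairwiseD[OF F(2) A1(1), of A] that by blast
    then show "disjnt A2 A" "disjnt A A2" by (auto simp: disjnt_def A2_def)
  qed
  have "pairwise disjnt (F - {A1})" using F(2) by (rule pairwise_subset) blast
  then have "pairwise disjnt G" unfolding G_def pairwise_insert using dis by blast
  moreover have "G \<subseteq> Pow V"
    using F(1) A1 by (auto simp: G_def A2_def)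
  moreover have cA2: "card A2 = card A1 - 1" "card A1 \<ge> 1"
    using A1 finA[OF A1(1)] by (auto simp: A2_def Suc_le_eq card_gt_0_iff)
  moreover have "\<forall>A\<in>G. card A \<le> d + 1"
    using F(3)[OF A1(1)] F(3) cA2 by (auto simp: G_def)
  moreover have "(\<Sum>A\<in>G. d + 1 - card A) = d + 1"
  proof -
    have "(\<Sum>A\<in>G. d + 1 - card A) = (d + 1 - card A2) + (\<Sum>A\<in>F - {A1}. d + 1 - card A)"
      using A2F finF by (simp add: G_def)
    moreover have "(\<Sum>A\<in>F. d + 1 - card A) = (d + 1 - card A1) + (\<Sum>A\<in>F - {A1}. d + 1 - card A)"
      using finF A1(1) by (rule sum.remove)
    ultimately show ?thesis using F(3)[OF A1(1)] F(4) cA2 by linarith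
  qed
  moreover have "\<forall>A\<in>G. in_hull d w A y"
  proof
    fix A assume "A \<in> G"
    then consider "A = A2" | "A \<in> F" by (auto simp: G_def)
    then show "in_hull d w A y"
    proof cases
      case 2
      then show ?thesis using m0 m1 my unfolding in_hull_def by blast
    qed (use A2y in simp)
  qed
  moreover have "d < (\<Sum>A\<in>G. d + 1 - card A)" using calculation by simp
  ultimately show False using gp unfolding general_position_def by blast
qed

section \<open>Compactness of faces\<close>

text \<open>The metric is a sum over the coordinates with weights \<open>(1/2) ^ n\<close>, of total
  two.\<close>

lemma dist_fun_le:
  fixes x y :: "nat \<Rightarrow> real"
  assumes "\<And>i. \<bar>x i - y i\<bar> \<le> e"
  shows "dist x y \<le> 2 * e"
proof (rule field_le_epsilon)
  fix r :: real assume "0 < r"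
  then obtain n where n: "(1/2) ^ n < r" using real_arch_pow_inv[of r "1/2"] by auto
  have "Max {dist (x (from_nat k)) (y (from_nat k)) |k. k \<le> n} \<le> e"
    using assms by (subst Max_le_iff) (auto simp: dist_real_def)
  then show "dist x y \<le> 2 * e + r"
    using dist_fun_le_dist_first_terms[of x y n] n by linarith
qed

lemma uniformly_continuous_coordinates:
  fixes f :: "(nat \<Rightarrow> real) \<Rightarrow> nat \<Rightarrow> real"
  assumes "compact C" "continuous_on C f" "0 < e"
  shows "\<exists>r>0. \<forall>x\<in>C. \<forall>y\<in>C. (\<forall>i. \<bar>x i - y i\<bar> \<le> r) \<longrightarrow> (\<forall>i<d. \<bar>f x i - f y i\<bar> < e)"
proof (induction d)
  case 0
  show ?case by (rule exI[of _ 1]) auto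
next
  case (Suc d)
  then obtain r where r: "r > 0"
    "\<And>x y. x \<in> C \<Longrightarrow> y \<in> C \<Longrightarrow> (\<forall>i. \<bar>x i - y i\<bar> \<le> r) \<Longrightarrow> (\<forall>i<d. \<bar>f x i - f y i\<bar> < e)"
    by blast
  have "uniformly_continuous_on C (\<lambda>x. f x d)"
    by (intro compact_uniformly_continuous continuous_on_coordinate assms)
  then obtain s where s: "s > 0" "\<And>x y. x \<in> C \<Longrightarrow> y \<in> C \<Longrightarrow> dist y x < s \<Longrightarrow> dist (f y d) (f x d) < e"
    unfolding uniformly_continuous_on_def using assms(3) by blast
  show ?case
  \<comment> \<open>\<open>dist_fun_le\<close> doubles a coordinatewise bound, so a third of
    \<open>s\<close> stays below \<open>s\<close>.\<close>
  proof (intro exI[of _ "min r (s / 3)"] conjI ballI impI allI)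
    fix x y i assume xy: "x \<in> C" "y \<in> C" "\<forall>i. \<bar>x i - y i\<bar> \<le> min r (s / 3)" "i < Suc d"
    show "\<bar>f x i - f y i\<bar> < e"
    proof (cases "i < d")
      case True
      then show ?thesis using r(2)[OF xy(1,2)] xy(3) by auto
    next
      case False
      then have "i = d" using xy by simp
      moreover have "dist x y \<le> 2 * (s / 3)" using xy(3) by (intro dist_fun_le) auto
      then have "dist x y < s" using s(1) by simp
      then have "dist (f x d) (f y d) < e" using s(2) xy by blast
      ultimately show ?thesis by (simp add: dist_real_def)
    qed
  qed (use r s in auto)
qed

lemma compact_standard_simplex: "compact (standard_simplex N)"
  using compactin_standard_simplex[of N] by (simp add: euclidean_product_topology)

lemma closed_vanishing: "closed {x :: nat \<Rightarrow> real. \<forall>i. i \<notin> S \<longrightarrow> x i = 0}"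
proof -
  have "closed (\<Inter>i\<in>-S. {x :: nat \<Rightarrow> real. x i = 0})"
    by (intro closed_INT ballI closed_Collect_eq continuous_on_product_coordinates continuous_on_const)
  moreover have "(\<Inter>i\<in>-S. {x :: nat \<Rightarrow> real. x i = 0}) = {x. \<forall>i. i \<notin> S \<longrightarrow> x i = 0}" by auto
  ultimately show ?thesis by simp
qed

lemma compact_face_realization:
  assumes "S \<subseteq> {..N}"
  shows "compact (face_realization S)"
proof -
  have "face_realization S = standard_simplex N \<inter> {x. \<forall>i. i \<notin> S \<longrightarrow> x i = 0}"
    unfolding face_realization_subset_standard_simplex[OF assms] by auto
  then show ?thesis
    by (simp add: compact_Int_closed compact_standard_simplex closed_vanishing)
qed

lemma finite_simplex_faces: "finite (simplex_faces N k)"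
  by (rule finite_subset[of _ "Pow {..N}"]) (auto simp: simplex_faces_def)

lemma compact_simplex_skeleton: "compact (simplex_skeleton N k)"
  unfolding simplex_skeleton_def
  by (intro compact_UN finite_simplex_faces) (auto simp: simplex_faces_def intro: compact_face_realization)

lemma face_realizationD:
  assumes "x \<in> face_realization S"
  shows "0 \<le> x i" "i \<notin> S \<Longrightarrow> x i = 0" "sum x S = 1" "S \<noteq> {}"
  using assms by (auto simp: face_realization_def)

lemma face_realization_mono:
  assumes "S \<subseteq> T" "finite T"
  shows "face_realization S \<subseteq> face_realization T"
proof
  fix x assume x: "x \<in> face_realization S"
  have "sum x T = sum x S"
    using assms x by (intro sum.mono_neutral_right) (auto simp: face_realization_def)
  then show "x \<in> face_realization T" using x assms by (auto simp: face_realization_def)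
qed

section \<open>Freudenthal interpolation\<close>

text \<open>In these coordinates the simplex becomes a set of increasing sequences from zero to one,
  to which the Freudenthal (or Kuhn) triangulation on the lattice of mesh \<open>1 / M\<close>
  restricts.\<close>

definition partial_sum :: "(nat \<Rightarrow> real) \<Rightarrow> nat \<Rightarrow> real" where
  "partial_sum x j = (\<Sum>i<j. x i)"

definition grid :: "nat \<Rightarrow> nat \<Rightarrow> (nat \<Rightarrow> real) set" where
  "grid N M = {v \<in> standard_simplex N. \<forall>i. real M * v i \<in> \<int>}"

definition defect :: "nat \<Rightarrow> (nat \<Rightarrow> real) \<Rightarrow> (nat \<Rightarrow> real) \<Rightarrow> nat \<Rightarrow> real" where
  "defect M x v j = real M * (partial_sum v j - partial_sum x j)"

text \<open>Positive exactly when the defects differ by less than one, which singles out the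
  vertices of the smallest Freudenthal simplex containing \<open>x\<close>. Normalised bumps are
  continuous weights with the support of barycentric coordinates.\<close>

definition bump :: "nat \<Rightarrow> nat \<Rightarrow> (nat \<Rightarrow> real) \<Rightarrow> (nat \<Rightarrow> real) \<Rightarrow> real" where
  "bump N M x v = (\<Prod>j\<le>Suc N. \<Prod>k\<le>Suc N. max 0 (1 - (defect M x v j - defect M x v k)))"

definition carrier_vertices :: "nat \<Rightarrow> nat \<Rightarrow> (nat \<Rightarrow> real) \<Rightarrow> (nat \<Rightarrow> real) set" where
  "carrier_vertices N M x = {v \<in> grid N M. 0 < bump N M x v}"

lemma bump_nonneg: "0 \<le> bump N M x v"
  unfolding bump_def by (intro prod_nonneg) auto

lemma bump_pos_iff:
  "0 < bump N M x v \<longleftrightarrow> (\<forall>j\<le>Suc N. \<forall>k\<le>Suc N. defect M x v j - defect M x v k < 1)"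
proof -
  have "0 < bump N M x v \<longleftrightarrow> bump N M x v \<noteq> 0"
    using bump_nonneg[of N M x v] by linarith
  also have "\<dots> \<longleftrightarrow> (\<forall>j\<le>Suc N. \<forall>k\<le>Suc N. max 0 (1 - (defect M x v j - defect M x v k)) \<noteq> 0)"
    unfolding bump_def by (auto simp: prod_zero_iff simp del: prod.atMost_Suc)
  also have "\<dots> \<longleftrightarrow> (\<forall>j\<le>Suc N. \<forall>k\<le>Suc N. defect M x v j - defect M x v k < 1)"
    by (intro all_cong) auto
  finally show ?thesis .
qed

lemma continuous_on_bump: "continuous_on S (\<lambda>x. bump N M x v)"
proof -
  have "continuous_on S (\<lambda>x. x i)" for i :: nat
    by (rule continuous_on_subset[OF continuous_on_product_coordinates]) simp
  then have "continuous_on S (\<lambda>x. partial_sum x j)" for j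
    unfolding partial_sum_def by (intro continuous_intros)
  then show ?thesis unfolding bump_def defect_def by (intro continuous_intros)
qed

lemma partial_sum_Suc: "partial_sum x (Suc j) = partial_sum x j + x j"
  by (simp add: partial_sum_def)

lemma defect_Suc: "defect M x v (Suc i) - defect M x v i = real M * (v i - x i)"
  by (simp add: defect_def partial_sum_Suc algebra_simps)

lemma partial_sum_total:
  assumes "x \<in> standard_simplex N" "N < j"
  shows "partial_sum x j = 1"
proof -
  have "(\<Sum>i<j. x i) = (\<Sum>i\<le>N. x i)"
    using assms by (intro sum.mono_neutral_right) (auto simp: standard_simplex_def)
  then show ?thesis using assms by (simp add: partial_sum_def standard_simplex_def)
qed

lemma finite_grid:
  assumes "0 < M"
  shows "finite (grid N M)"
proof -
  define c where "c v = (\<lambda>i\<in>{..N}. \<lfloor>real M * v i\<rfloor>)" for v :: "nat \<Rightarrow> real"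
  have "inj_on c (grid N M)"
  proof (rule inj_onI)
    fix u v assume u: "u \<in> grid N M" and v: "v \<in> grid N M" and cc: "c u = c v"
    show "u = v"
    proof
      fix i
      show "u i = v i"
      proof (cases "i \<le> N")
        case True
        have "\<lfloor>real M * u i\<rfloor> = \<lfloor>real M * v i\<rfloor>" using fun_cong[OF cc, of i] True by (simp add: c_def)
        moreover have "real M * u i \<in> \<int>" "real M * v i \<in> \<int>" using u v by (auto simp: grid_def)
        ultimately have "real M * u i = real M * v i" by (metis floor_of_int Ints_cases)
        then show ?thesis using assms by simp
      qed (use u v in \<open>simp add: grid_def standard_simplex_def\<close>)
    qed
  qed
  moreover have "c ` grid N M \<subseteq> (\<Pi>\<^sub>E i\<in>{..N}. {0..int M})"
  proof clarify
    fix v assume v: "v \<in> grid N M"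
    have "v i \<le> 1" "0 \<le> v i" for i
      using v by (auto simp: grid_def standard_simplex_def)
    then have "real M * v i \<le> real M * 1" "0 \<le> real M * v i" for i
      by (intro mult_left_mono mult_nonneg_nonneg; simp)+
    then have "0 \<le> \<lfloor>real M * v i\<rfloor>" "\<lfloor>real M * v i\<rfloor> \<le> int M" for i
      by (auto simp: floor_le_iff intro: order.strict_trans1[of _ "real M"])
    then show "c v \<in> (\<Pi>\<^sub>E i\<in>{..N}. {0..int M})" by (auto simp: c_def)
  qed
  moreover have "finite (\<Pi>\<^sub>E i\<in>{..N}. {0..int M})" by (intro finite_PiE) auto
  ultimately show ?thesis by (metis finite_imageD finite_subset)
qed

text \<open>Rounding the scaled partial sums down gives such a vertex: its defects lie above minus
  one and are at most zero. Its coordinates are nonnegative because rounding down is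
  monotone.\<close>

lemma carrier_vertices_nonempty:
  assumes x: "x \<in> standard_simplex N" and M: "0 < M"
  shows "carrier_vertices N M x \<noteq> {}"
proof -
  let ?c = "\<lambda>j. of_int \<lfloor>real M * partial_sum x j\<rfloor> :: real"
  define v where "v i = (?c (Suc i) - ?c i) / real M" for i
  have pv: "partial_sum v j = ?c j / real M" for j
  proof -
    have "partial_sum v j = (\<Sum>i<j. ?c (Suc i) / real M - ?c i / real M)"
      by (simp add: partial_sum_def v_def diff_divide_distrib)
    also have "\<dots> = ?c j / real M - ?c 0 / real M" by (rule sum_lessThan_telescope)
    finally show ?thesis by (simp add: partial_sum_def)
  qed
  have v0: "v i = 0" if "N < i" for i
    using that by (simp add: v_def partial_sum_total[OF x])
  have vpos: "0 \<le> v i" for i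
  proof -
    have "real M * partial_sum x i \<le> real M * partial_sum x (Suc i)"
      using x by (auto simp: partial_sum_Suc standard_simplex_def intro!: mult_left_mono)
    then have "\<lfloor>real M * partial_sum x i\<rfloor> \<le> \<lfloor>real M * partial_sum x (Suc i)\<rfloor>" by (rule floor_mono)
    then show ?thesis by (simp add: v_def)
  qed
  have vsum: "(\<Sum>i\<le>N. v i) = 1"
    using pv[of "Suc N"] M partial_sum_total[OF x, of "Suc N"]
    by (simp add: partial_sum_def lessThan_Suc_atMost)
  have "v i \<le> 1" for i
  proof (cases "i \<le> N")
    case True
    then have "v i \<le> (\<Sum>i\<le>N. v i)" using vpos by (intro member_le_sum) auto
    then show ?thesis using vsum by simp
  qed (simp add: v0)
  then have "v \<in> grid N M"
    using v0 vpos vsum M by (auto simp: grid_def standard_simplex_def v_def)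
  moreover have "0 < bump N M x v"
  proof -
    have "defect M x v j = ?c j - real M * partial_sum x j" for j
      using M by (simp add: defect_def pv field_simps)
    then have d: "defect M x v j \<le> 0" "-1 < defect M x v j" for j
      by (simp_all, linarith+)
    have "defect M x v j - defect M x v k < 1" for j k
      using d(1)[of j] d(2)[of k] by linarith
    then show ?thesis unfolding bump_pos_iff by blast
  qed
  ultimately show ?thesis by (auto simp: carrier_vertices_def)
qed

lemma carrier_vertices_close:
  assumes x: "x \<in> standard_simplex N" and M: "0 < M" and v: "v \<in> carrier_vertices N M x"
  shows "\<bar>v i - x i\<bar> < 1 / real M"
proof (cases "i \<le> N")
  case True
  then have "defect M x v (Suc i) - defect M x v i < 1" "defect M x v i - defect M x v (Suc i) < 1"
    using v by (auto simp: carrier_vertices_def bump_pos_iff)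
  then have "real M * (v i - x i) < 1" "- (real M * (v i - x i)) < 1"
    by (simp_all add: defect_Suc[symmetric])
  then have "\<bar>real M * (v i - x i)\<bar> < 1" by linarith
  then have "real M * \<bar>v i - x i\<bar> < 1" by (simp only: abs_mult abs_of_nat)
  then show ?thesis using M by (simp add: pos_less_divide_eq mult.commute)
next
  case False
  then show ?thesis using x v M by (simp add: carrier_vertices_def grid_def standard_simplex_def)
qed

text \<open>A coordinate of \<open>v\<close> is a multiple of \<open>1 / M\<close> and here less
  than \<open>1 / M\<close> away from zero. Hence the vertices around a point stay in its face, and
  disjoint faces use disjoint sets of vertices.\<close>

lemma carrier_vertices_support:
  assumes x: "x \<in> standard_simplex N" and M: "0 < M" and v: "v \<in> carrier_vertices N M x" and "x i = 0"
  shows "v i = 0"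
proof -
  have "\<bar>real M * v i\<bar> < 1"
    using carrier_vertices_close[OF x M v, of i] assms M by (simp add: abs_mult field_simps)
  moreover have "real M * v i \<in> \<int>" using v by (auto simp: carrier_vertices_def grid_def)
  ultimately have "real M * v i = 0" using Ints_nonzero_abs_less1 by blast
  then show ?thesis using M by simp
qed

text \<open>The defects of one vertex vary by less than one and start at zero. So the scaled partial
  sums of two vertices differ by less than two and, being integers, by at most one. If each exceeded
  the other somewhere, the two excesses would add up to at least two, more than the variation of
  both defects permits.\<close>

lemma carrier_vertices_partial_sum:
  assumes x: "x \<in> standard_simplex N" and u: "u \<in> carrier_vertices N M x"
    and v: "v \<in> carrier_vertices N M x"
  shows "\<bar>real M * partial_sum u j - real M * partial_sum v j\<bar> \<le> 1"
    and "(\<forall>j. real M * partial_sum u j \<le> real M * partial_sum v j) \<or>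
         (\<forall>j. real M * partial_sum v j \<le> real M * partial_sum u j)"
proof -
  have Z: "real M * partial_sum w j \<in> \<int>" if "w \<in> carrier_vertices N M x" for w j
    using that unfolding partial_sum_def sum_distrib_left
    by (intro Ints_sum) (auto simp: carrier_vertices_def grid_def)
  have tot: "partial_sum w j = 1" if "w \<in> carrier_vertices N M x" "N < j" for w j
    using that by (intro partial_sum_total) (auto simp: carrier_vertices_def grid_def)
  have lt: "defect M x w j - defect M x w k < 1" if w: "w \<in> carrier_vertices N M x" for w j k
  proof -
    \<comment> \<open>From index \<open>Suc N\<close> on all partial sums are one, so the bound for
      indices up to \<open>Suc N\<close> extends to all indices.\<close>
    have red: "defect M x w j = defect M x w (min j (Suc N))" for j
      using tot[OF w] partial_sum_total[OF x] by (cases "j \<le> N") (auto simp: defect_def min_def)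
    have "defect M x w (min j (Suc N)) - defect M x w (min k (Suc N)) < 1"
      using w by (simp add: carrier_vertices_def bump_pos_iff)
    then show ?thesis using red by metis
  qed
  have Zle: "a + 1 \<le> b" if "a < b" "a \<in> \<int>" "b \<in> \<int>" for a b :: real
    using that by (auto elim!: Ints_cases)
  have dd: "real M * partial_sum u j - real M * partial_sum v j = defect M x u j - defect M x v j" for j
    by (simp add: defect_def algebra_simps)
  have d0: "defect M x w 0 = 0" for w by (simp add: defect_def partial_sum_def)
  show "\<bar>real M * partial_sum u j - real M * partial_sum v j\<bar> \<le> 1"
  proof (rule ccontr)
    assume a: "\<not> ?thesis"
    have "\<bar>real M * partial_sum u j - real M * partial_sum v j\<bar> \<in> \<int>"
      using Z[OF u] Z[OF v] by (intro Ints_abs Ints_diff)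
    then have "1 + 1 \<le> \<bar>real M * partial_sum u j - real M * partial_sum v j\<bar>"
      using a by (intro Zle) auto
    then show False
      unfolding dd using lt[OF u, of j 0] lt[OF u, of 0 j] lt[OF v, of j 0] lt[OF v, of 0 j] d0
      by (auto simp: abs_if split: if_splits)
  qed
  show "(\<forall>j. real M * partial_sum u j \<le> real M * partial_sum v j) \<or>
         (\<forall>j. real M * partial_sum v j \<le> real M * partial_sum u j)"
  proof (rule ccontr)
    assume "\<not> ?thesis"
    then obtain j k where "real M * partial_sum v j < real M * partial_sum u j"
      "real M * partial_sum u k < real M * partial_sum v k" by (auto simp: not_le)
    then have "real M * partial_sum v j + 1 \<le> real M * partial_sum u j"
      "real M * partial_sum u k + 1 \<le> real M * partial_sum v k"
      using Z[OF u] Z[OF v] by (auto intro: Zle)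
    then show False using dd[of j] dd[of k] lt[OF u, of j k] lt[OF v, of k j] by linarith
  qed
qed

text \<open>The vertices around a point form a chain for the order of partial sums, and along
  this chain the sum of the partial sums at the break points increases by at least one.\<close>

lemma card_carrier_vertices:
  assumes S: "S \<subseteq> {..N}" and x: "x \<in> face_realization S" and M: "0 < M"
  shows "card (carrier_vertices N M x) \<le> card S"
proof -
  let ?V = "carrier_vertices N M x"
  let ?p = "\<lambda>v j. real M * partial_sum v j"
  have xN: "x \<in> standard_simplex N" and x0: "\<And>i. i \<notin> S \<Longrightarrow> x i = 0"
    using x face_realization_subset_standard_simplex[OF S] by auto
  have finS: "finite S" and "S \<noteq> {}" using S x by (auto intro: finite_subset dest: face_realizationD)
  \<comment> \<open>At the last break point \<open>Suc l\<close> all partial sums are one, so only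
    the \<open>card S - 1\<close> others tell vertices apart; this is what makes the bound
    \<open>card S\<close> instead of \<open>card S + 1\<close>.\<close>
  define l where "l = Max S"
  have l: "l \<in> S" "\<And>i. i \<in> S \<Longrightarrow> i \<le> l" using finS \<open>S \<noteq> {}\<close> by (auto simp: l_def)
  have finV: "finite ?V" using finite_grid[OF M, of N] by (simp add: carrier_vertices_def)
  have v0: "v i = 0" if "v \<in> ?V" "i \<notin> S" for v i
    using carrier_vertices_support[OF xN M that(1)] x0 that(2) by blast
  have plast: "partial_sum v (Suc l) = 1" if "v \<in> ?V" for v
  proof -
    have vN: "v \<in> standard_simplex N" using that by (simp add: carrier_vertices_def grid_def)
    have "(\<Sum>i<Suc N. v i) = (\<Sum>i<Suc l. v i)"
    proof (rule sum.mono_neutral_right)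
      have "l \<le> N" using l(1) S by auto
      then show "{..<Suc l} \<subseteq> {..<Suc N}" by auto
      show "\<forall>i\<in>{..<Suc N} - {..<Suc l}. v i = 0"
        by (intro ballI v0[OF that]) (auto dest: l(2))
    qed simp
    then show ?thesis using partial_sum_total[OF vN, of "Suc N"] by (simp add: partial_sum_def)
  qed
  define g where "g v = (\<Sum>i\<in>S - {l}. \<lfloor>?p v (Suc i)\<rfloor>)" for v
  have Zp: "?p v j \<in> \<int>" if "v \<in> ?V" for v j
    using that unfolding partial_sum_def sum_distrib_left
    by (intro Ints_sum) (auto simp: carrier_vertices_def grid_def)
  have fl: "of_int \<lfloor>?p v j\<rfloor> = ?p v j" if "v \<in> ?V" for v j
    using Zp[OF that, of j] by (metis Ints_cases floor_of_int)
  have inj: "u = v" if u: "u \<in> ?V" and v: "v \<in> ?V" and le: "\<forall>j. ?p u j \<le> ?p v j" and g: "g v \<le> g u" for u v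
  proof -
    have le': "\<lfloor>?p u j\<rfloor> \<le> \<lfloor>?p v j\<rfloor>" for j using le by (intro floor_mono) auto
    have feq: "\<lfloor>?p u (Suc i)\<rfloor> = \<lfloor>?p v (Suc i)\<rfloor>" if "i \<in> S - {l}" for i
    proof (rule ccontr)
      assume "\<not> ?thesis"
      then have "\<lfloor>?p u (Suc i)\<rfloor> < \<lfloor>?p v (Suc i)\<rfloor>" using le'[of "Suc i"] by simp
      then have "g u < g v"
        unfolding g_def using that finS le' by (intro sum_strict_mono_ex1) auto
      then show False using g by simp
    qed
    have eqS: "partial_sum u (Suc i) = partial_sum v (Suc i)" if "i \<in> S - {l}" for i
    proof -
      have "?p u (Suc i) = ?p v (Suc i)"
        using arg_cong[OF feq[OF that], of real_of_int] unfolding fl[OF u] fl[OF v] .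
      then show ?thesis using M by simp
    qed
    \<comment> \<open>Off \<open>S\<close> the coordinates of both vertices vanish, so equality at
      the break points propagates to all indices.\<close>
    have "partial_sum u j = partial_sum v j" for j
    proof (induction j)
      case (Suc j)
      consider "j \<in> S - {l}" | "j = l" | "j \<notin> S" by blast
      then show ?case
      proof cases
        case 3
        then show ?thesis using Suc v0[OF u] v0[OF v] by (simp add: partial_sum_Suc)
      qed (use eqS plast u v in auto)
    qed (simp add: partial_sum_def)
    then have "u i = v i" for i
      using partial_sum_Suc[of u i] partial_sum_Suc[of v i] by simp
    then show ?thesis by blast
  qed
  have "?V \<noteq> {}" by (rule carrier_vertices_nonempty[OF xN M])
  then obtain a where a: "a \<in> ?V" "\<And>v. v \<in> ?V \<Longrightarrow> g a \<le> g v"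
    using arg_min_if_finite(1)[OF finV, of g] arg_min_least[OF finV, of _ g] by blast
  have rng: "g v \<le> g a + int (card (S - {l}))" if v: "v \<in> ?V" for v
  proof -
    have "\<lfloor>?p v (Suc i)\<rfloor> \<le> \<lfloor>?p a (Suc i)\<rfloor> + 1" for i
      using carrier_vertices_partial_sum(1)[OF xN v a(1), of "Suc i"] by linarith
    then have "g v \<le> (\<Sum>i\<in>S - {l}. \<lfloor>?p a (Suc i)\<rfloor> + 1)" unfolding g_def by (intro sum_mono) auto
    then show ?thesis by (simp add: g_def sum.distrib)
  qed
  have "inj_on g ?V"
  proof (rule inj_onI)
    fix u v assume uv: "u \<in> ?V" "v \<in> ?V" "g u = g v"
    then show "u = v"
      using carrier_vertices_partial_sum(2)[OF xN uv(1,2)] inj[of u v] inj[of v u] by auto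
  qed
  then have "card ?V = card (g ` ?V)" by (simp add: card_image)
  also have "\<dots> \<le> card {g a..g a + int (card (S - {l}))}"
    using a(2) rng by (intro card_mono) auto
  also have "\<dots> = card S"
  proof -
    have "0 < card S" using finS l(1) by (auto simp: card_gt_0_iff)
    then show ?thesis using l(1) by (simp add: card_Diff_singleton)
  qed
  finally show ?thesis .
qed

section \<open>Generic approximation\<close>

definition interpolation ::
  "nat \<Rightarrow> nat \<Rightarrow> nat \<Rightarrow> ((nat \<Rightarrow> real) \<Rightarrow> nat \<Rightarrow> real) \<Rightarrow> (nat \<Rightarrow> real) \<Rightarrow> nat \<Rightarrow> real" where
  "interpolation d N M w x j = (if j < d then
     (\<Sum>v\<in>grid N M. bump N M x v * w v j) / (\<Sum>v\<in>grid N M. bump N M x v) else 0)"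

lemma bump_sum_pos:
  assumes "x \<in> standard_simplex N" "0 < M"
  shows "0 < (\<Sum>v\<in>grid N M. bump N M x v)"
proof -
  obtain v where "v \<in> grid N M" "0 < bump N M x v"
    using carrier_vertices_nonempty[OF assms] by (auto simp: carrier_vertices_def)
  then show ?thesis
    using finite_grid[OF assms(2)] bump_nonneg by (intro sum_pos2[of _ v]) auto
qed

lemma continuous_on_interpolation:
  assumes "0 < M"
  shows "continuous_on (standard_simplex N) (interpolation d N M w)"
proof (rule continuous_on_coordinatewise_then_product)
  fix j
  have "continuous_on (standard_simplex N)
      (\<lambda>x. (\<Sum>v\<in>grid N M. bump N M x v * w v j) / (\<Sum>v\<in>grid N M. bump N M x v))"
    using bump_sum_pos[OF _ assms] by (intro continuous_intros continuous_on_bump) force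
  then show "continuous_on (standard_simplex N) (\<lambda>x. interpolation d N M w x j)"
    by (cases "j < d") (simp_all add: interpolation_def)
qed

lemma interpolation_weights:
  assumes x: "x \<in> standard_simplex N" and M: "0 < M"
  obtains l where "\<And>v. v \<in> carrier_vertices N M x \<Longrightarrow> 0 \<le> l v"
    "sum l (carrier_vertices N M x) = 1"
    "\<And>w j. j < d \<Longrightarrow> interpolation d N M w x j = (\<Sum>v\<in>carrier_vertices N M x. l v * w v j)"
proof -
  let ?V = "carrier_vertices N M x"
  define s where "s = (\<Sum>v\<in>grid N M. bump N M x v)"
  define l where "l v = bump N M x v / s" for v
  have s: "0 < s" unfolding s_def by (rule bump_sum_pos[OF x M])
  have restrict: "(\<Sum>v\<in>grid N M. bump N M x v * h v) = (\<Sum>v\<in>?V. bump N M x v * h v)" for h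
    using finite_grid[OF M] bump_nonneg
    by (intro sum.mono_neutral_right) (auto simp: carrier_vertices_def not_less order.antisym)
  show thesis
  proof (rule that[of l])
    show "0 \<le> l v" for v using s bump_nonneg by (simp add: l_def)
    have "s = (\<Sum>v\<in>?V. bump N M x v)" using restrict[of "\<lambda>_. 1"] by (simp add: s_def)
    then show "sum l ?V = 1" using s by (simp add: l_def flip: sum_divide_distrib)
    show "interpolation d N M w x j = (\<Sum>v\<in>?V. l v * w v j)" if "j < d" for w j
      using that by (simp add: interpolation_def restrict s_def[symmetric] l_def sum_divide_distrib)
  qed
qed

lemma interpolation_in_hull:
  assumes "x \<in> standard_simplex N" "0 < M"
  shows "in_hull d w (carrier_vertices N M x) (interpolation d N M w x)"
proof (rule interpolation_weights[OF assms])
  fix l assume "\<And>v. v \<in> carrier_vertices N M x \<Longrightarrow> 0 \<le> l v"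
    "sum l (carrier_vertices N M x) = 1"
    "\<And>w j. j < d \<Longrightarrow> interpolation d N M w x j = (\<Sum>v\<in>carrier_vertices N M x. l v * w v j)"
  then show ?thesis unfolding in_hull_def by (intro exI[of _ l]) auto
qed

lemma interpolation_close:
  assumes x: "x \<in> standard_simplex N" and M: "0 < M" and j: "j < d"
    and close: "\<And>v. v \<in> carrier_vertices N M x \<Longrightarrow> \<bar>w v j - y\<bar> < e"
  shows "\<bar>interpolation d N M w x j - y\<bar> < e"
proof (rule interpolation_weights[OF x M])
  let ?V = "carrier_vertices N M x"
  fix l assume l: "\<And>v. v \<in> ?V \<Longrightarrow> 0 \<le> l v" "sum l ?V = 1"
    "\<And>w j. j < d \<Longrightarrow> interpolation d N M w x j = (\<Sum>v\<in>?V. l v * w v j)"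
  have fin: "finite ?V" using finite_grid[OF M] by (simp add: carrier_vertices_def)
  have "interpolation d N M w x j - y = (\<Sum>v\<in>?V. l v * (w v j - y))"
    using l(2) l(3)[OF j] by (simp add: algebra_simps sum_subtractf flip: sum_distrib_left)
  also have "\<bar>\<dots>\<bar> \<le> (\<Sum>v\<in>?V. l v * \<bar>w v j - y\<bar>)"
    using l(1) by (intro order.trans[OF sum_abs] sum_mono) (simp add: abs_mult)
  also have "\<dots> < (\<Sum>v\<in>?V. l v * e)"
  proof (rule sum_strict_mono_ex1[OF fin])
    show "\<forall>v\<in>?V. l v * \<bar>w v j - y\<bar> \<le> l v * e"
      using l(1) close by (intro ballI mult_left_mono) (auto simp: less_imp_le)
    obtain v where v: "v \<in> ?V" "l v \<noteq> 0"
      using l(2) by (metis sum.neutral zero_neq_one)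
    then show "\<exists>v\<in>?V. l v * \<bar>w v j - y\<bar> < l v * e"
      using l(1)[OF v(1)] close[OF v(1)] by (intro bexI[of _ v] mult_strict_left_mono) auto
  qed
  also have "\<dots> = e" using l(2) by (simp flip: sum_distrib_right)
  finally show ?thesis .
qed

text \<open>There are finitely many families, and each has at most one common point by
  \<open>general_position_unique\<close>.\<close>

lemma finite_simultaneous_hulls:
  assumes V: "finite V" and gp: "general_position d V w" and d: "0 < d"
  shows "finite {p \<in> eucl d. \<exists>F. F \<subseteq> Pow V \<and> pairwise disjnt F \<and> (\<forall>A\<in>F. card A \<le> d + 1) \<and>
     d = (\<Sum>A\<in>F. d + 1 - card A) \<and> (\<forall>A\<in>F. in_hull d w A p)}"
proof -
  define FF where "FF = {F. F \<subseteq> Pow V \<and> pairwise disjnt F \<and> (\<forall>A\<in>F. card A \<le> d + 1) \<and>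
     d = (\<Sum>A\<in>F. d + 1 - card A)}"
  define P where "P F = {p \<in> eucl d. \<forall>A\<in>F. in_hull d w A p}" for F
  have "finite FF" unfolding FF_def using V by (auto intro: finite_subset[of _ "Pow (Pow V)"])
  moreover have "finite (P F)" if "F \<in> FF" for F
  proof -
    have F: "F \<subseteq> Pow V" "pairwise disjnt F" "\<And>A. A \<in> F \<Longrightarrow> card A \<le> d + 1"
      "d = (\<Sum>A\<in>F. d + 1 - card A)" using that by (auto simp: FF_def)
    have "p = q" if pq: "p \<in> P F" "q \<in> P F" for p q
    proof
      fix i
      show "p i = q i"
      proof (cases "i < d")
        case True
        have "in_hull d w A p" "in_hull d w A q" if "A \<in> F" for A
          using pq that by (auto simp: P_def)
        then show ?thesis using general_position_unique[OF V gp d F _ _ True] by blast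
      qed (use pq in \<open>simp add: P_def eucl_def\<close>)
    qed
    then have "P F = {} \<or> (\<exists>p. P F = {p})" by blast
    then show ?thesis by auto
  qed
  ultimately have "finite (\<Union>F\<in>FF. P F)" by blast
  then show ?thesis by (rule finite_subset[rotated]) (auto simp: FF_def P_def)
qed

text \<open>The approximation sends a point into the hull of the perturbed values at the vertices
  around it. For a point of a face \<open>A\<close> these are at most \<open>card A\<close>
  vertices, all in \<open>A\<close>; so disjoint faces yield disjoint vertex sets of at least the
  same codimensions, and general position applies to those.\<close>

theorem generic_approximation:
  assumes d: "0 < d" and f: "continuous_on (simplex_skeleton N (d - 1)) f"
    and e: "0 < e"
  obtains g P where "continuous_on (standard_simplex N) g" "g ` standard_simplex N \<subseteq> eucl d"
    "\<And>x j. x \<in> simplex_skeleton N (d - 1) \<Longrightarrow> j < d \<Longrightarrow> \<bar>g x j - f x j\<bar> < e"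
    "finite P" "P \<subseteq> eucl d"
    "\<And>F p. F \<subseteq> simplex_faces N (d - 1) \<Longrightarrow> pairwise disjnt F \<Longrightarrow>
       (\<And>A. A \<in> F \<Longrightarrow> p \<in> g ` face_realization A) \<Longrightarrow>
       (\<Sum>A\<in>F. d + 1 - card A) \<le> d \<and> (d = (\<Sum>A\<in>F. d + 1 - card A) \<longrightarrow> p \<in> P)"
proof -
  let ?K = "simplex_skeleton N (d - 1)"
  \<comment> \<open>One half of \<open>e\<close> is spent on the variation of \<open>f\<close>
    within a grid cell, the other on the perturbation into general position.\<close>
  obtain r where r: "0 < r" "\<And>x y j. x \<in> ?K \<Longrightarrow> y \<in> ?K \<Longrightarrow> (\<forall>i. \<bar>x i - y i\<bar> \<le> r) \<Longrightarrow> j < d \<Longrightarrow>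
      \<bar>f x j - f y j\<bar> < e / 2"
    using uniformly_continuous_coordinates[OF compact_simplex_skeleton f, of "e / 2" d] e by auto
  obtain M where M: "0 < M" "1 / real M < r"
    using real_arch_inverse[of r] r(1) by (auto simp: inverse_eq_divide)
  obtain w where w: "\<And>v j. v \<in> grid N M \<Longrightarrow> j < d \<Longrightarrow> \<bar>w v j - f v j\<bar> < e / 2"
    and gp: "general_position d (grid N M) w"
    using exists_general_position[OF finite_grid[OF M(1)], of "e / 2" N d f] e by auto
  let ?g = "interpolation d N M w" and ?V = "carrier_vertices N M"
  define P where "P = {p \<in> eucl d. \<exists>F. F \<subseteq> Pow (grid N M) \<and> pairwise disjnt F \<and>
     (\<forall>A\<in>F. card A \<le> d + 1) \<and> d = (\<Sum>A\<in>F. d + 1 - card A) \<and> (\<forall>A\<in>F. in_hull d w A p)}"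
  have faceN: "x \<in> standard_simplex N" if "x \<in> face_realization A" "A \<in> simplex_faces N k" for x A k
    using that face_realization_subset_standard_simplex[of A N] by (auto simp: simplex_faces_def)
  have supp: "v \<in> face_realization A"
    if "x \<in> face_realization A" "A \<in> simplex_faces N k" "v \<in> ?V x" for x A k v
  proof -
    have A: "A \<subseteq> {..N}" using that by (simp add: simplex_faces_def)
    show ?thesis
      unfolding face_realization_subset_standard_simplex[OF A]
      using carrier_vertices_support[OF faceN[OF that(1,2)] M(1) that(3)] face_realizationD(2)[OF that(1)] that(3)
      by (auto simp: carrier_vertices_def grid_def)
  qed
  show thesis
  proof (rule that[of ?g P])
    show "continuous_on (standard_simplex N) ?g" by (rule continuous_on_interpolation[OF M(1)])
    show "?g ` standard_simplex N \<subseteq> eucl d" by (auto simp: interpolation_def eucl_def)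
    show "finite P"
      unfolding P_def by (rule finite_simultaneous_hulls[OF finite_grid[OF M(1)] gp d])
    show "P \<subseteq> eucl d" by (auto simp: P_def)
  next
    fix x j assume x: "x \<in> ?K" and j: "j < d"
    obtain A where A: "A \<in> simplex_faces N (d - 1)" "x \<in> face_realization A"
      using x by (auto simp: simplex_skeleton_def)
    show "\<bar>?g x j - f x j\<bar> < e"
    proof (rule interpolation_close[OF faceN[OF A(2,1)] M(1) j])
      fix v assume v: "v \<in> ?V x"
      have vK: "v \<in> ?K" using supp[OF A(2,1) v] A(1) by (auto simp: simplex_skeleton_def)
      have "\<bar>v i - x i\<bar> \<le> r" for i
        using carrier_vertices_close[OF faceN[OF A(2,1)] M(1) v, of i] M(2) by linarith
      then have "\<bar>f v j - f x j\<bar> < e / 2" using r(2)[OF vK x _ j] by blast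
      moreover have "\<bar>w v j - f v j\<bar> < e / 2"
        using v j by (intro w) (auto simp: carrier_vertices_def)
      ultimately show "\<bar>w v j - f x j\<bar> < e" by linarith
    qed
  next
    fix F p assume F: "F \<subseteq> simplex_faces N (d - 1)" "pairwise disjnt F"
      and p: "\<And>A. A \<in> F \<Longrightarrow> p \<in> ?g ` face_realization A"
    have "\<forall>A\<in>F. \<exists>x. x \<in> face_realization A \<and> p = ?g x" using p by blast
    then obtain x where x: "\<And>A. A \<in> F \<Longrightarrow> x A \<in> face_realization A" "\<And>A. A \<in> F \<Longrightarrow> p = ?g (x A)"
      by metis
    define W where "W A = ?V (x A)" for A
    have A: "A \<subseteq> {..N}" "card A \<le> d" "x A \<in> standard_simplex N" if "A \<in> F" for A
    proof -
      have "A \<in> simplex_faces N (d - 1)" using F that by blast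
      then show "A \<subseteq> {..N}" "card A \<le> d" "x A \<in> standard_simplex N"
        using d faceN[OF x(1)[OF that], of "d - 1"]
        by (simp_all add: simplex_faces_def face_dim_def) linarith
    qed
    have card: "card (W A) \<le> card A" if "A \<in> F" for A
      unfolding W_def by (rule card_carrier_vertices[OF A(1) x(1) M(1)]) (use that in auto)
    have ne: "W A \<noteq> {}" if "A \<in> F" for A
      unfolding W_def by (rule carrier_vertices_nonempty[OF A(3)[OF that] M(1)])
    have dis: "disjnt (W A) (W B)" if "A \<in> F" "B \<in> F" "A \<noteq> B" for A B
    proof -
      have "v \<notin> W B" if v: "v \<in> W A" for v
      proof
        assume "v \<in> W B"
        then have "v \<in> face_realization A" "v \<in> face_realization B"
          using v F(1) x(1) \<open>A \<in> F\<close> \<open>B \<in> F\<close> supp unfolding W_def by blast+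
        moreover have "A \<inter> B = {}"
          using pairwiseD[OF F(2) \<open>A \<in> F\<close> \<open>B \<in> F\<close> \<open>A \<noteq> B\<close>] by (simp add: disjnt_def)
        ultimately have "\<forall>i\<in>A. v i = 0" "sum v A = 1"
          using face_realizationD(2,3) by blast+
        then show False by simp
      qed
      then show ?thesis by (auto simp: disjnt_def)
    qed
    have inj: "inj_on W F"
    proof (rule inj_onI, rule ccontr)
      fix A B assume AB: "A \<in> F" "B \<in> F" "W A = W B" "A \<noteq> B"
      then show False using dis[OF AB(1,2,4)] ne[OF AB(1)] by (simp add: disjnt_def)
    qed
    have G: "W ` F \<subseteq> Pow (grid N M)" "pairwise disjnt (W ` F)" "\<forall>B\<in>W ` F. card B \<le> d + 1"
      using dis order.trans[OF card A(2)] by (auto simp: W_def carrier_vertices_def pairwise_def le_SucI)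
    have hull: "\<forall>B\<in>W ` F. in_hull d w B p"
      using x(2) interpolation_in_hull[OF A(3) M(1), of _ d w] by (auto simp: W_def)
    have sum_eq: "(\<Sum>B\<in>W ` F. d + 1 - card B) = (\<Sum>A\<in>F. d + 1 - card (W A))"
      using inj by (simp add: sum.reindex)
    have le: "(\<Sum>A\<in>F. d + 1 - card A) \<le> (\<Sum>A\<in>F. d + 1 - card (W A))"
      using card by (intro sum_mono) (simp add: diff_le_mono2)
    have le2: "(\<Sum>B\<in>W ` F. d + 1 - card B) \<le> d"
      using gp G hull unfolding general_position_def not_less[symmetric] by blast
    moreover have "p \<in> P" if "d = (\<Sum>A\<in>F. d + 1 - card A)"
    proof -
      have eq: "d = (\<Sum>B\<in>W ` F. d + 1 - card B)" using le le2 sum_eq that by linarith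
      \<comment> \<open>For the empty family nothing would place \<open>p\<close> in
        \<open>eucl d\<close>; \<open>0 < d\<close> excludes it.\<close>
      have "F \<noteq> {}" using that d by auto
      then have "p \<in> eucl d" using x(2) by (auto simp: interpolation_def eucl_def)
      then show ?thesis unfolding P_def using G eq hull by blast
    qed
    ultimately show "(\<Sum>A\<in>F. d + 1 - card A) \<le> d \<and> (d = (\<Sum>A\<in>F. d + 1 - card A) \<longrightarrow> p \<in> P)"
      using le sum_eq by linarith
  qed
qed

section \<open>Winding numbers\<close>

lemma face_boundary_eq:
  assumes "finite S"
  shows "face_boundary S = {x \<in> face_realization S. \<exists>i\<in>S. x i = 0}"
proof (intro equalityI subsetI)
  fix x assume "x \<in> face_boundary S"
  then obtain T where T: "T \<subset> S" "x \<in> face_realization T" by (auto simp: face_boundary_def)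
  then obtain i where "i \<in> S" "i \<notin> T" by blast
  then show "x \<in> {x \<in> face_realization S. \<exists>i\<in>S. x i = 0}"
    using T face_realization_mono[of T S] assms face_realizationD(2)[OF T(2)] by blast
next
  fix x assume "x \<in> {x \<in> face_realization S. \<exists>i\<in>S. x i = 0}"
  then obtain i where x: "x \<in> face_realization S" "i \<in> S" "x i = 0" by blast
  have "sum x (S - {i}) = sum x S"
    using assms x by (simp add: sum.remove)
  then have "x \<in> face_realization (S - {i})"
    using x by (auto simp: face_realization_def)
  moreover have "S - {i} \<noteq> {}" using calculation face_realizationD(4) by blast
  ultimately show "x \<in> face_boundary S"
    using x(2) unfolding face_boundary_def by blast
qed

lemma face_boundary_subset: "finite S \<Longrightarrow> face_boundary S \<subseteq> face_realization S"
  by (auto simp: face_boundary_eq)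

lemma compact_face_boundary:
  assumes "S \<subseteq> {..N}"
  shows "compact (face_boundary S)"
proof -
  have "finite S" using assms finite_subset by blast
  then have "finite {T. T \<subset> S \<and> T \<noteq> {}}" by (rule finite_subset[rotated, OF finite_Pow_iff[THEN iffD2]]) auto
  then show ?thesis
    unfolding face_boundary_def
    by (rule compact_UN) (use assms in \<open>auto intro!: compact_face_realization[of _ N]\<close>)
qed

lemma face_boundary_nonempty:
  assumes "finite S" "2 \<le> card S"
  shows "face_boundary S \<noteq> {}"
proof -
  obtain i where i: "i \<in> S" using assms by fastforce
  let ?e = "\<lambda>j. if j = i then 1 else 0 :: real"
  have "?e \<in> face_realization {i}" by (auto simp: face_realization_def)
  moreover have "{i} \<subset> S" using i assms by auto
  ultimately show ?thesis unfolding face_boundary_def by blast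
qed

text \<open>Projection to the only coordinate turns \<open>T\<close> into an interval, which
  contains the whole segment between two of its points; so the segment cannot reach
  \<open>p\<close>.\<close>

lemma segment_avoids_point_in_line:
  assumes T: "connected T" "T \<subseteq> eucl 1 - {p}" "a \<in> T" "b \<in> T" and p: "p \<in> eucl 1" and s: "0 \<le> s" "s \<le> 1"
  shows "(\<lambda>j. (1 - s) * a j + s * b j) \<noteq> p"
proof
  assume eq: "(\<lambda>j. (1 - s) * a j + s * b j) = p"
  have "connected ((\<lambda>z. z 0) ` T)"
    using T(1) by (intro connected_continuous_image continuous_on_subset[OF continuous_on_product_coordinates]) auto
  then have "is_interval ((\<lambda>z. z 0) ` T)" by (simp add: is_interval_connected_1)
  moreover have "p 0 = (1 - s) * a 0 + s * b 0" using fun_cong[OF eq, of 0] by simp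
  then have "p 0 \<in> closed_segment (a 0) (b 0)" using s by (auto simp: in_segment)
  ultimately have "p 0 \<in> (\<lambda>z. z 0) ` T"
    using T(3,4) by (meson closed_segment_subset image_eqI is_interval_convex subsetD)
  then obtain z where z: "z \<in> T" "z 0 = p 0" by auto
  then have "z i = p i" for i using T(2) p by (cases i) (auto simp: eucl_def)
  then have "z = p" by blast
  with z T(2) show False by blast
qed

lemma connected_component_of_punctured:
  "connected_component_of (punctured_space d p) a b \<longleftrightarrow>
     (\<exists>T. connected T \<and> T \<subseteq> eucl d - {p} \<and> a \<in> T \<and> b \<in> T)"
  by (auto simp: punctured_space_eq connected_component_of_def connectedin_subtopology)

text \<open>Only \<open>d = 1\<close> needs an argument. A homotopy to a constant traces paths from
  all values to one point, so the values lie in one component; conversely, segments from values in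
  one component to a fixed one miss \<open>p\<close>.\<close>

lemma winding_nonzero_iff:
  assumes g: "continuous_on (face_boundary S) g" "g ` face_boundary S \<subseteq> eucl d - {p}"
    and ne: "face_boundary S \<noteq> {}" and p: "p \<in> eucl d"
  shows "winding_nonzero d S g p \<longleftrightarrow> \<not> null_in (face_boundary S) (eucl d - {p}) g"
proof (cases "d = 1")
  case False
  then show ?thesis
    by (simp only: winding_nonzero_def null_in_def punctured_space_eq space_on_eq if_False)
next
  case True
  let ?X = "face_boundary S" and ?U = "eucl 1 - {p}"
  have "null_in ?X ?U g \<longleftrightarrow> (\<forall>a\<in>?X. \<forall>b\<in>?X. connected_component_of (punctured_space 1 p) (g a) (g b))"
  proof
    assume "null_in ?X ?U g"
    then obtain c h where h: "continuous_on ({0..1::real} \<times> ?X) h"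
      "\<And>s w. s \<in> {0..1} \<Longrightarrow> w \<in> ?X \<Longrightarrow> h (s, w) \<in> ?U"
      "\<And>w. h (0, w) = g w" "\<And>w. h (1, w) = c"
      unfolding null_in_def by (elim exE homotopic_with_canonE) blast
    let ?T = "\<lambda>a. (\<lambda>s. h (s, a)) ` {0..1}"
    have T: "connected (?T a)" "?T a \<subseteq> ?U" "g a \<in> ?T a" "c \<in> ?T a" if "a \<in> ?X" for a
    proof -
      have "continuous_on {0..1} (\<lambda>s. h (s, a))"
        by (rule continuous_on_compose2[OF h(1)]) (use that in \<open>auto intro!: continuous_intros\<close>)
      then show "connected (?T a)" by (intro connected_continuous_image) auto
      show "?T a \<subseteq> ?U" using h(2) that by blast
      show "g a \<in> ?T a" using h(3)[of a] by (intro image_eqI[of _ _ 0]) auto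
      show "c \<in> ?T a" using h(4)[of a] by (intro image_eqI[of _ _ 1]) auto
    qed
    show "\<forall>a\<in>?X. \<forall>b\<in>?X. connected_component_of (punctured_space 1 p) (g a) (g b)"
    proof (intro ballI)
      fix a b assume ab: "a \<in> ?X" "b \<in> ?X"
      have "connected (?T a \<union> ?T b)" using T(1,4) ab by (intro connected_Un) blast+
      then show "connected_component_of (punctured_space 1 p) (g a) (g b)"
        unfolding connected_component_of_punctured using T(2,3)[OF ab(1)] T(2,3)[OF ab(2)]
        by (intro exI[of _ "?T a \<union> ?T b"]) blast
    qed
  next
    assume cc: "\<forall>a\<in>?X. \<forall>b\<in>?X. connected_component_of (punctured_space 1 p) (g a) (g b)"
    obtain b where b: "b \<in> ?X" using ne by blast
    have "homotopic_with_canon (\<lambda>_. True) ?X ?U g (\<lambda>_. g b)"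
    proof (rule homotopic_with_linear_coordinates[OF g(1)])
      fix s :: real and a assume s: "s \<in> {0..1}" and a: "a \<in> ?X"
      obtain T where "connected T" "T \<subseteq> ?U" "g a \<in> T" "g b \<in> T"
        using cc a b unfolding connected_component_of_punctured by blast
      then have "(\<lambda>j. (1 - s) * g a j + s * g b j) \<noteq> p"
        using s p True by (intro segment_avoids_point_in_line) auto
      moreover have "g a \<in> eucl 1" "g b \<in> eucl 1" using g(2) a b True by blast+
      then have "(\<lambda>j. (1 - s) * g a j + s * g b j) \<in> eucl 1"
        by (simp add: eucl_def)
      ultimately show "(\<lambda>j. (1 - s) * g a j + s * g b j) \<in> ?U" by blast
    qed auto
    then show "null_in ?X ?U g" unfolding null_in_def by blast
  qed
  then show ?thesis using True by (simp add: winding_nonzero_def)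
qed

lemma face_realization_convex:
  assumes "x \<in> face_realization S" "y \<in> face_realization S" "0 \<le> s" "s \<le> 1"
  shows "(\<lambda>j. (1 - s) * x j + s * y j) \<in> face_realization S"
  using assms by (auto simp: face_realization_def sum.distrib simp flip: sum_distrib_left)

lemma winding_set_subset_image:
  assumes S: "finite S" "2 \<le> card S" and F: "continuous_on (face_realization S) F"
    "F ` face_realization S \<subseteq> eucl d"
  shows "winding_set d S F \<subseteq> F ` face_realization S"
proof
  fix p assume p: "p \<in> winding_set d S F"
  let ?X = "face_boundary S"
  show "p \<in> F ` face_realization S"
  proof (rule ccontr)
    assume np: "p \<notin> F ` face_realization S"
    have sub: "?X \<subseteq> face_realization S" by (rule face_boundary_subset[OF S(1)])
    then have pX: "p \<notin> F ` ?X" using np by blast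
    then have w: "winding_nonzero d S F p" and pe: "p \<in> eucl d"
      using p by (auto simp: winding_set_def topspace_Euclidean_space eucl_def)
    obtain x0 where x0: "x0 \<in> ?X" using face_boundary_nonempty[OF S] by blast
    let ?k = "\<lambda>w j. (1 - fst w) * snd w j + fst w * x0 j"
    have "homotopic_with_canon (\<lambda>_. True) ?X (eucl d - {p}) F (\<lambda>_. F x0)"
    proof (rule homotopic_with_canonI[where h = "\<lambda>w. F (?k w)"])
      have k: "?k (s, x) \<in> face_realization S" if "s \<in> {0..1}" "x \<in> ?X" for s x
        using that sub x0 by (auto intro!: face_realization_convex)
      have "continuous_on ({0..1} \<times> ?X) ?k"
        by (intro continuous_on_coordinatewise_then_product continuous_intros
          continuous_on_coordinate[OF continuous_on_snd[OF continuous_on_id]])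
      then show "continuous_on ({0..1} \<times> ?X) (\<lambda>w. F (?k w))"
        by (rule continuous_on_compose2[OF F(1)]) (use k in auto)
      show "F (?k (s, x)) \<in> eucl d - {p}" if "s \<in> {0..1}" "x \<in> ?X" for s x
        using k[OF that] np F(2) by blast
    qed auto
    then have "null_in ?X (eucl d - {p}) F" unfolding null_in_def by blast
    moreover have "F ` ?X \<subseteq> eucl d - {p}" using F(2) sub pX by blast
    ultimately show False
      using w winding_nonzero_iff[OF continuous_on_subset[OF F(1) sub] _ _ pe] x0 by blast
  qed
qed

section \<open>Extending a map over the cone of a face\<close>

lemma continuous_on_Min_coordinates:
  fixes T :: "nat set"
  assumes "finite T" "T \<noteq> {}"
  shows "continuous_on UNIV (\<lambda>x. Min (x ` T) :: real)"
  using assms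
proof (induction T rule: finite_ne_induct)
  case (singleton i)
  then show ?case by simp
next
  case (insert i T)
  have "continuous_on UNIV (\<lambda>x. min (x i) (Min (x ` T)) :: real)"
    by (intro continuous_on_min continuous_on_product_coordinates insert.IH)
  then show ?case using insert by simp
qed

text \<open>A point of the face \<open>T\<close> is a mixture of the barycentre and a boundary
  point; the factor \<open>card T\<close> makes this the weight of the barycentre.\<close>

definition depth :: "nat set \<Rightarrow> (nat \<Rightarrow> real) \<Rightarrow> real" where
  "depth T x = real (card T) * Min (x ` T)"

lemma continuous_on_depth:
  assumes "finite T" "T \<noteq> {}"
  shows "continuous_on UNIV (depth T)"
  unfolding depth_def
  by (intro continuous_on_mult continuous_on_const continuous_on_Min_coordinates assms)

lemma depth_nonneg:
  assumes "finite T" "T \<noteq> {}" "\<And>i. 0 \<le> x i"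
  shows "0 \<le> depth T x"
proof -
  have "0 \<le> Min (x ` T)" using assms by simp
  then show ?thesis by (simp add: depth_def)
qed

lemma depth_eq_0:
  assumes "finite T" "\<And>i. 0 \<le> x i" "i \<in> T" "x i = 0"
  shows "depth T x = 0"
proof -
  have "Min (x ` T) = 0" using assms by (intro Min_eqI) force+
  then show ?thesis by (simp add: depth_def)
qed

text \<open>The cone over \<open>T\<close> is the join of the boundary of \<open>T\<close> with the edge from the barycentre of \<open>T\<close> to the
  apex. In the proof \<open>s\<close> is the total weight of that edge, \<open>tau\<close> the position on it and \<open>z\<close> the
  point of the boundary; the null-homotopy is run in the direction of \<open>s\<close>, and \<open>lam\<close> blends it with the
  prescribed map.\<close>

lemma homotopic_extend_to_join:
  assumes T: "T \<subseteq> {..N}" "2 \<le> card T" and P: "finite P" "P \<subseteq> eucl d"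
    and f: "continuous_on UNIV f" "\<And>x. f x \<in> eucl d"
    and avoid: "f ` face_boundary T \<inter> P = {}"
    and null: "\<And>p. p \<in> P \<Longrightarrow> null_in (face_boundary T) (eucl d - {p}) f"
  defines "C \<equiv> face_realization (insert (Suc N) T)"
    and "base \<equiv> \<lambda>x. (f x)(d := x (Suc N) - depth T x)"
  shows "\<exists>K. continuous_on C K \<and> K ` C \<subseteq> eucl (d + 1) - P \<and>
    (\<forall>x\<in>C. x (Suc N) = 0 \<or> depth T x = 0 \<longrightarrow> K x = base x)"
proof -
  let ?X = "face_boundary T" and ?n = "Suc N" and ?U = "eucl (d + 1) - P"
  have finT: "finite T" using T(1) by (rule finite_subset) simp
  have neT: "T \<noteq> {}" using T(2) by (cases "T = {}") simp_all
  have nT: "?n \<notin> T" using T(1) by (meson Suc_n_not_le_n atMost_iff subsetD)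
  have card0: "1 \<le> real (card T)" using T(2) by linarith
  have CN: "insert ?n T \<subseteq> {..?n}" using T(1) by (simp add: subset_iff le_SucI)
  have compC: "compact C" unfolding C_def by (rule compact_face_realization[OF CN])
  have XC: "?X \<subseteq> C"
    using face_boundary_subset[OF finT] face_realization_mono[of T "insert ?n T"] finT by (auto simp: C_def)
  obtain z0 where z0: "z0 \<in> ?X" using face_boundary_nonempty[OF finT T(2)] by blast
  have fX: "f z \<in> eucl d - P" if "z \<in> ?X" for z using that avoid f(2) by auto
  have "susp_null d ?X P f"
    using null by (intro susp_null_finite P continuous_on_subset[OF f(1)] fX) auto
  then obtain \<beta> h where h: "continuous_on ({0..1::real} \<times> ?X \<times> {-1..1}) h"
    "\<And>s w. s \<in> {0..1} \<Longrightarrow> w \<in> ?X \<times> {-1..1} \<Longrightarrow> h (s, w) \<in> ?U"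
    "\<And>w. h (0, w) = vlift d f w" "\<And>w. h (1, w) = \<beta> (snd w)"
    "\<And>s. s \<in> {0..1} \<Longrightarrow> rises d ?X (\<lambda>w. h (s, w))"
    unfolding susp_null_def by (elim exE homotopic_with_canonE) blast
  \<comment> \<open>The compact image of the boundary keeps a positive distance from the finite set
    \<open>P\<close>.\<close>
  obtain e where e: "0 < e" "\<And>z y. z \<in> ?X \<Longrightarrow> (\<And>i. \<bar>y i - f z i\<bar> \<le> e) \<Longrightarrow> y \<notin> P"
  proof -
    have "compact (f ` ?X)"
      by (intro compact_continuous_image continuous_on_subset[OF f(1)] compact_face_boundary[OF T(1)]) auto
    then have comp: "compact (f ` ?X \<times> P)" using finite_imp_compact[OF P(1)] by (rule compact_Times)
    obtain r where r: "0 < r" "\<And>x y. x \<in> f ` ?X \<Longrightarrow> y \<in> P \<Longrightarrow> r \<le> dist x y"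
    proof (cases "P = {}")
      case True
      then show thesis by (intro that[of 1]) auto
    next
      case False
      then have "f ` ?X \<times> P \<noteq> {}" using z0 by blast
      moreover have "continuous_on (f ` ?X \<times> P) (\<lambda>w. dist (fst w) (snd w))"
        by (intro continuous_on_dist continuous_on_fst continuous_on_snd continuous_on_id)
      ultimately obtain w where w: "w \<in> f ` ?X \<times> P"
        "\<forall>v\<in>f ` ?X \<times> P. dist (fst w) (snd w) \<le> dist (fst v) (snd v)"
        using continuous_attains_inf[OF comp] by blast
      have "fst w \<noteq> snd w" using w(1) avoid by (metis disjoint_iff mem_Times_iff)
      then show thesis using w(2) by (intro that[of "dist (fst w) (snd w)"]) auto
    qed
    show thesis
    proof (rule that[of "r / 3"])
      fix z y assume z: "z \<in> ?X" and y: "\<And>i. \<bar>y i - f z i\<bar> \<le> r / 3"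
      have "dist (f z) y \<le> 2 * (r / 3)"
        using y by (intro dist_fun_le) (simp add: abs_minus_commute)
      then show "y \<notin> P" using r(1) r(2)[of "f z" y] z by auto
    qed (use r in auto)
  qed
  obtain r where r: "0 < r"
    "\<And>x y i. x \<in> C \<Longrightarrow> y \<in> C \<Longrightarrow> (\<And>i. \<bar>x i - y i\<bar> \<le> r) \<Longrightarrow> i < d \<Longrightarrow> \<bar>f x i - f y i\<bar> < e"
    using uniformly_continuous_coordinates[OF compC continuous_on_subset[OF f(1)] e(1), of d] by auto
  \<comment> \<open>Points with \<open>s x \<le> s1\<close> are within \<open>r\<close> of their
    boundary point \<open>z x\<close>, so that \<open>f x\<close> and \<open>f (z x)\<close> differ
    by less than \<open>e\<close> in each coordinate. The bound \<open>1/4\<close> keeps this zone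
    apart from \<open>3/4 \<le> s x\<close>.\<close>
  define s1 where "s1 = min (1/4) r"
  define s0 where "s0 = s1 / 2"
  have s01: "0 < s0" "s0 < s1" "s1 \<le> 1/4" "s1 \<le> r" using r(1) by (auto simp: s0_def s1_def)
  define m where "m x = Min (x ` T)" for x :: "nat \<Rightarrow> real"
  define s where "s x = x ?n + depth T x" for x
  define z where "z x = (\<lambda>i. if i \<in> T then (x i - m x) / (1 - s x) else 0)" for x
  define tau where "tau x = (x ?n - depth T x) / s x" for x
  \<comment> \<open>\<open>lam\<close> is one for \<open>s x \<le> s0\<close> and for
    \<open>\<bar>tau x\<bar> = 1\<close>, where the values are prescribed, and zero where both
    \<open>s1 \<le> s x\<close> and \<open>\<bar>tau x\<bar> \<le> 1/2\<close>.\<close>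
  define lam where "lam x = max (clamp01 ((s1 - s x) / (s1 - s0))) (clamp01 (2 * \<bar>tau x\<bar> - 1))" for x
  define sig where "sig x = clamp01 ((s x - s1) / (3/4 - s1))" for x
  \<comment> \<open>The factor two in \<open>clamp11 (2 * tau x)\<close> lets the path reach its
    ends already at \<open>\<bar>tau x\<bar> = 1/2\<close>, so that beyond this the homotopy and
    \<open>base\<close> have heights of equal sign.\<close>
  define K2 where "K2 x = (\<lambda>j. (1 - lam x) * h (sig x, z x, clamp11 (2 * tau x)) j + lam x * base x j)" for x
  \<comment> \<open>As \<open>s x\<close> approaches one, the denominator in \<open>z x\<close>
    vanishes. From \<open>s x = 3/4\<close> on, the homotopy has become independent of the boundary
    point, and the fixed \<open>z0\<close> replaces \<open>z x\<close>.\<close>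
  define K3 where "K3 x = (\<lambda>j. (1 - lam x) * h (1, z0, clamp11 (2 * tau x)) j + lam x * base x j)" for x
  define K where "K x = (if s x \<le> s0 then base x else if s x \<le> 3/4 then K2 x else K3 x)" for x
  have C0: "0 \<le> x i" if "x \<in> C" for x i using that by (simp add: C_def face_realizationD)
  have m_le: "m x \<le> x i" if "i \<in> T" for x i using that finT by (simp add: m_def)
  have m0: "0 \<le> m x" if "x \<in> C" for x using C0[OF that] finT neT by (simp add: m_def)
  have dm: "depth T x = real (card T) * m x" for x by (simp add: depth_def m_def)
  have d0: "0 \<le> depth T x" if "x \<in> C" for x using C0[OF that] finT neT by (intro depth_nonneg) auto
  have sumT: "(\<Sum>i\<in>T. x i - m x) = 1 - s x" if "x \<in> C" for x
  proof -
    have "sum x (insert ?n T) = 1" using that unfolding C_def by (rule face_realizationD)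
    then show ?thesis using nT finT by (simp add: sum_subtractf s_def dm)
  qed
  have s_range: "0 \<le> s x" "s x \<le> 1" if "x \<in> C" for x
  proof -
    show "0 \<le> s x" using C0[OF that, of ?n] d0[OF that] by (simp add: s_def)
    have "0 \<le> (\<Sum>i\<in>T. x i - m x)" using m_le by (intro sum_nonneg) auto
    then show "s x \<le> 1" using sumT[OF that] by simp
  qed
  have zX: "z x \<in> ?X" if x: "x \<in> C" and sx: "s x < 1" for x
  proof -
    have "sum (z x) T = (\<Sum>i\<in>T. x i - m x) / (1 - s x)"
      by (simp add: z_def sum_divide_distrib)
    then have "sum (z x) T = 1" using sumT[OF x] sx by simp
    moreover have "0 \<le> z x i" for i using m_le sx by (auto simp: z_def)
    ultimately have "z x \<in> face_realization T" by (auto simp: face_realization_def z_def)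
    moreover have "m x \<in> x ` T" unfolding m_def using finT neT by (intro Min_in) auto
    then obtain i where "i \<in> T" "x i = m x" by auto
    then have "\<exists>i\<in>T. z x i = 0" by (auto simp: z_def)
    ultimately show ?thesis by (simp add: face_boundary_eq[OF finT])
  qed
  have close: "\<bar>x i - z x i\<bar> \<le> s x" if x: "x \<in> C" and sx: "s x < 1" for x i
  proof -
    consider "i \<in> T" | "i = ?n" | "i \<notin> T" "i \<noteq> ?n" by blast
    then show ?thesis
    proof cases
      case 1
      then have "x i - z x i = m x - s x * z x i"
        using sx by (simp add: z_def field_simps)
      moreover have "z x i \<le> sum (z x) T" "sum (z x) T = 1" "0 \<le> z x i"
      proof -
        have zf: "z x \<in> face_realization T" using zX[OF x sx] face_boundary_subset[OF finT] by blast
        then show "sum (z x) T = 1" "0 \<le> z x i" by (auto simp: face_realizationD)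
        show "z x i \<le> sum (z x) T"
          using 1 finT zf by (intro member_le_sum) (auto simp: face_realizationD)
      qed
      then have "s x * z x i \<le> s x * 1" "0 \<le> s x * z x i"
        using s_range[OF x] by (intro mult_left_mono mult_nonneg_nonneg; simp)+
      moreover have "m x \<le> s x"
        using mult_right_mono[OF card0 m0[OF x]] C0[OF x, of ?n] by (simp add: s_def dm)
      ultimately show ?thesis using m0[OF x] by linarith
    next
      case 2
      then show ?thesis using nT C0[OF x] d0[OF x] by (simp add: z_def s_def)
    next
      case 3
      then have "x i = 0" using x by (auto simp: C_def face_realization_def)
      then show ?thesis using 3 s_range[OF x] by (simp add: z_def)
    qed
  qed
  have near: "\<bar>f x i - f (z x) i\<bar> < e" if x: "x \<in> C" and sx: "s x \<le> s1" and i: "i < d" for x i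
  proof (rule r(2)[OF x _ _ i])
    have s1': "s x < 1" using sx s01 by simp
    show "z x \<in> C" using zX[OF x s1'] XC by blast
    show "\<bar>x i - z x i\<bar> \<le> r" for i using close[OF x s1', of i] sx s01 by linarith
  qed
  have near_avoid: "w \<notin> P"
    if x: "x \<in> C" and sx: "s x \<le> s1" and l: "0 \<le> l" "l \<le> 1"
      and w: "\<And>j. j \<noteq> d \<Longrightarrow> w j = (1 - l) * f (z x) j + l * f x j" for x l w
  proof
    assume wP: "w \<in> P"
    have s1': "s x < 1" using sx s01 by simp
    have "\<bar>w i - f (z x) i\<bar> \<le> e" for i
    proof (cases "i < d")
      case True
      have "w i - f (z x) i = l * (f x i - f (z x) i)"
        using w[of i] True by (simp add: algebra_simps)
      then have "\<bar>w i - f (z x) i\<bar> = l * \<bar>f x i - f (z x) i\<bar>"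
        using l by (simp add: abs_mult)
      also have "\<dots> \<le> 1 * e" using near[OF x sx True] l e(1) by (intro mult_mono) auto
      finally show ?thesis by simp
    next
      case False
      have "f (z x) \<in> eucl d" "w \<in> eucl d" using f(2) wP P by auto
      then show ?thesis using False e(1) by (simp add: eucl_def)
    qed
    then show False using e(2)[OF zX[OF x s1']] wP by blast
  qed
  have base_eucl: "base x \<in> eucl (d + 1)" for x
    using f(2)[of x] by (simp add: base_def eucl_def)
  have lam01: "0 \<le> lam x" "lam x \<le> 1" for x
    by (auto simp: lam_def clamp01_range le_max_iff_disj)
  have tau_s: "x ?n - depth T x = s x * tau x" if "0 < s x" for x
    using that by (simp add: tau_def)
  \<comment> \<open>For \<open>\<bar>tau x\<bar> > 1/2\<close> both blended heights have the same
    sign, so the blend has nonzero height. Otherwise either \<open>s x < s1\<close>, where the blend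
    lies over a point within \<open>e\<close> of \<open>f (z x)\<close>, or
    \<open>lam x = 0\<close>, where the blend is \<open>b\<close> itself.\<close>
  have blend: "(\<lambda>j. (1 - lam x) * b j + lam x * base x j) \<in> ?U" (is "?w \<in> _")
    if x: "x \<in> C" and sx: "s0 < s x" and b: "b \<in> ?U"
      and up: "1/2 < tau x \<Longrightarrow> 0 < b d" and down: "tau x < - 1/2 \<Longrightarrow> b d < 0"
      and mid: "s x < s1 \<Longrightarrow> b = vlift d f (z x, clamp11 (2 * tau x))" for x b
  proof -
    have "?w \<in> eucl (d + 1)" using b base_eucl[of x] by (auto simp: eucl_def)
    moreover have "?w \<notin> P"
    proof
      assume wP: "?w \<in> P"
      then have wd: "?w d = 0" using P by (auto simp: eucl_def)
      have sx0: "0 < s x" using sx s01 by linarith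
      have bd: "base x d = s x * tau x" using tau_s[OF sx0] by (simp add: base_def)
      have pos: "0 < (1 - lam x) * a + lam x * c" if "0 < a" "0 < c" for a c :: real
        using that lam01[of x] by (cases "lam x = 0") (auto intro: add_nonneg_pos)
      consider "1/2 < tau x" | "tau x < - 1/2" | "\<bar>tau x\<bar> \<le> 1/2" by linarith
      then show False
      proof cases
        case 1
        then show False using pos[of "b d" "base x d"] up wd sx0 by (simp add: bd)
      next
        case 2
        then have "0 < - b d" "0 < - base x d"
          using down sx0 by (auto simp: bd mult_pos_neg)
        then show False using pos[of "- b d" "- base x d"] wd by simp
      next
        case 3
        show False
        proof (cases "s x < s1")
          case True
          have "?w \<notin> P"
            by (rule near_avoid[OF x _ lam01]) (use mid[OF True] True in \<open>auto simp: vlift_def base_def\<close>)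
          then show False using wP by simp
        next
          case False
          then have "lam x = 0"
            using 3 s01 by (auto simp: lam_def clamp01_def divide_simps min_def max_def)
          then have "?w = b" by auto
          then show False using wP b by simp
        qed
      qed
    qed
    ultimately show ?thesis by blast
  qed
  have hrise: "(1/2 < tau x \<longrightarrow> 0 < h (l, y, clamp11 (2 * tau x)) d) \<and>
      (tau x < - 1/2 \<longrightarrow> h (l, y, clamp11 (2 * tau x)) d < 0)"
    if "l \<in> {0..1}" "y \<in> ?X" for x l y
    using h(5)[OF that(1)] that(2) by (auto simp: rises_def clamp11_def min_def max_def)
  have hU: "h (l, y, clamp11 t) \<in> ?U" if "l \<in> {0..1}" "y \<in> ?X" for l y t
    using h(2)[OF that(1)] that(2) clamp11_range by blast
  have sig01: "sig x \<in> {0..1}" for x unfolding sig_def by (rule clamp01_range)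
  have KU: "K x \<in> ?U" if x: "x \<in> C" for x
  proof -
    consider "s x \<le> s0" | "s0 < s x" "s x \<le> 3/4" | "3/4 < s x" by linarith
    then show ?thesis
    proof cases
      case 1
      have "base x \<notin> P"
        by (rule near_avoid[OF x, of 1]) (use 1 s01 in \<open>auto simp: base_def\<close>)
      then show ?thesis using 1 base_eucl by (simp add: K_def)
    next
      case 2
      have "K2 x \<in> ?U"
        unfolding K2_def
      proof (rule blend[OF x 2(1)])
        have zx: "z x \<in> ?X" using zX[OF x] 2 by simp
        show "h (sig x, z x, clamp11 (2 * tau x)) \<in> ?U" by (rule hU[OF sig01 zx])
        show "1/2 < tau x \<Longrightarrow> 0 < h (sig x, z x, clamp11 (2 * tau x)) d"
          "tau x < - 1/2 \<Longrightarrow> h (sig x, z x, clamp11 (2 * tau x)) d < 0"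
          using hrise[OF sig01 zx] by blast+
        assume "s x < s1"
        then have "sig x = 0" using s01 by (auto simp: sig_def clamp01_def divide_simps min_def max_def)
        then show "h (sig x, z x, clamp11 (2 * tau x)) = vlift d f (z x, clamp11 (2 * tau x))"
          by (simp add: h(3))
      qed
      then show ?thesis using 2 by (simp add: K_def)
    next
      case 3
      have sx: "s0 < s x" using 3 s01 by linarith
      have 1: "1 \<in> {0..1::real}" by simp
      have "K3 x \<in> ?U"
        unfolding K3_def
      proof (rule blend[OF x sx hU[OF 1 z0]])
        show "1/2 < tau x \<Longrightarrow> 0 < h (1, z0, clamp11 (2 * tau x)) d"
          "tau x < - 1/2 \<Longrightarrow> h (1, z0, clamp11 (2 * tau x)) d < 0"
          using hrise[OF 1 z0] by blast+
      qed (use 3 s01 in simp)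
      then show ?thesis using 3 sx s01 by (simp add: K_def)
    qed
  qed
  have bdry: "K x = base x" if x: "x \<in> C" and b: "x ?n = 0 \<or> depth T x = 0" for x
  proof (cases "s x \<le> s0")
    case False
    then have sx: "0 < s x" using s01 by linarith
    then have "\<bar>tau x\<bar> = 1" using b by (auto simp: tau_def s_def abs_if)
    then have "lam x = 1" by (simp add: lam_def clamp01_def)
    then show ?thesis using False by (simp add: K_def K2_def K3_def)
  qed (simp add: K_def)
  have coord: "continuous_on S (\<lambda>x. x i)" for i :: nat and S :: "(nat \<Rightarrow> real) set"
    by (rule continuous_on_subset[OF continuous_on_product_coordinates]) simp
  have cdep: "continuous_on S (depth T)" for S
    by (rule continuous_on_subset[OF continuous_on_depth[OF finT neT]]) simp
  have cf: "continuous_on S f" for S by (rule continuous_on_subset[OF f(1)]) simp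
  have cbase: "continuous_on S base" for S
    unfolding base_def by (intro continuous_intros cf coord cdep)
  have cs: "continuous_on S s" for S
    unfolding s_def by (intro continuous_intros coord cdep)
  have cm: "continuous_on S m" for S
    unfolding m_def by (rule continuous_on_subset[OF continuous_on_Min_coordinates[OF finT neT]]) simp
  let ?C2 = "C \<inter> {x. s0 \<le> s x \<and> s x \<le> 3/4}" and ?C3 = "C \<inter> {x. 3/4 \<le> s x}"
  have ctau: "continuous_on S tau" if "S \<subseteq> {x. 0 < s x}" for S
    unfolding tau_def by (intro continuous_intros coord cdep cs) (use that in force)
  have clam: "continuous_on S lam" if "S \<subseteq> {x. 0 < s x}" for S
    unfolding lam_def by (intro continuous_intros ctau cs continuous_on_max that) (use s01 in auto)
  have csig: "continuous_on S sig" for S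
    unfolding sig_def by (intro continuous_intros cs) (use s01 in auto)
  have cz: "continuous_on ?C2 z"
  proof (rule continuous_on_coordinatewise_then_product)
    fix i show "continuous_on ?C2 (\<lambda>x. z x i)"
      by (cases "i \<in> T") (auto simp: z_def intro!: continuous_intros coord cm cs)
  qed
  have pos2: "?C2 \<subseteq> {x. 0 < s x}" and pos3: "?C3 \<subseteq> {x. 0 < s x}" using s01 by auto
  have ch2: "continuous_on ?C2 (\<lambda>x. h (sig x, z x, clamp11 (2 * tau x)))"
  proof (rule continuous_on_compose2[OF h(1)])
    show "continuous_on ?C2 (\<lambda>x. (sig x, z x, clamp11 (2 * tau x)))"
      by (intro continuous_on_Pair csig cz continuous_intros ctau pos2)
    show "(\<lambda>x. (sig x, z x, clamp11 (2 * tau x))) ` ?C2 \<subseteq> {0..1} \<times> ?X \<times> {-1..1}"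
    proof (rule image_subsetI)
      fix x assume x: "x \<in> ?C2"
      then have "z x \<in> ?X" using zX[of x] by simp
      then show "(sig x, z x, clamp11 (2 * tau x)) \<in> {0..1} \<times> ?X \<times> {-1..1}"
        using sig01 clamp11_range by blast
    qed
  qed
  have ch3: "continuous_on ?C3 (\<lambda>x. h (1, z0, clamp11 (2 * tau x)))"
  proof (rule continuous_on_compose2[OF h(1)])
    show "continuous_on ?C3 (\<lambda>x. (1::real, z0, clamp11 (2 * tau x)))"
      by (intro continuous_on_Pair continuous_intros ctau pos3)
    show "(\<lambda>x. (1, z0, clamp11 (2 * tau x))) ` ?C3 \<subseteq> {0..1::real} \<times> ?X \<times> {-1..1}"
      using z0 clamp11_range by auto
  qed
  have cK2: "continuous_on ?C2 K2"
    unfolding K2_def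
    by (intro continuous_on_coordinatewise_then_product continuous_on_add continuous_on_mult continuous_on_diff
      continuous_on_const clam pos2 continuous_on_coordinate[OF ch2] continuous_on_coordinate[OF cbase])
  have cK3: "continuous_on ?C3 K3"
    unfolding K3_def
    by (intro continuous_on_coordinatewise_then_product continuous_on_add continuous_on_mult continuous_on_diff
      continuous_on_const clam pos3 continuous_on_coordinate[OF ch3] continuous_on_coordinate[OF cbase])
  have clC: "closed C" using compC by (rule compact_imp_closed)
  have cl: "closed (C \<inter> {x. s x \<le> s0})" "closed ?C2" "closed ?C3"
    by (intro closed_Int clC closed_Collect_le closed_Collect_conj continuous_on_const cs)+
  have "continuous_on (?C2 \<union> ?C3) (\<lambda>x. if s x \<le> 3/4 then K2 x else K3 x)"
  proof (rule continuous_on_cases[OF cl(2,3) cK2 cK3], intro allI impI)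
    fix x assume "x \<in> ?C2 \<and> \<not> s x \<le> 3/4 \<or> x \<in> ?C3 \<and> s x \<le> 3/4"
    then have sx: "s x = 3/4" by auto
    then have "sig x = 1" using s01 by (simp add: sig_def clamp01_def)
    then show "K2 x = K3 x" by (simp add: K2_def K3_def h(4))
  qed
  then have "continuous_on (C \<inter> {x. s x \<le> s0} \<union> (?C2 \<union> ?C3)) K"
    unfolding K_def
  proof (rule continuous_on_cases[OF cl(1) closed_Un[OF cl(2,3)] cbase], intro allI impI)
    fix x assume "x \<in> C \<inter> {x. s x \<le> s0} \<and> \<not> s x \<le> s0 \<or> x \<in> ?C2 \<union> ?C3 \<and> s x \<le> s0"
    then have sx: "s x = s0" using s01 by auto
    then have "lam x = 1" using s01 clamp01_range(2) by (simp add: lam_def clamp01_def max_def)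
    then show "base x = (if s x \<le> 3/4 then K2 x else K3 x)" by (simp add: K2_def K3_def)
  qed
  moreover have "C \<inter> {x. s x \<le> s0} \<union> (?C2 \<union> ?C3) = C" by auto
  ultimately have "continuous_on C K" by simp
  then show ?thesis using KU bdry by (intro exI[of _ K] conjI) auto
qed

section \<open>Limits of winding partitions\<close>

text \<open>Dugundji extension in each coordinate below \<open>d\<close>; the others are set to
  zero, as they are on \<open>C\<close>.\<close>

lemma extend_to_eucl:
  fixes g :: "(nat \<Rightarrow> real) \<Rightarrow> nat \<Rightarrow> real"
  assumes C: "closed C" and g: "continuous_on C g" "g ` C \<subseteq> eucl d"
  obtains f where "continuous_on UNIV f" "\<And>x. f x \<in> eucl d" "\<And>x. x \<in> C \<Longrightarrow> f x = g x"
proof -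
  have "\<exists>e. continuous_on UNIV e \<and> (\<forall>x\<in>C. e x = g x j)" for j
  proof -
    obtain e :: "(nat \<Rightarrow> real) \<Rightarrow> real" where "continuous_on UNIV e" "\<And>x. x \<in> C \<Longrightarrow> e x = g x j"
      by (rule Dugundji[of UNIV UNIV C "\<lambda>x. g x j"])
        (use C continuous_on_coordinate[OF g(1)] in auto)
    then show ?thesis by blast
  qed
  then obtain e where e: "\<And>j. continuous_on UNIV (e j)" "\<And>j x. x \<in> C \<Longrightarrow> e j x = g x j" by metis
  define f where "f x j = (if j < d then e j x else 0)" for x j
  show thesis
  proof (rule that[of f])
    show "continuous_on UNIV f"
    proof (rule continuous_on_coordinatewise_then_product)
      fix j show "continuous_on UNIV (\<lambda>x. f x j)"
        using e(1)[of j] by (cases "j < d") (simp_all add: f_def)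
    qed
    show "f x \<in> eucl d" for x by (simp add: f_def eucl_def)
    show "f x = g x" if x: "x \<in> C" for x
    proof
      fix j
      have "g x \<in> eucl d" using g(2) x by blast
      then show "f x j = g x j" using e(2)[OF x, of j] by (simp add: f_def eucl_def)
    qed
  qed
qed

lemma disjoint_family_card_le:
  assumes "finite F" "finite V" "pairwise disjnt F" "\<And>A. A \<in> F \<Longrightarrow> A \<subseteq> V"
  shows "(\<Sum>A\<in>F. card A) \<le> card V"
proof -
  have "(\<Sum>A\<in>F. card A) = card (\<Union>F)"
    using assms by (intro card_Union_disjoint[symmetric]) (auto intro: finite_subset)
  also have "\<dots> \<le> card V" using assms by (intro card_mono) auto
  finally show ?thesis .
qed

text \<open>\<open>q\<close> faces with \<open>d + 1\<close> vertices each would need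
  \<open>q * (d + 1)\<close> vertices, which is \<open>d\<close> more than there are. A small face
  confines a winding point to the image of the skeleton.\<close>

lemma exists_small_face:
  assumes F: "pairwise disjnt F" "\<And>A. A \<in> F \<Longrightarrow> A \<subseteq> {..(d + 1) * (q - 1)}" "card F = q"
    and d: "0 < d" "0 < q"
  shows "\<exists>A\<in>F. card A \<le> d"
proof (rule ccontr)
  assume "\<not> ?thesis"
  then have "d + 1 \<le> card A" if "A \<in> F" for A using that by force
  then have "card F * (d + 1) \<le> (\<Sum>A\<in>F. card A)"
    using sum_bounded_below[of F "d + 1" card] by simp
  also have "\<dots> \<le> card {..(d + 1) * (q - 1)}"
    using F d by (intro disjoint_family_card_le) (auto intro: card_ge_0_finite)
  finally have "q * (d + 1) \<le> (d + 1) * (q - 1) + 1" using F(3) by simp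
  then show False using d by (cases q) auto
qed

lemma uniform_distance:
  fixes K :: "(nat \<Rightarrow> real) set"
  assumes "compact K" "l \<notin> K"
  obtains r where "0 < r" "\<And>z. z \<in> K \<Longrightarrow> \<exists>j. r < \<bar>l j - z j\<bar>"
proof -
  have "open (- K)" using assms(1) compact_imp_closed by blast
  then obtain e where e: "0 < e" "ball l e \<subseteq> - K" using assms(2) open_contains_ball[of "- K"] by blast
  show thesis
  proof (rule that[of "e / 3"])
    fix z assume z: "z \<in> K"
    show "\<exists>j. e / 3 < \<bar>l j - z j\<bar>"
    proof (rule ccontr)
      assume "\<not> ?thesis"
      then have "dist l z \<le> 2 * (e / 3)" by (intro dist_fun_le) (auto simp: not_less)
      then have "z \<in> ball l e" using e(1) by simp
      then show False using e(2) z by blast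
    qed
  qed (use e in auto)
qed

lemma face_boundary_subset_skeleton:
  assumes "S \<subseteq> {..N}" "card S = d + 1"
  shows "face_boundary S \<subseteq> simplex_skeleton N (d - 1)"
proof -
  have "T \<in> simplex_faces N (d - 1)" if "T \<subset> S" "T \<noteq> {}" for T
  proof -
    have "finite S" using assms(1) by (rule finite_subset) simp
    then have "card T < card S" using that by (intro psubset_card_mono)
    then show ?thesis using that assms by (auto simp: simplex_faces_def face_dim_def)
  qed
  then show ?thesis by (auto simp: face_boundary_def simplex_skeleton_def)
qed

text \<open>Outside the winding set, \<open>f\<close> is null-homotopic in the complement of
  \<open>l\<close>, and this survives small changes: once \<open>p\<close> is translated to
  \<open>l\<close>, the translate of \<open>g\<close> is joined to \<open>f\<close> by segments that
  stay away from \<open>l\<close>.\<close>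

lemma winding_set_approx:
  assumes f: "continuous_on (face_boundary S) f" "f ` face_boundary S \<subseteq> eucl d"
    and S: "S \<subseteq> {..N}" "2 \<le> card S" and l: "l \<in> eucl d" "l \<notin> winding_set d S f"
  shows "\<exists>r>0. \<forall>g p. continuous_on (face_boundary S) g \<longrightarrow> g ` face_boundary S \<subseteq> eucl d \<longrightarrow>
    p \<in> eucl d \<longrightarrow> (\<forall>z\<in>face_boundary S. \<forall>j<d. \<bar>g z j - f z j\<bar> < r) \<longrightarrow>
    (\<forall>j<d. \<bar>p j - l j\<bar> < r) \<longrightarrow> p \<notin> winding_set d S g"
proof -
  let ?X = "face_boundary S"
  have finS: "finite S" using S(1) by (rule finite_subset) simp
  have ne: "?X \<noteq> {}" by (rule face_boundary_nonempty[OF finS S(2)])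
  have lf: "l \<notin> f ` ?X" using l by (auto simp: winding_set_def)
  then have "\<not> winding_nonzero d S f l"
    using l by (auto simp: winding_set_def topspace_Euclidean_space eucl_def)
  then have null: "null_in ?X (eucl d - {l}) f"
    using winding_nonzero_iff[OF f(1) _ ne l(1)] f(2) lf by blast
  obtain r where r: "0 < r" "\<And>z. z \<in> f ` ?X \<Longrightarrow> \<exists>j. r < \<bar>l j - z j\<bar>"
    using uniform_distance[OF compact_continuous_image[OF f(1) compact_face_boundary[OF S(1)]] lf] by blast
  show ?thesis
  proof (intro exI[of _ "r / 4"] conjI allI impI)
    fix g p assume g: "continuous_on ?X g" "g ` ?X \<subseteq> eucl d" and p: "p \<in> eucl d"
      and "\<forall>z\<in>?X. \<forall>j<d. \<bar>g z j - f z j\<bar> < r / 4" "\<forall>j<d. \<bar>p j - l j\<bar> < r / 4"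
    note gf = this(4)[rule_format] and pl = this(5)[rule_format]
    have gf': "\<bar>g z j - f z j\<bar> \<le> r / 4" if z: "z \<in> ?X" for z j
    proof (cases "j < d")
      case False
      have "g z \<in> eucl d" "f z \<in> eucl d" using z g(2) f(2) by auto
      then show ?thesis using False r(1) by (simp add: eucl_def)
    qed (use gf[OF z] in \<open>auto simp: less_imp_le\<close>)
    have pl': "\<bar>p j - l j\<bar> \<le> r / 4" for j
      using pl[of j] l(1) p r(1) by (cases "j < d") (auto simp: eucl_def less_imp_le)
    have far: "y \<noteq> l" if z: "z \<in> ?X" and y: "\<And>j. \<bar>y j - f z j\<bar> \<le> r / 2" for y z
    proof
      assume "y = l"
      then obtain j where "r < \<bar>y j - f z j\<bar>" using r(2)[of "f z"] z by auto
      then show False using y[of j] r(1) by linarith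
    qed
    have pg: "p \<notin> g ` ?X"
    proof
      assume "p \<in> g ` ?X"
      then obtain z where z: "z \<in> ?X" "p = g z" by auto
      have "\<bar>l j - f z j\<bar> \<le> r / 2" for j
        using gf'[OF z(1), of j] pl'[of j] fun_cong[OF z(2), of j] by linarith
      then show False using far[OF z(1), of l] by blast
    qed
    \<comment> \<open>The translate that moves \<open>p\<close> to \<open>l\<close>. Its distance
      from \<open>f\<close> is at most \<open>r / 4\<close> for \<open>g\<close> and
      \<open>r / 4\<close> for the translation, together less than \<open>r\<close>.\<close>
    define g' where "g' z j = g z j + (l j - p j)" for z j
    have g': "continuous_on ?X g'"
      unfolding g'_def
      by (intro continuous_on_coordinatewise_then_product continuous_on_add continuous_on_const
        continuous_on_coordinate[OF g(1)])
    have "homotopic_with_canon (\<lambda>_. True) ?X (eucl d - {l}) g' f"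
    proof (rule homotopic_with_linear_coordinates[OF g' f(1)])
      fix s :: real and z assume s: "s \<in> {0..1}" and z: "z \<in> ?X"
      let ?y = "\<lambda>j. (1 - s) * g' z j + s * f z j"
      have "g z \<in> eucl d" "f z \<in> eucl d" using z g(2) f(2) by auto
      then have "?y \<in> eucl d" using l(1) p by (simp add: eucl_def g'_def)
      moreover have "?y \<noteq> l"
      proof (rule far[OF z])
        fix j
        have "?y j - f z j = (1 - s) * (g' z j - f z j)" by (simp add: algebra_simps)
        then have "\<bar>?y j - f z j\<bar> = (1 - s) * \<bar>g' z j - f z j\<bar>" using s by (simp add: abs_mult)
        also have "\<dots> \<le> 1 * \<bar>g' z j - f z j\<bar>" using s by (intro mult_right_mono) auto
        also have "\<dots> \<le> \<bar>g z j - f z j\<bar> + \<bar>p j - l j\<bar>" by (simp add: g'_def)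
        also have "\<dots> \<le> r / 2" using gf'[OF z, of j] pl'[of j] by linarith
        finally show "\<bar>?y j - f z j\<bar> \<le> r / 2" .
      qed
      ultimately show "?y \<in> eucl d - {l}" by blast
    qed auto
    then have "null_in ?X (eucl d - {l}) g'"
      using null unfolding null_in_def by (meson homotopic_with_trans)
    then obtain c where c: "homotopic_with_canon (\<lambda>_. True) ?X (eucl d - {l}) g' (\<lambda>_. c)"
      unfolding null_in_def by blast
    let ?t = "\<lambda>y j. y j + (p j - l j)"
    have "homotopic_with_canon (\<lambda>_. True) ?X (eucl d - {p}) (?t \<circ> g') (?t \<circ> (\<lambda>_. c))"
    proof (rule homotopic_with_compose_continuous_left[OF c])
      show "continuous_on (eucl d - {l}) ?t"
        by (intro continuous_on_coordinatewise_then_product continuous_on_add continuous_on_const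
          continuous_on_coordinate[OF continuous_on_id])
      show "?t \<in> (eucl d - {l}) \<rightarrow> (eucl d - {p})"
      proof
        fix y assume y: "y \<in> eucl d - {l}"
        have "y = l" if "?t y = p"
        proof
          fix j show "y j = l j" using fun_cong[OF that, of j] by simp
        qed
        then show "?t y \<in> eucl d - {p}" using y l(1) p by (auto simp: eucl_def)
      qed
    qed
    moreover have "?t \<circ> g' = g" by (auto simp: g'_def)
    moreover have "?t \<circ> (\<lambda>_. c) = (\<lambda>_. ?t c)" by auto
    ultimately have "null_in ?X (eucl d - {p}) g" unfolding null_in_def by auto
    then have "\<not> winding_nonzero d S g p"
      using winding_nonzero_iff[OF g(1) _ ne p] g(2) pg by blast
    then show "p \<notin> winding_set d S g" using pg by (auto simp: winding_set_def)
  qed (use r in simp)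
qed

lemma image_approx:
  assumes f: "continuous_on (face_realization S) f" "f ` face_realization S \<subseteq> eucl d"
    and S: "S \<subseteq> {..N}" and l: "l \<in> eucl d" "l \<notin> f ` face_realization S"
  shows "\<exists>r>0. \<forall>g p. p \<in> eucl d \<longrightarrow>
    (\<forall>z\<in>face_realization S. \<forall>j<d. \<bar>g z j - f z j\<bar> < r) \<longrightarrow>
    (\<forall>j<d. \<bar>p j - l j\<bar> < r) \<longrightarrow> p \<notin> g ` face_realization S"
proof -
  obtain r where r: "0 < r" "\<And>z. z \<in> f ` face_realization S \<Longrightarrow> \<exists>j. r < \<bar>l j - z j\<bar>"
    using uniform_distance[OF compact_continuous_image[OF f(1) compact_face_realization[OF S]] l(2)] by blast
  show ?thesis
  proof (intro exI[of _ "r / 2"] conjI allI impI)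
    fix g p assume "\<forall>z\<in>face_realization S. \<forall>j<d. \<bar>g z j - f z j\<bar> < r / 2"
      "\<forall>j<d. \<bar>p j - l j\<bar> < r / 2" and p: "p \<in> eucl d"
    note gf = this(1)[rule_format] and pl = this(2)[rule_format]
    show "p \<notin> g ` face_realization S"
    proof
      assume "p \<in> g ` face_realization S"
      then obtain z where z: "z \<in> face_realization S" "p = g z" by auto
      obtain j where j: "r < \<bar>l j - f z j\<bar>" using r(2)[of "f z"] z(1) by auto
      have "j < d"
      proof (rule ccontr)
        assume "\<not> j < d"
        moreover have "f z \<in> eucl d" using f(2) z(1) by blast
        ultimately show False using l(1) j r(1) by (simp add: eucl_def)
      qed
      then have "\<bar>g z j - f z j\<bar> < r / 2" "\<bar>p j - l j\<bar> < r / 2" using gf[OF z(1)] pl by blast+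
      then show False using fun_cong[OF z(2), of j] j by linarith
    qed
  qed (use r in simp)
qed

text \<open>There are finitely many families of faces, so one of them serves approximations of every
  quality, and its winding points accumulate at some \<open>l\<close>. If \<open>l\<close> failed
  for a face under \<open>f\<close>, then by \<open>winding_set_approx\<close> or
  \<open>image_approx\<close> so would the winding points of close approximations.\<close>

lemma winding_partition_limit:
  assumes d: "0 < d" "0 < q"
    and f: "continuous_on (simplex_skeleton ((d + 1) * (q - 1)) (d - 1)) f"
      "f ` simplex_skeleton ((d + 1) * (q - 1)) (d - 1) \<subseteq> eucl d"
    and approx: "\<And>e. 0 < e \<Longrightarrow> \<exists>g F. continuous_on (simplex_skeleton ((d + 1) * (q - 1)) (d - 1)) g \<and>
        g ` simplex_skeleton ((d + 1) * (q - 1)) (d - 1) \<subseteq> eucl d \<and>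
        (\<forall>x\<in>simplex_skeleton ((d + 1) * (q - 1)) (d - 1). \<forall>j<d. \<bar>g x j - f x j\<bar> < e) \<and>
        winding_partition d q g F"
  shows "\<exists>F. winding_partition d q f F"
proof -
  define N where "N = (d + 1) * (q - 1)"
  let ?K = "simplex_skeleton N (d - 1)"
  note approx = approx[folded N_def] and f = f[folded N_def]
  define good where "good g p S \<longleftrightarrow> (face_dim S \<le> d - 1 \<longrightarrow> p \<in> g ` face_realization S) \<and>
        (face_dim S = d \<longrightarrow> p \<in> winding_set d S g)" for g p S
  define near where "near e g \<longleftrightarrow> continuous_on ?K g \<and> g ` ?K \<subseteq> eucl d \<and>
      (\<forall>x\<in>?K. \<forall>j<d. \<bar>g x j - f x j\<bar> < e)" for e g
  define part where "part F \<longleftrightarrow> F \<subseteq> simplex_faces N d \<and> card F = q \<and> pairwise disjnt F" for F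
  have wp: "winding_partition d q g F \<longleftrightarrow> part F \<and> (\<exists>p\<in>eucl d. \<forall>S\<in>F. good g p S)" for g F
    by (simp add: winding_partition_def part_def good_def N_def topspace_Euclidean_space eucl_def)
  define e where "e n = 1 / real (Suc n)" for n
  have e0: "0 < e n" for n by (simp add: e_def)
  have "\<exists>g F p. near (e n) g \<and> part F \<and> p \<in> eucl d \<and> (\<forall>S\<in>F. good g p S)" for n
    using approx[OF e0[of n]] unfolding wp near_def by blast
  then obtain g F p where gFp: "\<And>n. near (e n) (g n)" "\<And>n. part (F n)" "\<And>n. p n \<in> eucl d"
    "\<And>n. \<forall>S\<in>F n. good (g n) (p n) S" by metis
  have "\<exists>x\<in>?K. p n = g n x" for n
  proof -
    have F: "F n \<subseteq> simplex_faces N d" "card (F n) = q" "pairwise disjnt (F n)"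
      using gFp(2)[of n] by (auto simp: part_def)
    have "A \<subseteq> {..(d + 1) * (q - 1)}" if "A \<in> F n" for A
      using F(1) that by (auto simp: simplex_faces_def N_def)
    then obtain A where A: "A \<in> F n" "card A \<le> d" using exists_small_face[OF F(3) _ F(2) d] by blast
    then have "face_dim A \<le> d - 1" by (simp add: face_dim_def)
    moreover have "A \<in> simplex_faces N (d - 1)"
      using F(1) A calculation by (auto simp: simplex_faces_def)
    moreover have "p n \<in> g n ` face_realization A"
      using gFp(4)[of n] A(1) calculation(1) by (auto simp: good_def)
    ultimately show ?thesis by (auto simp: simplex_skeleton_def)
  qed
  then obtain x where x: "\<And>n. x n \<in> ?K" "\<And>n. p n = g n (x n)" by metis
  have "range F \<subseteq> Pow (simplex_faces N d)" using gFp(2) by (auto simp: part_def)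
  then have "finite (range F)" by (rule finite_subset) (simp add: finite_simplex_faces)
  then obtain n0 where inf: "infinite {n. F n = F n0}"
    using pigeonhole_infinite[of UNIV F] by auto
  define r where "r = enumerate {n. F n = F n0}"
  have r: "strict_mono r" "\<And>k. F (r k) = F n0"
    using strict_mono_enumerate[OF inf] enumerate_in_set[OF inf] by (auto simp: r_def)
  \<comment> \<open>The winding points themselves lie in varying images; the points
    \<open>f (x n)\<close> lie in one compact set and differ from them by less than
    \<open>e n\<close> in each coordinate.\<close>
  have "compact (f ` ?K)" by (rule compact_continuous_image[OF f(1) compact_simplex_skeleton])
  then have "seq_compact (f ` ?K)" by (simp add: compact_eq_seq_compact_metric)
  then obtain l s where l: "l \<in> f ` ?K" and s: "strict_mono s"
    and lim: "((\<lambda>k. f (x (r k))) \<circ> s) \<longlonglongrightarrow> l"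
    by (rule seq_compactE[where f = "\<lambda>k. f (x (r k))"]) (use x(1) in auto)
  have le: "l \<in> eucl d" using l f(2) by blast
  have coord: "(\<lambda>k. f (x (r (s k))) j) \<longlonglongrightarrow> l j" for j
    using continuous_on_tendsto_compose[OF continuous_on_product_coordinates[of j] lim] by (simp add: o_def)
  have ex: "\<exists>n. F n = F n0 \<and> near c (g n) \<and> (\<forall>j<d. \<bar>p n j - l j\<bar> < c)" if c: "0 < c" for c
  proof -
    obtain m where m: "e m < c / 2"
      using c reals_Archimedean[of "c / 2"] by (auto simp: e_def inverse_eq_divide)
    have "\<forall>\<^sub>F k in sequentially. \<bar>f (x (r (s k))) j - l j\<bar> < c / 2" for j
      using tendstoD[OF coord, of "c / 2" j] c by (simp add: dist_real_def)
    then have "\<forall>\<^sub>F k in sequentially. \<forall>j\<in>{..<d}. \<bar>f (x (r (s k))) j - l j\<bar> < c / 2"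
      by (intro eventually_ball_finite) blast+
    then have "\<forall>\<^sub>F k in sequentially. \<forall>j<d. \<bar>f (x (r (s k))) j - l j\<bar> < c / 2"
      by (simp only: Ball_def lessThan_iff)
    then have "\<forall>\<^sub>F k in sequentially. (\<forall>j<d. \<bar>f (x (r (s k))) j - l j\<bar> < c / 2) \<and> m \<le> k"
      using eventually_ge_at_top by (rule eventually_conj)
    then obtain k where k: "\<forall>j<d. \<bar>f (x (r (s k))) j - l j\<bar> < c / 2" "m \<le> k"
      using eventually_happens by force
    define n where "n = r (s k)"
    have "k \<le> n" using strict_mono_imp_increasing[OF s, of k] strict_mono_imp_increasing[OF r(1), of "s k"]
      by (simp add: n_def)
    then have en: "e n < c / 2"
    proof -
      have "e n \<le> e m" using k(2) \<open>k \<le> n\<close> by (simp add: e_def frac_le)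
      then show ?thesis using m by linarith
    qed
    have gn: "\<bar>g n y j - f y j\<bar> < e n" if "y \<in> ?K" "j < d" for y j
      using gFp(1)[of n] that by (auto simp: near_def)
    have "near c (g n)"
      unfolding near_def
    proof (intro conjI ballI allI impI)
      show "continuous_on ?K (g n)" "g n ` ?K \<subseteq> eucl d" using gFp(1)[of n] by (auto simp: near_def)
      fix y j assume "y \<in> ?K" "j < d"
      from gn[OF this] show "\<bar>g n y j - f y j\<bar> < c" using en c by linarith
    qed
    moreover have "\<bar>p n j - l j\<bar> < c" if "j < d" for j
    proof -
      have "\<bar>p n j - f (x n) j\<bar> < c / 2" using gn[OF x(1) that, of n] en unfolding x(2)[of n] by linarith
      moreover have "\<bar>f (x n) j - l j\<bar> < c / 2" using k(1) that by (simp add: n_def)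
      ultimately show ?thesis by linarith
    qed
    ultimately show ?thesis using r(2) by (auto simp: n_def)
  qed
  have "good f l S" if S: "S \<in> F n0" for S
  proof -
    have SN: "S \<in> simplex_faces N d" using gFp(2)[of n0] S by (auto simp: part_def)
    then have S': "S \<subseteq> {..N}" "S \<noteq> {}" by (auto simp: simplex_faces_def)
    then have finS: "finite S" using finite_subset by blast
    show ?thesis
      unfolding good_def
    proof (intro conjI impI)
      assume dim: "face_dim S \<le> d - 1"
      have SK: "face_realization S \<subseteq> ?K" using S' dim by (auto simp: simplex_skeleton_def simplex_faces_def)
      show "l \<in> f ` face_realization S"
      proof (rule ccontr)
        assume nl: "l \<notin> f ` face_realization S"
        have fS: "f ` face_realization S \<subseteq> eucl d" using f(2) SK by blast
        obtain c where c: "0 < c" "\<forall>g p. p \<in> eucl d \<longrightarrow>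
            (\<forall>z\<in>face_realization S. \<forall>j<d. \<bar>g z j - f z j\<bar> < c) \<longrightarrow>
            (\<forall>j<d. \<bar>p j - l j\<bar> < c) \<longrightarrow> p \<notin> g ` face_realization S"
          using image_approx[OF continuous_on_subset[OF f(1) SK] fS S'(1) le nl] by blast
        obtain n where n: "F n = F n0" "near c (g n)" "\<forall>j<d. \<bar>p n j - l j\<bar> < c" using ex[OF c(1)] by blast
        have "p n \<notin> g n ` face_realization S"
          by (rule c(2)[rule_format, OF gFp(3)]) (use n SK in \<open>auto simp: near_def\<close>)
        moreover have "p n \<in> g n ` face_realization S"
          using gFp(4)[of n] n(1) S dim by (auto simp: good_def)
        ultimately show False by blast
      qed
    next
      assume dim: "face_dim S = d"
      have cS: "card S = d + 1"
        using dim S'(2) finS d by (auto simp: face_dim_def)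
      have SK: "face_boundary S \<subseteq> ?K" by (rule face_boundary_subset_skeleton[OF S'(1) cS])
      show "l \<in> winding_set d S f"
      proof (rule ccontr)
        assume nl: "l \<notin> winding_set d S f"
        have fS: "f ` face_boundary S \<subseteq> eucl d" using f(2) SK by blast
        have "2 \<le> card S" using cS d by simp
        obtain c where c: "0 < c" "\<forall>g p. continuous_on (face_boundary S) g \<longrightarrow>
            g ` face_boundary S \<subseteq> eucl d \<longrightarrow> p \<in> eucl d \<longrightarrow>
            (\<forall>z\<in>face_boundary S. \<forall>j<d. \<bar>g z j - f z j\<bar> < c) \<longrightarrow>
            (\<forall>j<d. \<bar>p j - l j\<bar> < c) \<longrightarrow> p \<notin> winding_set d S g"
          using winding_set_approx[OF continuous_on_subset[OF f(1) SK] fS S'(1) \<open>2 \<le> card S\<close> le nl] by blast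
        obtain n where n: "F n = F n0" "near c (g n)" "\<forall>j<d. \<bar>p n j - l j\<bar> < c" using ex[OF c(1)] by blast
        have gn: "continuous_on ?K (g n)" "g n ` ?K \<subseteq> eucl d" using n(2) by (auto simp: near_def)
        have gb: "g n ` face_boundary S \<subseteq> eucl d" using gn(2) SK by blast
        have "p n \<notin> winding_set d S (g n)"
          by (rule c(2)[rule_format, OF continuous_on_subset[OF gn(1) SK] gb gFp(3)])
            (use n SK in \<open>auto simp: near_def\<close>)
        moreover have "p n \<in> winding_set d S (g n)"
          using gFp(4)[of n] n(1) S dim by (auto simp: good_def)
        ultimately show False by blast
      qed
    qed
  qed
  then have "winding_partition d q f (F n0)" unfolding wp using gFp(2) le by blast
  then show ?thesis by blast
qed

section \<open>The equivalence\<close>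

text \<open>The affine map that sends every new vertex to the apex \<open>Suc N\<close> adds up
  their weights there. The apex is listed also when \<open>S\<close> has no new vertex; its weight
  is then zero.\<close>

lemma face_realization_collapse:
  assumes x: "x \<in> face_realization S" and S: "S \<subseteq> {..N + m}"
  shows "(\<lambda>i. if i \<le> N then x i else if i = Suc N then \<Sum>k\<in>{Suc N..N + m}. x k else 0)
    \<in> face_realization (insert (Suc N) (S \<inter> {..N}))" (is "?c \<in> _")
proof -
  have finS: "finite S" using S by (rule finite_subset) simp
  have "sum ?c (insert (Suc N) (S \<inter> {..N})) = (\<Sum>k\<in>{Suc N..N + m}. x k) + sum ?c (S \<inter> {..N})"
    using finS by simp
  also have "sum ?c (S \<inter> {..N}) = sum x {..N}"
    using face_realizationD(2)[OF x] finS by (intro sum.mono_neutral_cong_left) auto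
  also have "(\<Sum>k\<in>{Suc N..N + m}. x k) + sum x {..N} = sum x {..N + m}"
    by (subst sum.union_disjoint[symmetric]) (auto intro!: sum.cong)
  also have "sum x {..N + m} = sum x S"
    using face_realizationD(2)[OF x] S by (intro sum.mono_neutral_right) auto
  also have "\<dots> = 1" using x by (rule face_realizationD)
  finally have "sum ?c (insert (Suc N) (S \<inter> {..N})) = 1" .
  moreover have "0 \<le> ?c i" for i using x by (auto simp: face_realizationD intro!: sum_nonneg)
  moreover have "?c i = 0" if "i \<notin> insert (Suc N) (S \<inter> {..N})" for i
    using that face_realizationD(2)[OF x] by auto
  ultimately show ?thesis by (auto simp: face_realization_def)
qed

text \<open>Only \<open>q - 1\<close> new vertices exist, too few to give one to each of
  \<open>q\<close> disjoint faces.\<close>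

lemma disjoint_faces_new_vertices:
  assumes "pairwise disjnt F" "card F = q" "0 < q" "\<And>S. S \<in> F \<Longrightarrow> S \<subseteq> {..N + (q - 1)}"
  shows "\<exists>S\<in>F. S \<subseteq> {..N}"
proof (rule ccontr)
  assume "\<not> ?thesis"
  have "S \<inter> {Suc N..N + (q - 1)} \<noteq> {}" if SF: "S \<in> F" for S
  proof -
    obtain k where k: "k \<in> S" "k \<notin> {..N}" using \<open>\<not> (\<exists>S\<in>F. S \<subseteq> {..N})\<close> SF by blast
    then have "k \<in> {Suc N..N + (q - 1)}" using assms(4)[OF SF] by auto
    then show ?thesis using k by blast
  qed
  then have 1: "1 \<le> card (S \<inter> {Suc N..N + (q - 1)})" if "S \<in> F" for S
    using that by (simp add: Suc_le_eq card_gt_0_iff)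
  define G where "G = (\<lambda>S. S \<inter> {Suc N..N + (q - 1)}) ` F"
  have finF: "finite F" using assms by (auto intro: card_ge_0_finite)
  have inj: "inj_on (\<lambda>S. S \<inter> {Suc N..N + (q - 1)}) F"
  proof (rule inj_onI, rule ccontr)
    fix S T assume ST: "S \<in> F" "T \<in> F" "S \<inter> {Suc N..N + (q - 1)} = T \<inter> {Suc N..N + (q - 1)}" "S \<noteq> T"
    have "S \<inter> T = {}" using pairwiseD[OF assms(1) ST(1,2,4)] by (simp add: disjnt_def)
    then have "S \<inter> {Suc N..N + (q - 1)} = {}" using ST(3) by blast
    then show False using 1[OF ST(1)] by simp
  qed
  have "pairwise disjnt G"
    unfolding G_def pairwise_image using assms(1) by (auto simp: pairwise_def disjnt_def)
  then have "(\<Sum>A\<in>G. card A) \<le> card {Suc N..N + (q - 1)}"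
    using finF by (intro disjoint_family_card_le) (auto simp: G_def)
  moreover have "(\<Sum>A\<in>G. card A) = (\<Sum>S\<in>F. card (S \<inter> {Suc N..N + (q - 1)}))"
    using inj by (simp add: G_def sum.reindex)
  moreover have "card F * 1 \<le> (\<Sum>S\<in>F. card (S \<inter> {Suc N..N + (q - 1)}))"
    using sum_bounded_below[of F 1 "\<lambda>S. card (S \<inter> {Suc N..N + (q - 1)})"] 1 by simp
  ultimately have "q \<le> card {Suc N..N + (q - 1)}" using assms(2) by linarith
  then show False using assms(3) by simp
qed

text \<open>The height is the weight of the apex minus the depths in the \<open>d\<close>-faces, which vanish exactly on the
  \<open>(d - 1)\<close>-skeleton and the cone over it.\<close>

lemma cone_extension:
  assumes f: "continuous_on UNIV f" "\<And>x. f x \<in> eucl d" and d: "0 < d" and P: "finite P" "P \<subseteq> eucl d"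
  shows "\<exists>G. continuous_on UNIV G \<and> (\<forall>x. G x \<in> eucl (d + 1)) \<and>
    (\<forall>x\<in>standard_simplex N. G x d \<le> 0) \<and>
    (\<forall>S. S \<subseteq> {..N} \<longrightarrow> card S \<le> d \<longrightarrow>
       (\<forall>x\<in>face_realization (insert (Suc N) S). G x = (f x)(d := x (Suc N)))) \<and>
    (\<forall>T. T \<subseteq> {..N} \<longrightarrow> card T = d + 1 \<longrightarrow>
       (\<forall>x\<in>face_realization (insert (Suc N) T). G x \<in> P \<longrightarrow> G x \<in> winding_set d T f))"
proof -
  let ?n = "Suc N"
  define Ts where "Ts = {T. T \<subseteq> {..N} \<and> card T = d + 1}"
  define C where "C T = face_realization (insert ?n T)" for T
  define Q where "Q T = {p \<in> P. p \<notin> winding_set d T f}" for T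
  define G0 where "G0 x = (f x)(d := x ?n - (\<Sum>T\<in>Ts. depth T x))" for x
  have T: "T \<subseteq> {..N}" "card T = d + 1" "finite T" "T \<noteq> {}" "2 \<le> card T" if "T \<in> Ts" for T
    using that d by (auto simp: Ts_def intro: finite_subset)
  have finTs: "finite Ts" by (rule finite_subset[of _ "Pow {..N}"]) (auto simp: Ts_def)
  have depth0: "depth T x = 0"
    if TT: "T \<in> Ts" and x: "x \<in> face_realization (insert ?n S)" and nTS: "\<not> T \<subseteq> S" for T S x
  proof -
    obtain i where i: "i \<in> T" "i \<notin> S" using nTS by blast
    moreover have "i \<noteq> ?n" using T(1)[OF TT] i by auto
    ultimately have "x i = 0" using face_realizationD(2)[OF x] by auto
    then show ?thesis
      using i T(3)[OF TT] face_realizationD(1)[OF x] by (intro depth_eq_0) auto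
  qed
  \<comment> \<open>On the cone over \<open>T\<close> only the depth in \<open>T\<close> survives.
    So \<open>G0\<close> agrees there with the map prescribed in
    \<open>homotopic_extend_to_join\<close>, and two cones meet only where both extensions equal
    \<open>G0\<close>.\<close>
  have depthC: "depth T' x = 0" if "T \<in> Ts" "T' \<in> Ts" "T' \<noteq> T" "x \<in> C T" for T T' x
  proof (rule depth0[OF that(2) that(4)[unfolded C_def]])
    show "\<not> T' \<subseteq> T"
      using card_subset_eq[of T T'] T(2,3)[OF that(1)] T(2)[OF that(2)] that(3) by auto
  qed
  have G0_C: "G0 x = (f x)(d := x ?n - depth T x)" if "T \<in> Ts" "x \<in> C T" for T x
  proof -
    have "(\<Sum>T'\<in>Ts. depth T' x) = (\<Sum>T'\<in>{T}. depth T' x)"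
      using that depthC finTs by (intro sum.mono_neutral_right) auto
    then show ?thesis by (simp add: G0_def)
  qed
  have "\<exists>K. continuous_on (C T) K \<and> K ` C T \<subseteq> eucl (d + 1) - Q T \<and>
      (\<forall>x\<in>C T. x ?n = 0 \<or> depth T x = 0 \<longrightarrow> K x = G0 x)" if TT: "T \<in> Ts" for T
  proof -
    have av: "f ` face_boundary T \<inter> Q T = {}" by (auto simp: Q_def winding_set_def)
    have Qf: "finite (Q T)" "Q T \<subseteq> eucl d" using P by (auto simp: Q_def)
    have null: "null_in (face_boundary T) (eucl d - {p}) f" if p: "p \<in> Q T" for p
    proof -
      have pe: "p \<in> eucl d" using p Qf by blast
      have pf: "p \<notin> f ` face_boundary T" using p av by blast
      then have "\<not> winding_nonzero d T f p"
        using p pe by (auto simp: Q_def winding_set_def topspace_Euclidean_space eucl_def)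
      then show ?thesis
        using winding_nonzero_iff[OF continuous_on_subset[OF f(1) subset_UNIV] _
          face_boundary_nonempty[OF T(3,5)[OF TT]] pe] f(2) pf by blast
    qed
    have "\<exists>K. continuous_on (C T) K \<and> K ` C T \<subseteq> eucl (d + 1) - Q T \<and>
        (\<forall>x\<in>C T. x ?n = 0 \<or> depth T x = 0 \<longrightarrow> K x = (f x)(d := x ?n - depth T x))"
      unfolding C_def by (rule homotopic_extend_to_join[OF T(1,5)[OF TT] Qf f av null])
    then show ?thesis using G0_C[OF TT] by simp
  qed
  then obtain K where K: "\<And>T. T \<in> Ts \<Longrightarrow> continuous_on (C T) (K T)"
    "\<And>T. T \<in> Ts \<Longrightarrow> K T ` C T \<subseteq> eucl (d + 1) - Q T"
    "\<And>T x. T \<in> Ts \<Longrightarrow> x \<in> C T \<Longrightarrow> x ?n = 0 \<or> depth T x = 0 \<Longrightarrow> K T x = G0 x"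
    by metis
  define A where "A = standard_simplex N \<union> (\<Union>S\<in>{S. S \<subseteq> {..N} \<and> card S \<le> d}. face_realization (insert ?n S))"
  \<comment> \<open>Corrections are added to \<open>G0\<close>; at each point at most one of them is
    nonzero.\<close>
  define G1 where "G1 x j = G0 x j + (\<Sum>T\<in>Ts. if x \<in> C T then K T x j - G0 x j else 0)" for x j
  have G1_C: "G1 x = K T x" if "T \<in> Ts" "x \<in> C T" for T x
  proof
    fix j
    have "(\<Sum>T'\<in>Ts. if x \<in> C T' then K T' x j - G0 x j else 0) =
        (\<Sum>T'\<in>{T}. if x \<in> C T' then K T' x j - G0 x j else 0)"
      using that depthC K(3) finTs by (intro sum.mono_neutral_right) auto
    then show "G1 x j = K T x j" using that by (simp add: G1_def)
  qed
  have G1_A: "G1 x = G0 x" if x: "x \<in> A" for x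
  proof
    fix j
    have "K T x = G0 x" if TC: "T \<in> Ts" "x \<in> C T" for T
    proof (rule K(3)[OF TC])
      from x consider "x \<in> standard_simplex N"
        | S where "S \<subseteq> {..N}" "card S \<le> d" "x \<in> face_realization (insert ?n S)"
        by (auto simp: A_def)
      then show "x ?n = 0 \<or> depth T x = 0"
      proof cases
        case 1
        then show ?thesis by (simp add: standard_simplex_def)
      next
        case 2
        have "finite S" using 2(1) by (rule finite_subset) simp
        then have "\<not> T \<subseteq> S" using card_mono[of S T] T(2)[OF TC(1)] 2(2) by auto
        then show ?thesis using depth0[OF TC(1) 2(3)] by blast
      qed
    qed
    then have "(\<Sum>T\<in>Ts. if x \<in> C T then K T x j - G0 x j else 0) = 0" by (intro sum.neutral) simp
    then show "G1 x j = G0 x j" by (simp add: G1_def)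
  qed
  have cG0: "continuous_on UNIV G0"
  proof -
    have "continuous_on UNIV (\<lambda>x. \<Sum>T\<in>Ts. depth T x)"
      using T(3,4) by (intro continuous_on_sum) (auto intro: continuous_on_depth)
    then show ?thesis
      unfolding G0_def
      by (intro continuous_on_fun_upd f(1) continuous_on_diff continuous_on_product_coordinates)
  qed
  have clC: "closed (face_realization (insert ?n S))" if "S \<subseteq> {..N}" for S
    using that by (intro compact_imp_closed compact_face_realization[of _ ?n]) (auto simp: le_SucI)
  have clA: "closed A"
  proof -
    have "finite {S. S \<subseteq> {..N} \<and> card S \<le> d}" by (rule finite_subset[of _ "Pow {..N}"]) auto
    then show ?thesis unfolding A_def
      by (intro closed_Un closed_UN compact_imp_closed[OF compact_standard_simplex]) (auto intro: clC)
  qed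
  have clTs: "closed (C T)" if "T \<in> Ts" for T using clC[OF T(1)[OF that]] by (simp add: C_def)
  have "continuous_on (\<Union>T\<in>Ts. C T) G1"
  proof (rule continuous_on_closed_Union[OF finTs clTs])
    show "continuous_on (C T) G1" if "T \<in> Ts" for T
      using K(1)[OF that] G1_C[OF that] by (simp cong: continuous_on_cong)
  qed
  moreover have "continuous_on A G1"
    using continuous_on_subset[OF cG0 subset_UNIV, of A] G1_A by (simp cong: continuous_on_cong)
  moreover have clL: "closed (A \<union> (\<Union>T\<in>Ts. C T))" by (intro closed_Un clA closed_UN finTs ballI clTs)
  ultimately have cL: "continuous_on (A \<union> (\<Union>T\<in>Ts. C T)) G1"
    using clA by (intro continuous_on_closed_Un) (auto intro!: closed_UN finTs clTs)
  have G0e: "G0 x \<in> eucl (d + 1)" for x using f(2)[of x] by (simp add: G0_def eucl_def)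
  have "G1 ` (A \<union> (\<Union>T\<in>Ts. C T)) \<subseteq> eucl (d + 1)"
    using G1_A G1_C G0e K(2) by fastforce
  \<comment> \<open>Cones over faces with more than \<open>d + 1\<close> vertices carry no condition
    away from the smaller cones and the base, so any continuous extension serves.\<close>
  then obtain G where G: "continuous_on UNIV G" "\<And>x. G x \<in> eucl (d + 1)"
    "\<And>x. x \<in> A \<union> (\<Union>T\<in>Ts. C T) \<Longrightarrow> G x = G1 x"
    by (rule extend_to_eucl[OF clL cL]) blast
  show ?thesis
  proof (intro exI[of _ G] conjI allI ballI impI G(1,2))
    fix x assume x: "x \<in> standard_simplex N"
    then have "G x = G0 x" using G(3) G1_A by (auto simp: A_def)
    moreover have "0 \<le> (\<Sum>T\<in>Ts. depth T x)"
      using T(3,4) x by (intro sum_nonneg depth_nonneg) (auto simp: standard_simplex_def)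
    ultimately show "G x d \<le> 0" using x by (simp add: G0_def standard_simplex_def)
  next
    fix S x assume S: "S \<subseteq> {..N}" "card S \<le> d" and x: "x \<in> face_realization (insert ?n S)"
    have "finite S" using S(1) by (rule finite_subset) simp
    then have "\<not> T \<subseteq> S" if "T \<in> Ts" for T using card_mono[of S T] T(2)[OF that] S(2) by auto
    then have "(\<Sum>T\<in>Ts. depth T x) = 0" using depth0[OF _ x] by (intro sum.neutral) blast
    moreover have "x \<in> A" using S x by (auto simp: A_def)
    then have "G x = G0 x" using G(3) G1_A by auto
    ultimately show "G x = (f x)(d := x ?n)" by (simp add: G0_def)
  next
    fix T x assume TT: "T \<subseteq> {..N}" "card T = d + 1" and x: "x \<in> face_realization (insert ?n T)"
      and GP: "G x \<in> P"
    have TTs: "T \<in> Ts" and xC: "x \<in> C T" using TT x by (auto simp: Ts_def C_def)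
    have "x \<in> A \<union> (\<Union>T\<in>Ts. C T)" using TTs xC by blast
    then have "G x = K T x" using G(3)[of x] G1_C[OF TTs xC] by simp
    moreover have "K T x \<notin> Q T" using K(2)[OF TTs] xC by blast
    ultimately show "G x \<in> winding_set d T f" using GP by (auto simp: Q_def)
  qed
qed

text \<open>The sets of old vertices in the faces of a Tverberg partition for the cone map form the
  winding partition, with the common value \<open>y\<close> as winding point.\<close>

lemma winding_partition_of_generic_map:
  assumes d: "0 < d" and q: "0 < q"
    and tv: "\<And>f. continuous_map (space_on (standard_simplex ((d + 1 + 1) * (q - 1)))) (Euclidean_space (d + 1)) f \<Longrightarrow>
      \<exists>F. tverberg_partition (d + 1) q ((d + 1 + 1) * (q - 1)) f F"
    and f: "continuous_on UNIV f" "\<And>x. f x \<in> eucl d" and P: "finite P" "P \<subseteq> eucl d"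
    and gen: "\<And>F p. F \<subseteq> simplex_faces ((d + 1) * (q - 1)) (d - 1) \<Longrightarrow> pairwise disjnt F \<Longrightarrow>
       (\<And>A. A \<in> F \<Longrightarrow> p \<in> f ` face_realization A) \<Longrightarrow>
       (\<Sum>A\<in>F. d + 1 - card A) \<le> d \<and> (d = (\<Sum>A\<in>F. d + 1 - card A) \<longrightarrow> p \<in> P)"
  shows "\<exists>F. winding_partition d q f F"
proof -
  define N where "N = (d + 1) * (q - 1)"
  \<comment> \<open>Raising the dimension by one adds \<open>q - 1\<close> vertices, all of which
    \<open>col\<close> sends to the apex.\<close>
  have N': "(d + 1 + 1) * (q - 1) = N + (q - 1)" by (simp add: N_def)
  obtain G where G: "continuous_on UNIV G" "\<forall>x. G x \<in> eucl (d + 1)"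
    "\<forall>x\<in>standard_simplex N. G x d \<le> 0"
    "\<forall>S. S \<subseteq> {..N} \<longrightarrow> card S \<le> d \<longrightarrow>
       (\<forall>x\<in>face_realization (insert (Suc N) S). G x = (f x)(d := x (Suc N)))"
    "\<forall>T. T \<subseteq> {..N} \<longrightarrow> card T = d + 1 \<longrightarrow>
       (\<forall>x\<in>face_realization (insert (Suc N) T). G x \<in> P \<longrightarrow> G x \<in> winding_set d T f)"
    using cone_extension[OF f d P, of N] by blast
  define col :: "(nat \<Rightarrow> real) \<Rightarrow> nat \<Rightarrow> real" where
    "col x = (\<lambda>i. if i \<le> N then x i else if i = Suc N then \<Sum>k\<in>{Suc N..N + (q - 1)}. x k else 0)" for x
  have ccol: "continuous_on UNIV col"
  proof (rule continuous_on_coordinatewise_then_product)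
    fix i
    have "continuous_on UNIV (\<lambda>x. \<Sum>k\<in>{Suc N..N + (q - 1)}. x k :: real)"
      by (intro continuous_on_sum continuous_on_product_coordinates)
    then show "continuous_on UNIV (\<lambda>x. col x i)"
      by (cases "i \<le> N"; cases "i = Suc N") (simp_all add: col_def)
  qed
  have "continuous_map (space_on (standard_simplex ((d + 1 + 1) * (q - 1)))) (Euclidean_space (d + 1))
      (\<lambda>x. G (col x))"
    unfolding continuous_map_Euclidean_space
    using G(2) by (intro conjI continuous_on_compose2[OF G(1) continuous_on_subset[OF ccol]]) auto
  then obtain F where F: "tverberg_partition (d + 1) q ((d + 1 + 1) * (q - 1)) (\<lambda>x. G (col x)) F"
    using tv by blast
  then have FN: "\<And>S. S \<in> F \<Longrightarrow> S \<subseteq> {..N + (q - 1)}" and cF: "card F = q" and dis: "pairwise disjnt F"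
    and int: "(\<Inter>S\<in>F. (\<lambda>x. G (col x)) ` face_realization S) \<noteq> {}"
    unfolding tverberg_partition_def N' by (auto simp: simplex_faces_def)
  have finF: "finite F" using cF q by (auto intro: card_ge_0_finite)
  obtain y where "\<And>S. S \<in> F \<Longrightarrow> y \<in> (\<lambda>x. G (col x)) ` face_realization S" using int by blast
  then have "\<forall>S\<in>F. \<exists>x. x \<in> face_realization S \<and> y = G (col x)" by blast
  then obtain x where x: "\<And>S. S \<in> F \<Longrightarrow> x S \<in> face_realization S" "\<And>S. S \<in> F \<Longrightarrow> y = G (col (x S))"
    by metis
  define T where "T S = S \<inter> {..N}" for S
  define c where "c S = col (x S)" for S
  have c: "c S \<in> face_realization (insert (Suc N) (T S))" "y = G (c S)" if "S \<in> F" for S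
    using face_realization_collapse[OF x(1)[OF that] FN[OF that]] x(2)[OF that]
    by (simp_all add: c_def col_def T_def)
  have TN: "T S \<subseteq> {..N}" "finite (T S)" for S by (auto simp: T_def)
  have small: "y = (f (c S))(d := c S (Suc N))" if "S \<in> F" "card (T S) \<le> d" for S
    using G(4)[rule_format, OF TN(1) that(2) c(1)[OF that(1)]] c(2)[OF that(1)] by simp
  have disT: "T S \<inter> T S' = {}" if "S \<in> F" "S' \<in> F" "S \<noteq> S'" for S S'
    using pairwiseD[OF dis that] by (auto simp: T_def disjnt_def)
  have "(\<Sum>S\<in>F. card (T S)) = card (\<Union>S\<in>F. T S)"
    using finF disT TN(2) by (intro card_UN_disjoint[symmetric]) auto
  also have "\<dots> \<le> card {..N}" using TN(1) by (intro card_mono) auto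
  finally have sumT: "(\<Sum>S\<in>F. card (T S)) \<le> N + 1" by simp
  have "y d = 0"
  proof (rule order.antisym)
    obtain S where S: "S \<in> F" "S \<subseteq> {..N}" using disjoint_faces_new_vertices[OF dis cF q FN] by blast
    have xN: "x S \<in> standard_simplex N"
      using x(1)[OF S(1)] face_realization_subset_standard_simplex[OF S(2)] by blast
    then have "x S i = 0" if "N < i" for i using that by (simp add: standard_simplex_def)
    then have "c S = x S" by (auto simp: c_def col_def)
    then show "y d \<le> 0" using G(3) xN c(2)[OF S(1)] by simp
    have "\<exists>S\<in>F. card (T S) \<le> d"
    proof (rule ccontr)
      assume "\<not> ?thesis"
      then have "d + 1 \<le> card (T S)" if "S \<in> F" for S using that by force
      then have "card F * (d + 1) \<le> (\<Sum>S\<in>F. card (T S))"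
        using sum_bounded_below[of F "d + 1" "\<lambda>S. card (T S)"] by simp
      then have "q * (d + 1) \<le> (d + 1) * (q - 1) + 1" using sumT cF by (simp add: N_def)
      then show False using d q by (cases q) auto
    qed
    then obtain S' where S': "S' \<in> F" "card (T S') \<le> d" by blast
    show "0 \<le> y d" using small[OF S'] face_realizationD(1)[OF c(1)[OF S'(1)]] by simp
  qed
  have yf: "y \<in> f ` face_realization (T S)" if S: "S \<in> F" "card (T S) \<le> d" for S
  proof -
    have n0: "c S (Suc N) = 0" using small[OF S] \<open>y d = 0\<close> by simp
    have "Suc N \<notin> T S" by (simp add: T_def)
    moreover have "c S i = 0" if "i \<notin> T S" for i
      using face_realizationD(2)[OF c(1)[OF S(1)], of i] that n0 by (cases "i = Suc N") auto
    ultimately have "c S \<in> face_realization (T S)"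
      using c(1)[OF S(1)] n0 TN(2)[of S] by (auto simp: face_realization_def)
    moreover have "y = f (c S)"
      using small[OF S] n0 f(2)[of "c S"] by (simp add: eucl_def fun_upd_idem)
    ultimately show ?thesis by blast
  qed
  \<comment> \<open>A face of new vertices only would be sent to the apex, whose height is one
    instead of zero.\<close>
  have neT: "T S \<noteq> {}" if "S \<in> F" for S
  proof
    assume e: "T S = {}"
    then have "y \<in> f ` face_realization (T S)" using yf[OF that] by simp
    then show False using e by (auto simp: face_realization_def)
  qed
  have injT: "inj_on T F"
  proof (rule inj_onI, rule ccontr)
    fix S S' assume "S \<in> F" "S' \<in> F" "T S = T S'" "S \<noteq> S'"
    then show False using disT[of S S'] neT[of S] by simp
  qed
  define Sm where "Sm = {S \<in> F. card (T S) \<le> d}"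
  have pdis: "pairwise disjnt (T ` F)"
  proof (rule pairwiseI)
    fix A B assume "A \<in> T ` F" "B \<in> T ` F" "A \<noteq> B"
    then show "disjnt A B" using disT by (auto simp: disjnt_def)
  qed
  have SmF: "T ` Sm \<subseteq> simplex_faces N (d - 1)"
    using neT TN(1) by (auto simp: simplex_faces_def face_dim_def Sm_def)
  have SmD: "pairwise disjnt (T ` Sm)" by (rule pairwise_subset[OF pdis]) (auto simp: Sm_def)
  have SmY: "y \<in> f ` face_realization A" if "A \<in> T ` Sm" for A using that yf by (auto simp: Sm_def)
  note gg = gen[folded N_def, OF SmF SmD SmY]
  have reindex: "(\<Sum>A\<in>T ` Sm. d + 1 - card A) = (\<Sum>S\<in>Sm. d + 1 - card (T S))"
    by (rule sum.reindex_cong[OF inj_on_subset[OF injT]]) (auto simp: Sm_def)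
  \<comment> \<open>Over all of \<open>F\<close> the terms of large sets can be negative, so the
    count is done in the integers; on \<open>Sm\<close> the natural subtraction agrees with
    it.\<close>
  have "int (\<Sum>S\<in>Sm. d + 1 - card (T S)) = (\<Sum>S\<in>Sm. int (d + 1) - int (card (T S)))"
    unfolding of_nat_sum by (intro sum.cong) (auto simp: Sm_def of_nat_diff)
  then have Smint: "(\<Sum>S\<in>Sm. int (d + 1) - int (card (T S))) \<le> int d"
    using gg reindex by linarith
  have split: "(\<Sum>S\<in>F. int (d + 1) - int (card (T S))) =
      (\<Sum>S\<in>F - Sm. int (d + 1) - int (card (T S))) + (\<Sum>S\<in>Sm. int (d + 1) - int (card (T S)))"
    using finF by (intro sum.subset_diff) (auto simp: Sm_def)
  have "(\<Sum>S\<in>F. int (d + 1) - int (card (T S))) = int q * int (d + 1) - int (\<Sum>S\<in>F. card (T S))"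
    using cF by (simp add: sum_subtractf)
  moreover have "int q * int (d + 1) - int (N + 1) = int d"
    using q by (cases q) (auto simp: N_def algebra_simps)
  ultimately have all_ge: "int d \<le> (\<Sum>S\<in>F. int (d + 1) - int (card (T S)))"
    using sumT by linarith
  have big_le: "int (d + 1) - int (card (T S)) \<le> 0" if "S \<in> F - Sm" for S
    using that by (auto simp: Sm_def)
  then have "(\<Sum>S\<in>F - Sm. int (d + 1) - int (card (T S))) \<le> 0" by (intro sum_nonpos) auto
  \<comment> \<open>The lower bound for \<open>F\<close> meets the upper bounds for
    \<open>Sm\<close> and for the rest, so all of them are equalities.\<close>
  then have Smeq: "(\<Sum>S\<in>Sm. int (d + 1) - int (card (T S))) = int d"
    and big0: "(\<Sum>S\<in>F - Sm. int (d + 1) - int (card (T S))) = 0"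
    using Smint split all_ge by linarith+
  have "d = (\<Sum>A\<in>T ` Sm. d + 1 - card A)"
    using Smeq \<open>int (\<Sum>S\<in>Sm. d + 1 - card (T S)) = _\<close> reindex by linarith
  then have yP: "y \<in> P" using gg by blast
  have big: "card (T S) = d + 1" if "S \<in> F - Sm" for S
  proof -
    have "(\<Sum>S\<in>F - Sm. int (card (T S)) - int (d + 1)) = 0"
      using big0 by (simp add: sum_subtractf)
    then have "\<forall>S\<in>F - Sm. int (card (T S)) - int (d + 1) = 0"
      using finF big_le by (subst (asm) sum_nonneg_eq_0_iff) auto
    then show ?thesis using that by force
  qed
  have "winding_partition d q f (T ` F)"
    unfolding winding_partition_def N_def[symmetric]
  proof (intro conjI bexI ballI impI)
    show "T ` F \<subseteq> simplex_faces N d"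
    proof (rule image_subsetI)
      fix S assume S: "S \<in> F"
      have "card (T S) \<le> d + 1" using big[of S] S by (cases "S \<in> Sm") (auto simp: Sm_def)
      then show "T S \<in> simplex_faces N d"
        using neT[OF S] TN(1) by (simp add: simplex_faces_def face_dim_def)
    qed
    show "card (T ` F) = q" using card_image[OF injT] cF by simp
    show "pairwise disjnt (T ` F)" by (rule pdis)
    show "y \<in> topspace (Euclidean_space d)"
      using yP P by (auto simp: topspace_Euclidean_space eucl_def)
    fix A assume "A \<in> T ` F"
    then obtain S where S: "S \<in> F" "A = T S" by blast
    have "0 < card A" using neT[OF S(1)] TN(2) S(2) by (simp add: card_gt_0_iff)
    then have fd: "face_dim A = card A - 1" "card A = face_dim A + 1" by (simp_all add: face_dim_def)
    { assume "face_dim A \<le> d - 1"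
      then have "card (T S) \<le> d" using fd d S(2) by simp
      then show "y \<in> f ` face_realization A" using yf[OF S(1)] S(2) by simp }
    { assume "face_dim A = d"
      then have "card (T S) = d + 1" using fd S(2) by simp
      then show "y \<in> winding_set d A f"
        using G(5)[rule_format, OF TN(1) _ c(1)[OF S(1)]] yP c(2)[OF S(1)] S(2) by simp }
  qed
  then show ?thesis by blast
qed

lemma winding_implies_tverberg:
  assumes d: "0 < d" and f: "continuous_on (standard_simplex ((d + 1) * (q - 1))) f"
    "f ` standard_simplex ((d + 1) * (q - 1)) \<subseteq> eucl d"
    and F: "winding_partition d q f F"
  shows "tverberg_partition d q ((d + 1) * (q - 1)) f F"
proof -
  define N where "N = (d + 1) * (q - 1)"
  note f = f[folded N_def]
  obtain p where p: "\<And>S. S \<in> F \<Longrightarrow> face_dim S \<le> d - 1 \<Longrightarrow> p \<in> f ` face_realization S"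
    "\<And>S. S \<in> F \<Longrightarrow> face_dim S = d \<Longrightarrow> p \<in> winding_set d S f"
    and FN: "F \<subseteq> simplex_faces N d" and cd: "card F = q" "pairwise disjnt F"
    using F unfolding winding_partition_def N_def by blast
  have S: "S \<subseteq> {..N}" "S \<noteq> {}" "face_dim S \<le> d" "finite S" if "S \<in> F" for S
    using FN that by (auto simp: simplex_faces_def intro: finite_subset)
  have "p \<in> f ` face_realization S" if SF: "S \<in> F" for S
  proof (cases "face_dim S = d")
    case True
    have "2 \<le> card S" using True d by (simp add: face_dim_def)
    moreover have "face_realization S \<subseteq> standard_simplex N"
      using face_realization_subset_standard_simplex[OF S(1)[OF SF]] by blast
    then have "continuous_on (face_realization S) f" "f ` face_realization S \<subseteq> eucl d"
      using f by (auto intro: continuous_on_subset)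
    ultimately show ?thesis
      using winding_set_subset_image[OF S(4)[OF SF]] p(2)[OF SF True] by blast
  next
    case False
    then show ?thesis using p(1)[OF SF] S(3)[OF SF] by simp
  qed
  \<comment> \<open>\<open>d\<close> can exceed \<open>N\<close>, for example when
    \<open>q = 1\<close>; the dimension bound \<open>N\<close> is read off from the number of
    vertices.\<close>
  moreover have "F \<subseteq> simplex_faces N N"
  proof
    fix S assume SF: "S \<in> F"
    have "card S \<le> card {..N}" using S(1)[OF SF] by (intro card_mono) auto
    then show "S \<in> simplex_faces N N" using S[OF SF] by (simp add: simplex_faces_def face_dim_def)
  qed
  ultimately show ?thesis
    using cd unfolding tverberg_partition_def N_def[symmetric] by blast
qed

lemma simplex_skeleton_subset: "simplex_skeleton N k \<subseteq> standard_simplex N"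
proof -
  have "face_realization S \<subseteq> standard_simplex N" if "S \<subseteq> {..N}" for S
    using face_realization_subset_standard_simplex[OF that] by blast
  then show ?thesis unfolding simplex_skeleton_def by (intro UN_least) (simp add: simplex_faces_def)
qed

lemma tverberg_implies_winding:
  assumes d: "0 < d" and q: "0 < q"
    and tv: "\<And>f. continuous_map (space_on (standard_simplex ((d + 1 + 1) * (q - 1)))) (Euclidean_space (d + 1)) f \<Longrightarrow>
      \<exists>F. tverberg_partition (d + 1) q ((d + 1 + 1) * (q - 1)) f F"
    and f: "continuous_on (simplex_skeleton ((d + 1) * (q - 1)) (d - 1)) f"
      "f ` simplex_skeleton ((d + 1) * (q - 1)) (d - 1) \<subseteq> eucl d"
  shows "\<exists>F. winding_partition d q f F"
proof (rule winding_partition_limit[OF d q f])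
  fix e :: real assume e: "0 < e"
  let ?N = "(d + 1) * (q - 1)"
  let ?K = "simplex_skeleton ?N (d - 1)"
  show "\<exists>g F. continuous_on ?K g \<and> g ` ?K \<subseteq> eucl d \<and> (\<forall>x\<in>?K. \<forall>j<d. \<bar>g x j - f x j\<bar> < e) \<and>
      winding_partition d q g F"
  proof (rule generic_approximation[OF d f(1) e])
    fix g0 P assume g0: "continuous_on (standard_simplex ?N) g0" "g0 ` standard_simplex ?N \<subseteq> eucl d"
      and close: "\<And>x j. x \<in> ?K \<Longrightarrow> j < d \<Longrightarrow> \<bar>g0 x j - f x j\<bar> < e"
      and P: "finite P" "P \<subseteq> eucl d"
      and gen: "\<And>F p. F \<subseteq> simplex_faces ?N (d - 1) \<Longrightarrow> pairwise disjnt F \<Longrightarrow>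
       (\<And>A. A \<in> F \<Longrightarrow> p \<in> g0 ` face_realization A) \<Longrightarrow>
       (\<Sum>A\<in>F. d + 1 - card A) \<le> d \<and> (d = (\<Sum>A\<in>F. d + 1 - card A) \<longrightarrow> p \<in> P)"
    obtain g where g: "continuous_on UNIV g" "\<And>x. g x \<in> eucl d" "\<And>x. x \<in> standard_simplex ?N \<Longrightarrow> g x = g0 x"
      using extend_to_eucl[OF compact_imp_closed[OF compact_standard_simplex] g0] by blast
    have "\<exists>F. winding_partition d q g F"
    proof (rule winding_partition_of_generic_map[OF d q tv g(1,2) P])
      fix F p assume F: "F \<subseteq> simplex_faces ?N (d - 1)" "pairwise disjnt F"
        and p: "\<And>A. A \<in> F \<Longrightarrow> p \<in> g ` face_realization A"
      have "p \<in> g0 ` face_realization A" if A: "A \<in> F" for A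
      proof -
        have "A \<subseteq> {..?N}" using F(1) A by (auto simp: simplex_faces_def)
        from face_realization_subset_standard_simplex[OF this]
        have "g ` face_realization A = g0 ` face_realization A" using g(3) by (intro image_cong) auto
        then show ?thesis using p[OF A] by simp
      qed
      then show "(\<Sum>A\<in>F. d + 1 - card A) \<le> d \<and> (d = (\<Sum>A\<in>F. d + 1 - card A) \<longrightarrow> p \<in> P)"
        by (rule gen[OF F])
    qed
    then obtain F where "winding_partition d q g F" by blast
    moreover have "\<bar>g x j - f x j\<bar> < e" if "x \<in> ?K" "j < d" for x j
      using close[OF that] g(3)[OF subsetD[OF simplex_skeleton_subset that(1)]] by simp
    moreover have "continuous_on ?K g" by (rule continuous_on_subset[OF g(1) subset_UNIV])
    moreover have "g ` ?K \<subseteq> eucl d" using g(2) by blast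
    ultimately show ?thesis by blast
  qed
qed

theorem theorem2p0p7:
  shows "(\<forall>d q :: nat. d > 0 \<longrightarrow> q > 0 \<longrightarrow>
            (\<forall>f. continuous_map (space_on (simplex_skeleton ((d + 1) * (q - 1)) (d - 1)))
                   (Euclidean_space d) f \<longrightarrow>
                 (\<exists>F. winding_partition d q f F)))
     \<longleftrightarrow>
         (\<forall>d q :: nat. d > 0 \<longrightarrow> q > 0 \<longrightarrow>
            (\<forall>f. continuous_map (space_on (standard_simplex ((d + 1) * (q - 1))))
                   (Euclidean_space d) f \<longrightarrow>
                 (\<exists>F. tverberg_partition d q ((d + 1) * (q - 1)) f F)))"
    (is "?winding \<longleftrightarrow> ?tverberg")
proof
  assume w: ?winding
  show ?tverberg
  proof (intro allI impI)
    fix d q :: nat and f assume d: "0 < d" and q: "0 < q"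
      and "continuous_map (space_on (standard_simplex ((d + 1) * (q - 1)))) (Euclidean_space d) f"
    then have f: "continuous_on (standard_simplex ((d + 1) * (q - 1))) f"
      "f ` standard_simplex ((d + 1) * (q - 1)) \<subseteq> eucl d"
      by (simp_all only: continuous_map_Euclidean_space)
    have "continuous_map (space_on (simplex_skeleton ((d + 1) * (q - 1)) (d - 1))) (Euclidean_space d) f"
      unfolding continuous_map_Euclidean_space
      using continuous_on_subset[OF f(1) simplex_skeleton_subset]
        order.trans[OF image_mono[OF simplex_skeleton_subset] f(2)] by (rule conjI)
    then obtain F where "winding_partition d q f F" using w d q by blast
    then show "\<exists>F. tverberg_partition d q ((d + 1) * (q - 1)) f F"
      using winding_implies_tverberg[OF d f] by blast
  qed
next
  assume t: ?tverberg
  show ?winding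
  proof (intro allI impI)
    fix d q :: nat and f assume d: "0 < d" and q: "0 < q"
      and "continuous_map (space_on (simplex_skeleton ((d + 1) * (q - 1)) (d - 1))) (Euclidean_space d) f"
    then have f: "continuous_on (simplex_skeleton ((d + 1) * (q - 1)) (d - 1)) f"
      "f ` simplex_skeleton ((d + 1) * (q - 1)) (d - 1) \<subseteq> eucl d"
      by (simp_all only: continuous_map_Euclidean_space)
    show "\<exists>F. winding_partition d q f F"
    proof (rule tverberg_implies_winding[OF d q _ f])
      \<comment> \<open>The hypothesis is used in dimension \<open>d + 1\<close>, so this direction
        relates different values of \<open>d\<close>.\<close>
      fix g assume "continuous_map (space_on (standard_simplex ((d + 1 + 1) * (q - 1)))) (Euclidean_space (d + 1)) g"
      then show "\<exists>F. tverberg_partition (d + 1) q ((d + 1 + 1) * (q - 1)) g F"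
        using t[rule_format, of "d + 1" q g] q by simp
    qed
  qed
qed

end
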